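(* Let $H$ be a complex Hilbert space with $\dim H\geq 2$. For a real number $p<1$ let $f_p(x)=\frac{x}{xp+(1-p)}$ $(x\in[0,1])$. (1) Let $\phi:E(H)\to E(H)$ be a bijective map which preserves the order in both directions (i.e., $A\leq B\Longleftrightarrow\phi(A)\leq\phi(B)$ for all $A,B\in E(H)$) and suppose that there is a single pair of scalars $\lambda,\mu\in\,]0,1[$ such that $\phi(\lambda I)=\mu I$. Then there exist an either unitary or antiunitary operator $U$ on $H$ and a real number $p<1$ such that \[ \phi(A)=U f_p(A)U^*\qquad (A\in E(H)). \] (2) In particular, the same conclusion (existence of such $U$ and $p$ with $\phi(A)=Uf_p(A)U^*$ for all $A\in E(H)$) holds for any bijection $\phi:E(H)\to E(H)$ which preserves the order and commutativity in both directions, i.e., for all $A,B\in E(H)$, $A\leq B\Longleftrightarrow\phi(A)\leq\phi(B)$ and $AB=BA\Longleftrightarrow\phi(A)\phi(B)=\phi(B)\phi(A)$.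
   Context: $E(H)$ denotes the set of all (Hilbert space) effects on $H$, i.e., all positive bounded linear operators $A$ on $H$ with $0\leq A\leq I$, where $I$ is the identity. The order $\leq$ is the usual order among self-adjoint bounded linear operators. $]0,1[$ is the open unit interval. $f_p(A)$ denotes the image of $f_p$ under the continuous functional calculus belonging to $A$. The phrase "there is a single pair" means that the existence of at least one such pair is assumed. *)

theory Defs
  imports "HOL-Analysis.Analysis" "HOL-Computational_Algebra.Polynomial"
begin

section \<open>Complex Hilbert spaces\<close>

text \<open>
  The complex inner product is linear in the first argument. The real structure of the
  superclasses is the underlying one: \<open>r *\<^sub>R x\<close> is multiplication by a real scalar and \<open>inner\<close> is
  the real part of \<open>cinner\<close>. Hence the inherited norm is \<open>sqrt (Re (cinner x x))\<close>, and
  definiteness of \<open>cinner\<close> is inherited from \<^class>\<open>real_inner\<close>.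
\<close>

class complex_hilbert = real_inner + banach +
  fixes scaleC :: "complex \<Rightarrow> 'a \<Rightarrow> 'a" (infixr "*\<^sub>C" 75)
    and cinner :: "'a \<Rightarrow> 'a \<Rightarrow> complex"
  assumes scaleC_add_right: "a *\<^sub>C (x + y) = a *\<^sub>C x + a *\<^sub>C y"
    and scaleC_add_left: "(a + b) *\<^sub>C x = a *\<^sub>C x + b *\<^sub>C x"
    and scaleC_scaleC: "a *\<^sub>C b *\<^sub>C x = (a * b) *\<^sub>C x"
    and scaleC_of_real: "complex_of_real r *\<^sub>C x = r *\<^sub>R x"
    and cinner_commute: "cinner x y = cnj (cinner y x)"
    and cinner_add_left: "cinner (x + y) z = cinner x z + cinner y z"
    and cinner_scaleC_left: "cinner (a *\<^sub>C x) y = a * cinner x y"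
    and inner_eq_Re_cinner: "inner x y = Re (cinner x y)"

global_interpretation complex_vector:
  vector_space "scaleC :: complex \<Rightarrow> 'a \<Rightarrow> 'a::complex_hilbert"
  defines cdependent = complex_vector.dependent
proof
  show "1 *\<^sub>C x = x" for x :: 'a
    using scaleC_of_real[of 1 x] by simp
qed (simp_all add: scaleC_add_right scaleC_add_left scaleC_scaleC)

text \<open>
  \<open>cdim_at_least n\<close> says that the complex dimension is at least \<open>n\<close>. The library's \<open>dim\<close> is not
  used because it is 0 for infinite-dimensional spaces, which are included here.
\<close>

definition cdim_at_least :: "nat \<Rightarrow> 'a::complex_hilbert itself \<Rightarrow> bool" where
  "cdim_at_least n _ \<longleftrightarrow> (\<exists>B :: 'a set. finite B \<and> card B = n \<and> \<not> cdependent B)"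

text \<open>
  \<open>complex ^ 'n\<close>, with its usual structure, is an instance.
\<close>

instantiation complex :: complex_hilbert
begin

definition scaleC_complex :: "complex \<Rightarrow> complex \<Rightarrow> complex" where
  "scaleC_complex a x = a * x"

definition cinner_complex :: "complex \<Rightarrow> complex \<Rightarrow> complex" where
  "cinner_complex x y = x * cnj y"

instance
  by standard
    (simp_all add: scaleC_complex_def cinner_complex_def algebra_simps scaleR_conv_of_real
      inner_complex_def)

end

instantiation vec :: (complex_hilbert, finite) complex_hilbert
begin

definition scaleC_vec :: "complex \<Rightarrow> 'a ^ 'b \<Rightarrow> 'a ^ 'b" where
  "scaleC_vec a x = (\<chi> i. a *\<^sub>C x $ i)"

definition cinner_vec :: "'a ^ 'b \<Rightarrow> 'a ^ 'b \<Rightarrow> complex" where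
  "cinner_vec x y = (\<Sum>i\<in>UNIV. cinner (x $ i) (y $ i))"

instance
proof
  fix x y :: "'a ^ 'b"
  show "cinner x y = cnj (cinner y x)"
    unfolding cinner_vec_def cnj_sum by (intro sum.cong refl cinner_commute)
qed (simp_all add: scaleC_vec_def cinner_vec_def vec_eq_iff scaleC_add_right scaleC_add_left
      scaleC_scaleC scaleC_of_real cinner_add_left cinner_scaleC_left inner_vec_def
      inner_eq_Re_cinner sum.distrib sum_distrib_left)

end


section \<open>Operators\<close>

text \<open>
  The type \<open>'h \<Rightarrow>\<^sub>L 'h\<close> consists of the bounded \<^emph>\<open>real\<close>-linear maps. It contains both the bounded
  complex-linear and the bounded conjugate-linear operators, singled out by the following
  predicates; its norm is the usual operator norm.
\<close>

definition clinear_op :: "('h::complex_hilbert \<Rightarrow>\<^sub>L 'h) \<Rightarrow> bool" where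
  "clinear_op A \<longleftrightarrow> (\<forall>c x. blinfun_apply A (c *\<^sub>C x) = c *\<^sub>C blinfun_apply A x)"

definition antilinear_op :: "('h::complex_hilbert \<Rightarrow>\<^sub>L 'h) \<Rightarrow> bool" where
  "antilinear_op A \<longleftrightarrow> (\<forall>c x. blinfun_apply A (c *\<^sub>C x) = cnj c *\<^sub>C blinfun_apply A x)"

text \<open>
  The adjoint of a conjugate-linear operator \<open>U\<close> is given by
  \<open>\<langle>U x, y\<rangle> = cnj \<langle>x, U\<^sup>* y\<rangle>\<close>.
\<close>

definition adj_op :: "('h::complex_hilbert \<Rightarrow>\<^sub>L 'h) \<Rightarrow> ('h \<Rightarrow>\<^sub>L 'h)" where
  "adj_op U = (THE V. \<forall>x y. cinner (blinfun_apply U x) y =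
     (if antilinear_op U then cnj (cinner x (blinfun_apply V y))
      else cinner x (blinfun_apply V y)))"

definition unitary_op :: "('h::complex_hilbert \<Rightarrow>\<^sub>L 'h) \<Rightarrow> bool" where
  "unitary_op U \<longleftrightarrow> clinear_op U \<and> surj (blinfun_apply U) \<and>
     (\<forall>x y. cinner (blinfun_apply U x) (blinfun_apply U y) = cinner x y)"

definition antiunitary_op :: "('h::complex_hilbert \<Rightarrow>\<^sub>L 'h) \<Rightarrow> bool" where
  "antiunitary_op U \<longleftrightarrow> antilinear_op U \<and> surj (blinfun_apply U) \<and>
     (\<forall>x y. cinner (blinfun_apply U x) (blinfun_apply U y) = cnj (cinner x y))"

definition selfadjoint_op :: "('h::complex_hilbert \<Rightarrow>\<^sub>L 'h) \<Rightarrow> bool" where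
  "selfadjoint_op A \<longleftrightarrow> clinear_op A \<and>
     (\<forall>x y. cinner (blinfun_apply A x) y = cinner x (blinfun_apply A y))"

text \<open>
  For selfadjoint \<open>A\<close> the number \<open>cinner (A x) x\<close> is real, so taking real parts loses nothing.
\<close>

definition op_le :: "('h::complex_hilbert \<Rightarrow>\<^sub>L 'h) \<Rightarrow> ('h \<Rightarrow>\<^sub>L 'h) \<Rightarrow> bool" (infix "\<le>\<^sub>o" 50) where
  "A \<le>\<^sub>o B \<longleftrightarrow> selfadjoint_op A \<and> selfadjoint_op B \<and>
     (\<forall>x. Re (cinner (blinfun_apply A x) x) \<le> Re (cinner (blinfun_apply B x) x))"

definition effects :: "('h::complex_hilbert \<Rightarrow>\<^sub>L 'h) set" where
  "effects = {A. 0 \<le>\<^sub>o A \<and> A \<le>\<^sub>o id_blinfun}"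


section \<open>Continuous functional calculus\<close>

definition spectrum_op :: "('h::complex_hilbert \<Rightarrow>\<^sub>L 'h) \<Rightarrow> complex set" where
  "spectrum_op A = {z. \<not> (\<exists>B. clinear_op B \<and>
     (\<forall>x. blinfun_apply B (blinfun_apply A x - z *\<^sub>C x) = x) \<and>
     (\<forall>x. blinfun_apply A (blinfun_apply B x) - z *\<^sub>C blinfun_apply B x = x))}"

definition poly_op :: "real poly \<Rightarrow> ('h::complex_hilbert \<Rightarrow>\<^sub>L 'h) \<Rightarrow> ('h \<Rightarrow>\<^sub>L 'h)" where
  "poly_op q A = (\<Sum>i\<le>degree q. coeff q i *\<^sub>R (((o\<^sub>L) A) ^^ i) id_blinfun)"

text \<open>
  Continuous functional calculus for selfadjoint \<open>A\<close> and a real function \<open>f\<close> that is continuous on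
  the spectrum: \<open>f(A)\<close> is the norm limit of \<open>q\<^sub>n(A)\<close> whenever the polynomials \<open>q\<^sub>n\<close> converge to
  \<open>f\<close> uniformly on the spectrum. The spectrum of a selfadjoint operator is real, so only its
  real points need to be considered, and real polynomials suffice by the Weierstrass theorem.
\<close>

definition cfc :: "(real \<Rightarrow> real) \<Rightarrow> ('h::complex_hilbert \<Rightarrow>\<^sub>L 'h) \<Rightarrow> ('h \<Rightarrow>\<^sub>L 'h)" where
  "cfc f A = (THE B. \<forall>q :: nat \<Rightarrow> real poly.
     uniform_limit {t. complex_of_real t \<in> spectrum_op A} (\<lambda>n. poly (q n)) f sequentially
     \<longrightarrow> (\<lambda>n. poly_op (q n) A) \<longlonglongrightarrow> B)"

text \<open>Only used for \<open>p < 1\<close> and \<open>x\<close> in \<open>[0,1]\<close>, where the denominator is positive.\<close>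

definition fp_fun :: "real \<Rightarrow> real \<Rightarrow> real" where
  "fp_fun p x = x / (x * p + (1 - p))"

end

theory Submission
  imports Defs "HOL-Computational_Algebra.Fundamental_Theorem_Algebra"
begin

text \<open>
  The idea is to linearize the problem. The map \<open>A \<mapsto> A\<^sup>-\<^sup>1 - I\<close> is an order-reversing bijection from
  the invertible effects onto the cone of positive operators, and on the cone the function \<open>f\<^sub>p\<close> is
  just multiplication by \<open>1 - p\<close>. So it has to be shown that \<open>\<phi>\<close> induces on the cone a map
  \<open>B \<mapsto> k U B U\<^sup>*\<close> with \<open>U\<close> unitary or antiunitary.

  The order determines the rank-one effects, as those whose lower set is a chain
  (\<open>rank_one_iff_chain\<close>). Hence \<open>\<phi>\<close> induces a map of lines and, on each line, an increasing
  bijection of \<open>[0, 1]\<close>. It also determines the invertible effects, as those that dominate a positive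
  multiple of every rank-one projection (\<open>pointwise_lower_bound_imp_coercive\<close>, a Baire argument). The
  largest \<open>t\<close> for which \<open>t\<close> times the projection onto the line of a unit vector \<open>x\<close> is below an
  invertible \<open>A\<close> equals \<open>1 / \<langle>A\<^sup>-\<^sup>1 x, x\<rangle>\<close> (\<open>rank1_le_coercive_iff\<close>). Therefore the map \<open>\<psi>\<close> induced on
  the cone satisfies \<open>\<langle>\<psi> B (\<sigma> x), \<sigma> x\<rangle> = h\<^sub>x \<langle>B x, x\<rangle>\<close> with increasing functions \<open>h\<^sub>x\<close>.

  Such a pointwise transport of positive forms is rigid. Forms with prescribed kernel show that \<open>\<sigma>\<close>
  maps complex planes to complex planes and that the functions \<open>h\<^sub>x\<close> are proportional up to rescaling of
  their arguments; diagonal forms on a plane and the parallelogram identity then give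
  \<open>h\<^sub>x (s + t) = h\<^sub>x s + h\<^sub>x t\<close> (\<open>h_additive\<close>). An
  increasing additive function is linear, so \<open>h\<^sub>x\<close> is multiplication by a constant. The assumption
  \<open>\<phi> (\<lambda> I) = \<mu> I\<close> says that the constant is the same number \<open>k\<close> for
  all unit vectors, and that \<open>\<sigma>\<close>, normalized, preserves \<open>\<bar>\<langle>x, y\<rangle>\<bar>\<close> (\<open>normalized_transport\<close>). Wigner's
  theorem supplies \<open>U\<close>, and \<open>p = 1 - k\<close>.

  This gives the formula for invertible effects. Every effect is the infimum of the invertible effects
  \<open>A + (I - A) / (n + 1)\<close>, and both sides of the formula respect this infimum
  (\<open>automorphism_form\<close>). That the operator found is the value of the continuous functional calculus is
  \<open>cfc_fp\<close>; it rests on the estimate of \<open>\<parallel>r(A)\<parallel>\<close> by the maximum of \<open>\<bar>r\<bar>\<close> on the spectrum.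

  If \<open>\<phi>\<close> preserves commutativity, then \<open>\<phi> (I / 2)\<close> commutes with all effects, so it is a scalar
  operator, and neither \<open>0\<close> nor \<open>I\<close>. This reduces the second part to the first.
\<close>

section \<open>The inner product\<close>

lemma cinner_add_right: "cinner x (y + z) = cinner x y + cinner x z"
  for x y z :: "'h::complex_hilbert"
  by (metis cinner_add_left cinner_commute complex_cnj_add)

lemma cinner_scaleC_right: "cinner x (a *\<^sub>C y) = cnj a * cinner x y"
  for x y :: "'h::complex_hilbert"
  by (metis cinner_commute cinner_scaleC_left complex_cnj_mult)

lemma cinner_zero_left [simp]: "cinner 0 (y::'h::complex_hilbert) = 0"
  using cinner_add_left[of 0 0 y] by simp

lemma cinner_zero_right [simp]: "cinner (y::'h::complex_hilbert) 0 = 0"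
  using cinner_add_right[of y 0 0] by simp

lemma cinner_minus_left [simp]: "cinner (- x) y = - cinner x y"
  for x y :: "'h::complex_hilbert"
  using cinner_add_left[of x "- x" y] by (simp add: eq_neg_iff_add_eq_0 add.commute)

lemma cinner_minus_right [simp]: "cinner x (- y) = - cinner x y"
  for x y :: "'h::complex_hilbert"
  using cinner_add_right[of x y "- y"] by (simp add: eq_neg_iff_add_eq_0 add.commute)

lemma cinner_diff_left: "cinner (x - y) z = cinner x z - cinner y z"
  for x y z :: "'h::complex_hilbert"
  using cinner_add_left[of x "- y" z] by simp

lemma cinner_diff_right: "cinner x (y - z) = cinner x y - cinner x z"
  for x y z :: "'h::complex_hilbert"
  using cinner_add_right[of x y "- z"] by simp

lemma cinner_scaleR_left: "cinner (r *\<^sub>R x) y = of_real r * cinner x y"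
  for x y :: "'h::complex_hilbert"
  by (metis cinner_scaleC_left scaleC_of_real)

lemma cinner_scaleR_right: "cinner x (r *\<^sub>R y) = of_real r * cinner x y"
  for x y :: "'h::complex_hilbert"
  by (metis cinner_scaleC_right complex_cnj_complex_of_real scaleC_of_real)

lemmas cinner_simps = cinner_add_left cinner_add_right cinner_diff_left cinner_diff_right
  cinner_scaleC_left cinner_scaleC_right cinner_scaleR_left cinner_scaleR_right

lemma cinner_self: "cinner x x = of_real ((norm x)\<^sup>2)" for x :: "'h::complex_hilbert"
proof (rule complex_eqI)
  show "Re (cinner x x) = Re (of_real ((norm x)\<^sup>2))"
    by (simp add: inner_eq_Re_cinner[symmetric] power2_norm_eq_inner)
  show "Im (cinner x x) = Im (of_real ((norm x)\<^sup>2))"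
    using cinner_commute[of x x] by (simp add: complex_eq_iff)
qed

lemma cmod_cinner_self: "cmod (cinner x x) = (norm x)\<^sup>2" for x :: "'h::complex_hilbert"
  unfolding cinner_self norm_of_real by simp

lemma Re_cinner: "Re (cinner x y) = x \<bullet> y" for x y :: "'h::complex_hilbert"
  by (simp add: inner_eq_Re_cinner)

lemma Im_cinner: "Im (cinner x y) = x \<bullet> (\<i> *\<^sub>C y)" for x y :: "'h::complex_hilbert"
  by (simp add: inner_eq_Re_cinner cinner_simps)

lemma cinner_eq_0_commute: "cinner x y = 0 \<longleftrightarrow> cinner y x = 0"
  for x y :: "'h::complex_hilbert"
  by (metis cinner_commute complex_cnj_zero)

lemma of_real_cmod_square: "(of_real (cmod z))\<^sup>2 = z * cnj z"
  by (metis complex_norm_square of_real_power)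

lemma norm_scaleC: "norm (a *\<^sub>C x) = cmod a * norm x" for x :: "'h::complex_hilbert"
proof -
  have "cinner (a *\<^sub>C x) (a *\<^sub>C x) = of_real ((cmod a * norm x)\<^sup>2)"
    by (simp only: cinner_scaleC_left cinner_scaleC_right cinner_self[of x] power_mult_distrib
        of_real_mult of_real_power of_real_cmod_square ac_simps)
  then have "(norm (a *\<^sub>C x))\<^sup>2 = (cmod a * norm x)\<^sup>2"
    unfolding cinner_self of_real_eq_iff .
  then show ?thesis by simp
qed

lemma cinner_ext: "x = y" if "\<And>z. cinner x z = cinner y z" for x y :: "'h::complex_hilbert"
proof -
  have "cinner (x - y) (x - y) = 0" using that by (simp add: cinner_simps)
  then show ?thesis by (simp add: cinner_self)
qed

lemma scaleC_simps [simp]: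
  "0 *\<^sub>C (x::'h::complex_hilbert) = 0" "a *\<^sub>C (0::'h) = 0" "1 *\<^sub>C x = x" "(- 1) *\<^sub>C x = - x"
  by simp_all

lemma scaleR_scaleC: "r *\<^sub>R x = complex_of_real r *\<^sub>C x" for x :: "'h::complex_hilbert"
  by (simp add: scaleC_of_real)

lemma phase_exists: "\<exists>w::complex. cmod w = 1 \<and> w * z = of_real (cmod z)"
proof (cases "z = 0")
  case True then show ?thesis by (intro exI[of _ 1]) simp
next
  case False
  then show ?thesis
    by (intro exI[of _ "cnj z / of_real (cmod z)"])
      (simp add: norm_divide complex_norm_square[symmetric] mult.commute power2_eq_square)
qed

lemma complex_Cauchy_Schwarz: "cmod (cinner x y) \<le> norm x * norm y"
  for x y :: "'h::complex_hilbert"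
proof -
  obtain w where w: "cmod w = 1" "w * cinner x y = of_real (cmod (cinner x y))"
    using phase_exists by blast
  have "cmod (cinner x y) = (w *\<^sub>C x) \<bullet> y"
    by (simp add: inner_eq_Re_cinner cinner_simps w)
  also have "\<dots> \<le> norm (w *\<^sub>C x) * norm y" by (rule norm_cauchy_schwarz)
  finally show ?thesis by (simp add: norm_scaleC w)
qed

section \<open>Selfadjoint and positive operators\<close>

lemma clinear_op_scaleC: "clinear_op A \<Longrightarrow> A (c *\<^sub>C x) = c *\<^sub>C A x"
  by (simp add: clinear_op_def)

lemma selfadjoint_clinear: "selfadjoint_op A \<Longrightarrow> clinear_op A"
  by (simp add: selfadjoint_op_def)

lemma selfadjoint_scaleC: "selfadjoint_op A \<Longrightarrow> A (c *\<^sub>C x) = c *\<^sub>C A x"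
  by (simp add: selfadjoint_clinear clinear_op_scaleC)

lemma selfadjoint_cinner: "selfadjoint_op A \<Longrightarrow> cinner (A x) y = cinner x (A y)"
  by (simp add: selfadjoint_op_def)

lemma selfadjoint_inner: "selfadjoint_op A \<Longrightarrow> A x \<bullet> y = x \<bullet> A y"
  by (simp add: inner_eq_Re_cinner selfadjoint_cinner)

lemma selfadjoint_id: "selfadjoint_op id_blinfun"
  by (simp add: selfadjoint_op_def clinear_op_def)

lemma selfadjoint_zero: "selfadjoint_op 0"
  by (simp add: selfadjoint_op_def clinear_op_def)

lemma selfadjoint_add: "selfadjoint_op A \<Longrightarrow> selfadjoint_op B \<Longrightarrow> selfadjoint_op (A + B)"
  by (simp add: selfadjoint_op_def clinear_op_def blinfun.add_left cinner_simps scaleC_add_right)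

lemma selfadjoint_scaleR: "selfadjoint_op A \<Longrightarrow> selfadjoint_op (r *\<^sub>R A)"
  by (simp add: selfadjoint_op_def clinear_op_def blinfun.scaleR_left cinner_simps
      scaleC_scaleC scaleR_scaleC mult.commute)

lemma selfadjoint_diff: "selfadjoint_op A \<Longrightarrow> selfadjoint_op B \<Longrightarrow> selfadjoint_op (A - B)"
  using selfadjoint_add[of A "(-1) *\<^sub>R B"] selfadjoint_scaleR[of B "-1"] by simp

lemmas selfadjoint_intros = selfadjoint_id selfadjoint_zero selfadjoint_add selfadjoint_scaleR
  selfadjoint_diff

lemma op_le_iff: "A \<le>\<^sub>o B \<longleftrightarrow>
    selfadjoint_op A \<and> selfadjoint_op B \<and> (\<forall>x. A x \<bullet> x \<le> B x \<bullet> x)"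
  by (simp add: op_le_def inner_eq_Re_cinner)

lemma op_le_refl: "selfadjoint_op A \<Longrightarrow> A \<le>\<^sub>o A"
  by (simp add: op_le_iff)

lemma op_le_trans: "A \<le>\<^sub>o B \<Longrightarrow> B \<le>\<^sub>o C \<Longrightarrow> A \<le>\<^sub>o C"
  unfolding op_le_iff by (meson order_trans)

lemma pos_op_iff: "0 \<le>\<^sub>o A \<longleftrightarrow> selfadjoint_op A \<and> (\<forall>x. 0 \<le> A x \<bullet> x)"
  by (auto simp: op_le_iff selfadjoint_zero)

lemma selfadjoint_eq_0: "A = 0" if A: "selfadjoint_op A" and q: "\<And>x. A x \<bullet> x = 0"
proof -
  have "A x \<bullet> y = 0" for x y
  proof -
    have "A (x + y) \<bullet> (x + y) = 2 * (A x \<bullet> y)"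
      using q[of x] q[of y] selfadjoint_inner[OF A, of y x]
      by (simp add: blinfun.add_right inner_simps inner_commute)
    then show ?thesis using q by simp
  qed
  then have "A x = 0" for x by (metis inner_eq_zero_iff)
  then show ?thesis by (intro blinfun_eqI) simp
qed

lemma selfadjoint_eqI: "A = B"
  if "selfadjoint_op A" "selfadjoint_op B" "\<And>x. A x \<bullet> x = B x \<bullet> x"
  using selfadjoint_eq_0[OF selfadjoint_diff[OF that(1,2)]] that(3)
  by (simp add: blinfun.diff_left inner_diff_left)

lemma op_le_antisym: "A \<le>\<^sub>o B \<Longrightarrow> B \<le>\<^sub>o A \<Longrightarrow> A = B"
  by (intro selfadjoint_eqI) (auto simp: op_le_iff intro: antisym)

lemma quadratic_nonneg_discriminant:
  fixes a b c :: real
  assumes "\<And>t. 0 \<le> a + 2 * t * b + t\<^sup>2 * c" and "0 \<le> c"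
  shows "b\<^sup>2 \<le> a * c"
proof (cases "c = 0")
  case True
  have "b = 0"
  proof (rule ccontr)
    assume "b \<noteq> 0"
    then have "a + 2 * (- (a + 1) / (2 * b)) * b + (- (a + 1) / (2 * b))\<^sup>2 * c = -1"
      using True by (simp add: field_simps)
    with assms(1)[of "- (a + 1) / (2 * b)"] show False by linarith
  qed
  then show ?thesis by (simp add: True)
next
  case False
  with assms(2) have c: "c > 0" by simp
  have "a + 2 * (- b / c) * b + (- b / c)\<^sup>2 * c = a - b\<^sup>2 / c"
    using c by (simp add: field_simps power2_eq_square)
  with assms(1)[of "- b / c"] have "b\<^sup>2 / c \<le> a" by simp
  then show ?thesis using c by (simp add: field_simps)
qed

lemma pos_op_Cauchy_Schwarz_real:
  assumes "0 \<le>\<^sub>o A" shows "(A x \<bullet> y)\<^sup>2 \<le> (A x \<bullet> x) * (A y \<bullet> y)"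
proof (rule quadratic_nonneg_discriminant)
  have sa: "selfadjoint_op A" and q: "\<And>x. 0 \<le> A x \<bullet> x" using assms by (auto simp: pos_op_iff)
  show "0 \<le> A y \<bullet> y" by (rule q)
  fix t :: real
  have "A (x + t *\<^sub>R y) \<bullet> (x + t *\<^sub>R y) = A x \<bullet> x + 2 * t * (A x \<bullet> y) + t\<^sup>2 * (A y \<bullet> y)"
    using selfadjoint_inner[OF sa, of y x]
    by (simp add: blinfun.add_right blinfun.scaleR_right inner_simps inner_commute
        power2_eq_square algebra_simps)
  then show "0 \<le> A x \<bullet> x + 2 * t * (A x \<bullet> y) + t\<^sup>2 * (A y \<bullet> y)" using q by metis
qed

lemma selfadjoint_form_scaleC:
  assumes "selfadjoint_op A" shows "A (c *\<^sub>C x) \<bullet> (c *\<^sub>C x) = (cmod c)\<^sup>2 * (A x \<bullet> x)"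
proof -
  have "cinner (A (c *\<^sub>C x)) (c *\<^sub>C x) = of_real ((cmod c)\<^sup>2) * cinner (A x) x"
    by (simp add: selfadjoint_scaleC[OF assms] cinner_simps of_real_cmod_square ac_simps)
  then show ?thesis by (simp add: inner_eq_Re_cinner)
qed

lemma pos_op_Cauchy_Schwarz:
  assumes "0 \<le>\<^sub>o A" shows "(cmod (cinner (A x) y))\<^sup>2 \<le> (A x \<bullet> x) * (A y \<bullet> y)"
proof -
  have sa: "selfadjoint_op A" using assms by (auto simp: pos_op_iff)
  obtain w where w: "cmod w = 1" "w * cinner (A x) y = of_real (cmod (cinner (A x) y))"
    using phase_exists by blast
  have "cmod (cinner (A x) y) = A (w *\<^sub>C x) \<bullet> y"
    by (simp add: inner_eq_Re_cinner selfadjoint_scaleC[OF sa] cinner_simps w)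
  then show ?thesis
    using pos_op_Cauchy_Schwarz_real[OF assms, of "w *\<^sub>C x" y]
    by (simp add: selfadjoint_form_scaleC[OF sa] w)
qed

lemma pos_op_kernel: "A x \<bullet> x = 0 \<longleftrightarrow> A x = 0" if "0 \<le>\<^sub>o A"
  using pos_op_Cauchy_Schwarz_real[OF that, of x "A x"] by auto

section \<open>Rank-one operators\<close>

definition rank1 :: "'h::complex_hilbert \<Rightarrow> 'h \<Rightarrow>\<^sub>L 'h" where
  "rank1 v = Blinfun (\<lambda>x. cinner x v *\<^sub>C v)"

lemma rank1_apply: "rank1 v x = cinner x v *\<^sub>C v"
proof -
  have "bounded_linear (\<lambda>x. cinner x v *\<^sub>C v)"
  proof (rule bounded_linear_intro[of _ "norm v * norm v"])
    show "norm (cinner x v *\<^sub>C v) \<le> norm x * (norm v * norm v)" for x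
      using mult_right_mono[OF complex_Cauchy_Schwarz[of x v], of "norm v"]
      by (simp add: norm_scaleC mult.assoc)
  qed (simp_all add: cinner_simps scaleC_add_left scaleR_scaleC scaleC_scaleC)
  then show ?thesis by (simp add: rank1_def bounded_linear_Blinfun_apply)
qed

lemma rank1_form: "rank1 v x \<bullet> x = (cmod (cinner x v))\<^sup>2"
proof -
  have "cinner (rank1 v x) x = of_real ((cmod (cinner x v))\<^sup>2)"
    by (subst complex_norm_square) (simp add: rank1_apply cinner_simps cinner_commute[of v x])
  then show ?thesis by (simp add: inner_eq_Re_cinner)
qed

lemma rank1_pos: "0 \<le>\<^sub>o rank1 v"
proof -
  have "selfadjoint_op (rank1 v)"
    unfolding selfadjoint_op_def clinear_op_def
    by (simp add: rank1_apply cinner_simps scaleC_scaleC cinner_commute[of v])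
  then show ?thesis by (simp add: pos_op_iff rank1_form)
qed

lemma rank1_selfadjoint: "selfadjoint_op (rank1 v)"
  using rank1_pos[of v] by (simp add: pos_op_iff)

lemma rank1_scaleC: "rank1 (c *\<^sub>C v) = (cmod c)\<^sup>2 *\<^sub>R rank1 v"
  by (intro selfadjoint_eqI rank1_selfadjoint selfadjoint_scaleR)
    (simp add: rank1_form cinner_simps norm_mult blinfun.scaleR_left power_mult_distrib)

section \<open>Inverses of coercive operators\<close>

text \<open>
  For a positive operator this is bounded invertibility.
\<close>

definition coercive_op :: "('h::complex_hilbert \<Rightarrow>\<^sub>L 'h) \<Rightarrow> bool" where
  "coercive_op A \<longleftrightarrow> selfadjoint_op A \<and> (\<exists>e>0. \<forall>x. e * (x \<bullet> x) \<le> A x \<bullet> x)"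

text \<open>
  A coercive operator has a bounded inverse, so there the abstraction function \<open>Blinfun\<close> is applied to
  a bounded linear map; otherwise the value is arbitrary.
\<close>

definition op_inv :: "('h::complex_hilbert \<Rightarrow>\<^sub>L 'h) \<Rightarrow> 'h \<Rightarrow>\<^sub>L 'h" where
  "op_inv A = Blinfun (inv (blinfun_apply A))"

lemma coercive_selfadjoint: "coercive_op A \<Longrightarrow> selfadjoint_op A"
  by (simp add: coercive_op_def)

lemma coercive_pos: "coercive_op A \<Longrightarrow> 0 \<le>\<^sub>o A"
  unfolding coercive_op_def pos_op_iff
  by (meson inner_ge_zero mult_nonneg_nonneg order_less_imp_le order_trans)

lemma form_bound_below: 
  fixes A :: "'h::complex_hilbert \<Rightarrow>\<^sub>L 'h"
  assumes "e * (x \<bullet> x) \<le> A x \<bullet> x" shows "e * norm x \<le> norm (A x)"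
proof (cases "x = 0")
  case False
  have "e * norm x * norm x \<le> norm (A x) * norm x"
    using assms norm_cauchy_schwarz[of "A x" x]
    by (simp add: power2_norm_eq_inner[symmetric] power2_eq_square mult.assoc)
  then show ?thesis using False by simp
qed simp

text \<open>
  Solving \<open>A x = y\<close> is a fixed point problem for \<open>x \<mapsto> x - s (A x - y)\<close>. Since
  \<open>\<parallel>x - s A x\<parallel>\<^sup>2 = \<parallel>x\<parallel>\<^sup>2 - 2 s \<langle>A x, x\<rangle> + s\<^sup>2 \<parallel>A x\<parallel>\<^sup>2\<close>, coercivity makes this map a contraction for
  small \<open>s\<close>. The choice below is \<open>s = e / M\<close>; the summand \<open>e\<^sup>2\<close> in \<open>M\<close> keeps \<open>M\<close> and the contraction
  constant in range.
\<close>

lemma coercive_bij: assumes A: "coercive_op A" shows "bij (blinfun_apply A)"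
proof -
  obtain e where e: "e > 0" "\<And>x. e * (x \<bullet> x) \<le> A x \<bullet> x"
    using A by (auto simp: coercive_op_def)
  define M where "M = (norm A)\<^sup>2 + e\<^sup>2"
  have M: "M > 0" using e by (simp add: M_def add_nonneg_pos)
  define c where "c = 1 - e\<^sup>2 / M"
  have c: "0 \<le> c" "c < 1"
    using M e by (auto simp: c_def field_simps M_def)
  have contr: "norm (x - (e / M) *\<^sub>R A x) \<le> sqrt c * norm x" for x
  proof -
    have nA: "(norm (A x))\<^sup>2 \<le> M * (norm x)\<^sup>2"
    proof -
      have "(norm (A x))\<^sup>2 \<le> (norm A * norm x)\<^sup>2"
        by (intro power_mono norm_blinfun) simp
      also have "\<dots> \<le> M * (norm x)\<^sup>2"
        by (simp add: M_def power_mult_distrib mult_right_mono)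
      finally show ?thesis .
    qed
    have "(norm (x - (e / M) *\<^sub>R A x))\<^sup>2
        = (norm x)\<^sup>2 - 2 * (e / M) * (A x \<bullet> x) + (e / M)\<^sup>2 * (norm (A x))\<^sup>2"
      unfolding power2_norm_eq_inner
      by (simp add: inner_simps inner_commute power2_eq_square algebra_simps)
    also have "\<dots> \<le> (norm x)\<^sup>2 - 2 * (e / M) * (e * (norm x)\<^sup>2) + (e / M)\<^sup>2 * (M * (norm x)\<^sup>2)"
      using e(1) M e(2)[of x] nA
      by (intro add_mono diff_mono mult_left_mono) (auto simp: power2_norm_eq_inner)
    also have "\<dots> = c * (norm x)\<^sup>2"
      using M by (simp add: c_def field_simps power2_eq_square)
    finally have "norm (x - (e / M) *\<^sub>R A x) \<le> sqrt (c * (norm x)\<^sup>2)"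
      by (simp add: real_le_rsqrt)
    then show ?thesis by (simp add: real_sqrt_mult)
  qed
  have "\<exists>x. A x = y" for y
  proof -
    have "\<exists>!x. (\<lambda>x. x - (e / M) *\<^sub>R (A x - y)) x = x"
    proof (rule banach_fix_type)
      show "0 \<le> sqrt c" "sqrt c < 1" using c by auto
      show "\<forall>x z. dist (x - (e / M) *\<^sub>R (A x - y)) (z - (e / M) *\<^sub>R (A z - y)) \<le> sqrt c * dist x z"
      proof (intro allI)
        fix x z
        have "(x - (e / M) *\<^sub>R (A x - y)) - (z - (e / M) *\<^sub>R (A z - y))
            = (x - z) - (e / M) *\<^sub>R A (x - z)"
          by (simp add: blinfun.diff_right algebra_simps)
        then show "dist (x - (e / M) *\<^sub>R (A x - y)) (z - (e / M) *\<^sub>R (A z - y)) \<le> sqrt c * dist x z"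
          using contr[of "x - z"] by (simp only: dist_norm)
      qed
    qed
    then obtain x where "(e / M) *\<^sub>R (A x - y) = 0" by auto
    then show ?thesis using e M by auto
  qed
  then have "surj (blinfun_apply A)" by (metis surjI)
  moreover have "inj (blinfun_apply A)"
  proof (rule injI)
    fix x y assume "A x = A y"
    then have "e * norm (x - y) \<le> 0"
      using form_bound_below[OF e(2)[of "x - y"]] by (simp add: blinfun.diff_right)
    with e(1) show "x = y" by (simp add: mult_le_0_iff)
  qed
  ultimately show ?thesis by (simp add: bij_def)
qed

lemma op_inv_apply: assumes A: "coercive_op A" shows "op_inv A x = inv (blinfun_apply A) x"
proof -
  obtain e where e: "e > 0" "\<And>x. e * (x \<bullet> x) \<le> A x \<bullet> x"
    using A by (auto simp: coercive_op_def)
  let ?I = "inv (blinfun_apply A)"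
  have AI [simp]: "A (?I x) = x" "?I (A x) = x" for x
    using coercive_bij[OF A] by (simp_all add: bij_is_surj surj_f_inv_f bij_is_inj)
  have "bounded_linear ?I"
  proof (rule bounded_linear_intro[of _ "1 / e"])
    show "?I (x + y) = ?I x + ?I y" for x y
      by (metis AI blinfun.add_right)
    show "?I (r *\<^sub>R x) = r *\<^sub>R ?I x" for r x
      by (metis AI blinfun.scaleR_right)
    show "norm (?I x) \<le> norm x * (1 / e)" for x
      using form_bound_below[OF e(2)[of "?I x"]] e(1) by (simp add: field_simps)
  qed
  then show ?thesis by (simp add: op_inv_def bounded_linear_Blinfun_apply)
qed

lemma op_inv_right [simp]: "coercive_op A \<Longrightarrow> A (op_inv A x) = x"
  by (simp add: op_inv_apply coercive_bij bij_is_surj surj_f_inv_f)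

lemma op_inv_left [simp]: "coercive_op A \<Longrightarrow> op_inv A (A x) = x"
  by (simp add: op_inv_apply coercive_bij bij_is_inj)

lemma op_inv_coercive: assumes A: "coercive_op A" shows "coercive_op (op_inv A)"
proof -
  obtain e where e: "e > 0" "\<And>x. e * (x \<bullet> x) \<le> A x \<bullet> x"
    using A by (auto simp: coercive_op_def)
  note sa = coercive_selfadjoint[OF A]
  have cl: "op_inv A (c *\<^sub>C x) = c *\<^sub>C op_inv A x" for c x
    by (metis A op_inv_left op_inv_right sa selfadjoint_scaleC)
  have sy: "cinner (op_inv A x) y = cinner x (op_inv A y)" for x y
    by (metis A op_inv_right sa selfadjoint_cinner)
  define M where "M = (norm A)\<^sup>2 + 1"
  have M: "M > 0" by (simp add: M_def add_nonneg_pos)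
  have "e / M * (x \<bullet> x) \<le> op_inv A x \<bullet> x" for x
  proof -
    define y where "y = op_inv A x"
    have x: "x = A y" by (simp add: y_def A)
    have "(norm (A y))\<^sup>2 \<le> (norm A * norm y)\<^sup>2"
      by (intro power_mono norm_blinfun) simp
    also have "\<dots> \<le> M * (norm y)\<^sup>2"
      by (simp add: M_def power_mult_distrib mult_right_mono)
    finally have "e / M * (norm x)\<^sup>2 \<le> e * (norm y)\<^sup>2"
      using M e(1) by (simp add: x field_simps)
    also have "\<dots> \<le> y \<bullet> x"
      using e(2)[of y] by (simp add: x power2_norm_eq_inner inner_commute)
    finally show ?thesis by (simp add: y_def power2_norm_eq_inner)
  qed
  moreover have "e / M > 0" using e(1) M by simp
  ultimately show ?thesis
    using cl sy unfolding coercive_op_def selfadjoint_op_def clinear_op_def by blast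
qed

lemma op_inv_op_inv: "coercive_op A \<Longrightarrow> op_inv (op_inv A) = A"
  by (intro blinfun_eqI) (metis op_inv_coercive op_inv_left op_inv_right)

lemma effects_iff: "A \<in> effects \<longleftrightarrow>
    selfadjoint_op A \<and> (\<forall>x. 0 \<le> A x \<bullet> x) \<and> (\<forall>x. A x \<bullet> x \<le> x \<bullet> x)"
  by (auto simp: effects_def op_le_iff selfadjoint_intros)

lemma effect_pos: "A \<in> effects \<Longrightarrow> 0 \<le>\<^sub>o A"
  by (simp add: effects_def)

lemma effect_selfadjoint: "A \<in> effects \<Longrightarrow> selfadjoint_op A"
  by (simp add: effects_iff)

text \<open>
  This is \<open>A\<^sup>2 \<le> A\<close>, obtained from the Cauchy--Schwarz inequality for the form of \<open>A\<close> at \<open>x\<close> and \<open>A x\<close>.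
\<close>

lemma effect_norm_square_le: assumes "A \<in> effects" shows "A x \<bullet> A x \<le> A x \<bullet> x"
proof -
  have "(A x \<bullet> A x)\<^sup>2 \<le> (A x \<bullet> x) * (A (A x) \<bullet> A x)"
    using pos_op_Cauchy_Schwarz_real[OF effect_pos[OF assms]] .
  also have "\<dots> \<le> (A x \<bullet> x) * (A x \<bullet> A x)"
    using assms by (intro mult_left_mono) (auto simp: effects_iff)
  finally show ?thesis
    using assms by (cases "A x \<bullet> A x = 0") (auto simp: effects_iff power2_eq_square)
qed

lemma effect_norm_le: assumes "A \<in> effects" shows "norm (A x) \<le> norm x"
proof -
  have "(norm (A x))\<^sup>2 \<le> (norm x)\<^sup>2"
    using effect_norm_square_le[OF assms, of x] assms
    unfolding power2_norm_eq_inner effects_iff by (meson order_trans)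
  then show ?thesis by simp
qed

text \<open>
  The map \<open>A \<mapsto> A\<^sup>-\<^sup>1 - I\<close> identifies the coercive effects with the cone of all positive operators and
  reverses the order. On the cone the functions \<open>f\<^sub>p\<close> become multiplication by \<open>1 - p\<close>, because
  \<open>1 / f\<^sub>p x - 1 = (1 - p) (1 / x - 1)\<close>.
\<close>

definition effect_to_pos :: "('h::complex_hilbert \<Rightarrow>\<^sub>L 'h) \<Rightarrow> 'h \<Rightarrow>\<^sub>L 'h" where
  "effect_to_pos A = op_inv A - id_blinfun"

definition pos_to_effect :: "('h::complex_hilbert \<Rightarrow>\<^sub>L 'h) \<Rightarrow> 'h \<Rightarrow>\<^sub>L 'h" where
  "pos_to_effect B = op_inv (id_blinfun + B)"

lemma effect_to_pos_pos: assumes A: "A \<in> effects" "coercive_op A" shows "0 \<le>\<^sub>o effect_to_pos A"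
proof -
  have "x \<bullet> x \<le> op_inv A x \<bullet> x" for x
    using effect_norm_square_le[OF A(1), of "op_inv A x"] by (simp add: A(2) inner_commute)
  moreover have "selfadjoint_op (effect_to_pos A)"
    unfolding effect_to_pos_def
    by (intro selfadjoint_intros coercive_selfadjoint op_inv_coercive A(2))
  ultimately show ?thesis
    by (simp add: pos_op_iff effect_to_pos_def blinfun.diff_left inner_diff_left)
qed

lemma id_plus_pos_coercive: "0 \<le>\<^sub>o B \<Longrightarrow> coercive_op (id_blinfun + B)"
  unfolding coercive_op_def pos_op_iff
  by (auto intro!: selfadjoint_intros exI[of _ 1] simp: blinfun.add_left inner_add_left)

lemma pos_to_effect_coercive: "0 \<le>\<^sub>o B \<Longrightarrow> coercive_op (pos_to_effect B)"
  by (simp add: pos_to_effect_def id_plus_pos_coercive op_inv_coercive)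

lemma pos_to_effect_effect: assumes B: "0 \<le>\<^sub>o B" shows "pos_to_effect B \<in> effects"
proof -
  note co = id_plus_pos_coercive[OF B]
  have "op_inv (id_blinfun + B) x \<bullet> x \<le> x \<bullet> x" for x
  proof -
    define y where "y = op_inv (id_blinfun + B) x"
    have x: "x = (id_blinfun + B) y" by (simp add: y_def co)
    have "1 * norm y \<le> norm x"
      unfolding x using B by (intro form_bound_below) (auto simp: pos_op_iff blinfun.add_left inner_simps)
    then have "norm y * norm x \<le> norm x * norm x" by (intro mult_right_mono) auto
    with norm_cauchy_schwarz[of y x] show ?thesis
      by (simp add: y_def power2_norm_eq_inner[symmetric] power2_eq_square)
  qed
  then show ?thesis
    using coercive_pos[OF op_inv_coercive[OF co]]
    by (auto simp: effects_iff pos_to_effect_def pos_op_iff)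
qed

lemma effect_to_pos_to_effect: "coercive_op A \<Longrightarrow> pos_to_effect (effect_to_pos A) = A"
  by (simp add: pos_to_effect_def effect_to_pos_def op_inv_op_inv)

lemma pos_to_effect_to_pos: "0 \<le>\<^sub>o B \<Longrightarrow> effect_to_pos (pos_to_effect B) = B"
  by (simp add: pos_to_effect_def effect_to_pos_def op_inv_op_inv id_plus_pos_coercive)

section \<open>Maps that transport quadratic forms pointwise\<close>

lemma orthogonal_split:
  fixes u z :: "'h::complex_hilbert"
  obtains a w where "z = a *\<^sub>C u + w" "cinner w u = 0"
proof (cases "u = 0")
  case True
  then show ?thesis using that[of 0 z] by simp
next
  case False
  define a where "a = cinner z u / cinner u u"
  have "cinner (z - a *\<^sub>C u) u = 0"
    using False by (simp add: cinner_simps a_def cinner_self)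
  then show ?thesis using that[of a "z - a *\<^sub>C u"] by simp
qed

lemma orthogonal_split2:
  fixes u v z :: "'h::complex_hilbert"
  obtains a b w where "z = a *\<^sub>C u + b *\<^sub>C v + w" "cinner w u = 0" "cinner w v = 0"
proof -
  obtain c v' where v: "v = c *\<^sub>C u + v'" "cinner v' u = 0" by (rule orthogonal_split)
  obtain a z' where z: "z = a *\<^sub>C u + z'" "cinner z' u = 0" by (rule orthogonal_split)
  obtain b w where w: "z' = b *\<^sub>C v' + w" "cinner w v' = 0" by (rule orthogonal_split)
  have wu: "cinner w u = 0" using z(2) v(2) by (simp add: w(1) cinner_simps)
  have eq: "z = (a - b * c) *\<^sub>C u + b *\<^sub>C v + w"
    by (simp add: z w v complex_vector.scale_left_diff_distrib scaleC_add_right scaleC_scaleC)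
  have "cinner w v = 0" using wu w(2) by (simp add: v(1) cinner_simps)
  from that[OF eq wu this] show ?thesis .
qed

definition lin_indep2 :: "'h::complex_hilbert \<Rightarrow> 'h \<Rightarrow> bool" where
  "lin_indep2 x y \<longleftrightarrow> (\<forall>a b. a *\<^sub>C x + b *\<^sub>C y = 0 \<longrightarrow> a = 0 \<and> b = 0)"

lemma lin_indep2_nonzero: "lin_indep2 x y \<Longrightarrow> x \<noteq> 0" "lin_indep2 x y \<Longrightarrow> y \<noteq> 0"
  unfolding lin_indep2_def
  by (metis add.right_neutral scaleC_simps(1,2) zero_neq_one,
      metis add.left_neutral scaleC_simps(1,2) zero_neq_one)

lemma lin_indep2_commute: "lin_indep2 x y \<Longrightarrow> lin_indep2 y x"
  unfolding lin_indep2_def by (metis add.commute)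

lemma nonzero_vector_exists:
  assumes "cdim_at_least 2 TYPE('h::complex_hilbert)" obtains x :: "'h::complex_hilbert" where "x \<noteq> 0"
proof -
  obtain S :: "'h set" where "card S = 2" "\<not> cdependent S"
    using assms unfolding cdim_at_least_def by blast
  then show ?thesis using that by (metis complex_vector.dependent_zero card_2_iff insertCI)
qed

text \<open>
  These are the test forms on a complex plane: on multiples of \<open>x\<close> plus multiples of \<open>y\<close> such a form
  is determined by its value at \<open>x\<close> alone.
\<close>

lemma positive_form_vanishing_at:
  assumes xy: "lin_indep2 x y" and t: "t \<ge> 0"
  obtains B where "0 \<le>\<^sub>o B" "B y = 0" "B x \<bullet> x = t"
proof -
  obtain a w where w: "x = a *\<^sub>C y + w" "cinner w y = 0" by (rule orthogonal_split)
  have "w \<noteq> 0"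
  proof
    assume "w = 0"
    then have "1 *\<^sub>C x + (- a) *\<^sub>C y = 0" by (simp add: w(1))
    with xy show False unfolding lin_indep2_def by (metis zero_neq_one)
  qed
  then have nz: "norm w \<noteq> 0" by simp
  define B where "B = (t / (norm w)^4) *\<^sub>R rank1 w"
  have "0 \<le>\<^sub>o B"
    using t rank1_pos[of w]
    by (simp add: B_def pos_op_iff selfadjoint_scaleR blinfun.scaleR_left)
  moreover have yw: "cinner y w = 0" using w(2) by (simp add: cinner_eq_0_commute)
  then have "B y = 0" by (simp add: B_def blinfun.scaleR_left rank1_apply)
  moreover have "cinner x w = of_real ((norm w)\<^sup>2)"
    using yw by (simp add: w(1) cinner_simps cinner_self)
  then have "B x \<bullet> x = t / (norm w)^4 * (cmod (of_real ((norm w)\<^sup>2)))\<^sup>2"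
    by (simp only: B_def blinfun.scaleR_left inner_scaleR_left rank1_form)
  then have "B x \<bullet> x = t" using nz by (simp add: norm_power)
  ultimately show ?thesis using that by blast
qed

lemma form_modulo_kernel:
  assumes B: "0 \<le>\<^sub>o B" and y: "B y = 0"
  shows "B (a *\<^sub>C x + b *\<^sub>C y) \<bullet> (a *\<^sub>C x + b *\<^sub>C y) = (cmod a)\<^sup>2 * (B x \<bullet> x)"
proof -
  have sa: "selfadjoint_op B" using B by (simp add: pos_op_iff)
  have "B (b *\<^sub>C y) = 0" by (simp add: selfadjoint_scaleC[OF sa] y)
  then have "B (a *\<^sub>C x + b *\<^sub>C y) \<bullet> (a *\<^sub>C x + b *\<^sub>C y) = B (a *\<^sub>C x) \<bullet> (a *\<^sub>C x)"
    using selfadjoint_inner[OF sa, of "a *\<^sub>C x" "b *\<^sub>C y"]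
    by (simp add: blinfun.add_right inner_add_right)
  then show ?thesis by (simp add: selfadjoint_form_scaleC[OF sa])
qed

lemma form_parallelogram:
  "A (x + y) \<bullet> (x + y) + A (x - y) \<bullet> (x - y) = 2 * (A x \<bullet> x) + 2 * (A y \<bullet> y)"
  for A :: "'h::complex_hilbert \<Rightarrow>\<^sub>L 'h"
  by (simp add: blinfun.add_right blinfun.diff_right inner_simps)

text \<open>
  Additivity gives \<open>f (n t) = n f t\<close>; comparing \<open>n t\<close> with the integers next to it, monotonicity bounds
  \<open>\<bar>f t - t f 1\<bar>\<close> by \<open>f 1 / n\<close>.
\<close>

lemma additive_mono_imp_linear:
  fixes f :: "real \<Rightarrow> real"
  assumes add: "\<And>s t. 0 \<le> s \<Longrightarrow> 0 \<le> t \<Longrightarrow> f (s + t) = f s + f t"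
    and mono: "\<And>s t. 0 \<le> s \<Longrightarrow> s \<le> t \<Longrightarrow> f s \<le> f t"
    and t: "0 \<le> t"
  shows "f t = t * f 1"
proof -
  have f0: "f 0 = 0" using add[of 0 0] by simp
  have mult: "f (real n * s) = real n * f s" if "0 \<le> s" for n s
    by (induction n) (use that in \<open>simp_all add: f0 add distrib_right\<close>)
  have f1: "0 \<le> f 1" using mono[of 0 1] f0 by simp
  have bound: "real n * \<bar>f t - t * f 1\<bar> \<le> f 1" for n
  proof -
    define k where "k = nat \<lfloor>real n * t\<rfloor>"
    have k: "real k \<le> real n * t" "real n * t \<le> real (Suc k)"
      using t unfolding k_def by (simp, linarith)
    have "real k * f 1 \<le> real n * f t" "real n * f t \<le> real (Suc k) * f 1"
      using mult[of 1 k] mult[of 1 "Suc k"] mult[OF t, of n] mono[OF _ k(1)] mono[OF _ k(2)] t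
      by auto
    moreover have "real k * f 1 \<le> real n * t * f 1" "real n * t * f 1 \<le> real (Suc k) * f 1"
      using k f1 by (simp_all only: mult_right_mono)
    ultimately have "\<bar>real n * f t - real n * t * f 1\<bar> \<le> f 1"
      by (simp add: distrib_right abs_le_iff)
    also have "real n * f t - real n * t * f 1 = real n * (f t - t * f 1)"
      by (simp add: right_diff_distrib mult.assoc)
    finally show ?thesis by (simp add: abs_mult)
  qed
  show ?thesis
  proof (rule ccontr)
    assume "f t \<noteq> t * f 1"
    then have "\<bar>f t - t * f 1\<bar> > 0" by simp
    from reals_Archimedean3[OF this] obtain n where "f 1 < real n * \<bar>f t - t * f 1\<bar>" by blast
    with bound[of n] show False by simp
  qed
qed

text \<open>
  An order automorphism of the positive cone acts on quadratic forms one line at a time: the value of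
  the new form at \<open>\<sigma> x\<close> depends only on the value of the old form at \<open>x\<close>, through an increasing
  function \<open>h x\<close>. That \<open>h x\<close> is additive and homogeneous has to be derived. Lines are represented by
  arbitrary nonzero vectors on them, so \<open>\<sigma>\<close> is onto only up to scalars.
\<close>

locale form_transport =
  fixes \<psi> :: "('h::complex_hilbert \<Rightarrow>\<^sub>L 'h) \<Rightarrow> ('h \<Rightarrow>\<^sub>L 'h)"
    and \<sigma> :: "'h \<Rightarrow> 'h" and h :: "'h \<Rightarrow> real \<Rightarrow> real"
  assumes psi_pos: "0 \<le>\<^sub>o B \<Longrightarrow> 0 \<le>\<^sub>o \<psi> B"
    and psi_onto: "0 \<le>\<^sub>o C \<Longrightarrow> \<exists>B. 0 \<le>\<^sub>o B \<and> \<psi> B = C"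
    and sigma_nonzero: "x \<noteq> 0 \<Longrightarrow> \<sigma> x \<noteq> 0"
    and sigma_onto: "y \<noteq> 0 \<Longrightarrow> \<exists>x c. x \<noteq> 0 \<and> c \<noteq> 0 \<and> \<sigma> x = c *\<^sub>C y"
    and psi_form: "0 \<le>\<^sub>o B \<Longrightarrow> x \<noteq> 0 \<Longrightarrow> \<psi> B (\<sigma> x) \<bullet> \<sigma> x = h x (B x \<bullet> x)"
    and h_strict: "x \<noteq> 0 \<Longrightarrow> 0 \<le> s \<Longrightarrow> s < t \<Longrightarrow> h x s < h x t"
    and h_zero: "x \<noteq> 0 \<Longrightarrow> h x 0 = 0"
begin

lemma h_mono: "x \<noteq> 0 \<Longrightarrow> 0 \<le> s \<Longrightarrow> s \<le> t \<Longrightarrow> h x s \<le> h x t"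
  using h_strict[of x s t] by (cases "s = t") auto

lemma h_pos: "x \<noteq> 0 \<Longrightarrow> 0 < t \<Longrightarrow> 0 < h x t"
  using h_strict[of x 0 t] h_zero by simp

lemma h_inj: "x \<noteq> 0 \<Longrightarrow> 0 \<le> s \<Longrightarrow> 0 \<le> t \<Longrightarrow> h x s = h x t \<Longrightarrow> s = t"
  using h_strict[of x s t] h_strict[of x t s] by fastforce

text \<open>
  The value \<open>0\<close> is transported to \<open>0\<close>, and for positive operators a zero of the form is a zero of
  the operator. Hence kernels, and with them linear spans, are visible to \<open>\<sigma>\<close>.
\<close>

lemma kernel_transport:
  assumes "0 \<le>\<^sub>o B" "x \<noteq> 0" shows "\<psi> B (\<sigma> x) = 0 \<longleftrightarrow> B x = 0"
proof -
  have "h x (B x \<bullet> x) = 0 \<longleftrightarrow> B x \<bullet> x = 0"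
    using h_inj[of x "B x \<bullet> x" 0] h_zero[of x] assms by (auto simp: pos_op_iff)
  then show ?thesis
    using pos_op_kernel[OF assms(1)] pos_op_kernel[OF psi_pos[OF assms(1)], of "\<sigma> x"]
      psi_form[OF assms] by auto
qed

text \<open>
  Let \<open>w\<close> be the component of \<open>\<sigma> z\<close> orthogonal to \<open>\<sigma> x\<close> and \<open>\<sigma> y\<close>. The form of \<open>rank1 w\<close> is the image
  of a form vanishing at \<open>x\<close> and \<open>y\<close>, hence at \<open>z\<close>; so \<open>rank1 w\<close> kills \<open>\<sigma> z\<close>, which forces \<open>w = 0\<close>.
\<close>

lemma sigma_coplanar:
  assumes "x \<noteq> 0" "y \<noteq> 0" "z = a *\<^sub>C x + b *\<^sub>C y" "z \<noteq> 0"
  obtains a' b' where "\<sigma> z = a' *\<^sub>C \<sigma> x + b' *\<^sub>C \<sigma> y"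
proof -
  obtain a' b' w where w: "\<sigma> z = a' *\<^sub>C \<sigma> x + b' *\<^sub>C \<sigma> y + w"
    "cinner w (\<sigma> x) = 0" "cinner w (\<sigma> y) = 0" by (rule orthogonal_split2)
  obtain B where B: "0 \<le>\<^sub>o B" "\<psi> B = rank1 w" using psi_onto[OF rank1_pos] by blast
  have sa: "selfadjoint_op B" using B by (simp add: pos_op_iff)
  have "\<psi> B (\<sigma> x) = 0" "\<psi> B (\<sigma> y) = 0"
    using w(2,3) cinner_eq_0_commute by (auto simp: B(2) rank1_apply)
  then have "B x = 0" "B y = 0" using kernel_transport[OF B(1) assms(1)] kernel_transport[OF B(1) assms(2)]
    by (simp_all only:)
  then have "B z = 0" by (simp add: assms(3) blinfun.add_right selfadjoint_scaleC[OF sa])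
  then have "\<psi> B (\<sigma> z) = 0" using kernel_transport[OF B(1) assms(4)] by (simp only:)
  moreover have "cinner (\<sigma> z) w = of_real ((norm w)\<^sup>2)"
    using w(2,3)[THEN cinner_eq_0_commute[THEN iffD1]]
    by (subst w(1)) (simp add: cinner_simps cinner_self)
  ultimately have "w = 0" by (simp add: B(2) rank1_apply)
  with w(1) that show ?thesis by simp
qed

lemma sigma_coplanar_converse:
  assumes "x \<noteq> 0" "y \<noteq> 0" "z \<noteq> 0" "\<sigma> z = a' *\<^sub>C \<sigma> x + b' *\<^sub>C \<sigma> y"
  obtains a b where "z = a *\<^sub>C x + b *\<^sub>C y"
proof -
  obtain a b w where w: "z = a *\<^sub>C x + b *\<^sub>C y + w" "cinner w x = 0" "cinner w y = 0"
    by (rule orthogonal_split2)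
  let ?B = "rank1 w"
  have B: "0 \<le>\<^sub>o ?B" by (rule rank1_pos)
  have sa: "selfadjoint_op (\<psi> ?B)" using psi_pos[OF B] by (simp add: pos_op_iff)
  have "?B x = 0" "?B y = 0" using w(2,3) cinner_eq_0_commute by (auto simp: rank1_apply)
  then have "\<psi> ?B (\<sigma> x) = 0" "\<psi> ?B (\<sigma> y) = 0" using kernel_transport B assms by auto
  then have "\<psi> ?B (\<sigma> z) = 0"
    by (simp add: assms(4) blinfun.add_right selfadjoint_scaleC[OF sa])
  then have "?B z = 0" using kernel_transport[OF B assms(3)] by (simp only:)
  moreover have "cinner z w = of_real ((norm w)\<^sup>2)"
    using w(2,3)[THEN cinner_eq_0_commute[THEN iffD1]]
    by (subst w(1)) (simp add: cinner_simps cinner_self)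
  ultimately have "w = 0" by (simp add: rank1_apply)
  with w(1) that show ?thesis by simp
qed

text \<open>
  Apply \<open>psi_form\<close> to a form vanishing at \<open>y\<close>: its values at \<open>z\<close> and at \<open>x\<close> differ by the factor
  \<open>\<bar>a\<bar>\<^sup>2\<close>, and those of its image, which vanishes at \<open>\<sigma> y\<close>, by the factor \<open>\<bar>a'\<bar>\<^sup>2\<close>. All functions \<open>h x\<close> are
  therefore rescalings of each other.
\<close>

lemma h_coefficient:
  assumes xy: "lin_indep2 x y" and z: "z = a *\<^sub>C x + b *\<^sub>C y" "z \<noteq> 0"
    and z': "\<sigma> z = a' *\<^sub>C \<sigma> x + b' *\<^sub>C \<sigma> y" and t: "t \<ge> 0"
  shows "h z ((cmod a)\<^sup>2 * t) = (cmod a')\<^sup>2 * h x t"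
proof -
  note nz = lin_indep2_nonzero[OF xy]
  obtain B where B: "0 \<le>\<^sub>o B" "B y = 0" "B x \<bullet> x = t"
    using positive_form_vanishing_at[OF xy t] .
  have "\<psi> B (\<sigma> y) = 0" using kernel_transport B nz by auto
  then have "\<psi> B (\<sigma> z) \<bullet> \<sigma> z = (cmod a')\<^sup>2 * (\<psi> B (\<sigma> x) \<bullet> \<sigma> x)"
    unfolding z' by (rule form_modulo_kernel[OF psi_pos[OF B(1)]])
  moreover have "B z \<bullet> z = (cmod a)\<^sup>2 * t"
    unfolding z(1) B(3)[symmetric] by (rule form_modulo_kernel[OF B(1,2)])
  ultimately show ?thesis
    using psi_form[OF B(1) z(2)] psi_form[OF B(1) nz(1)] B(3) by simp
qed

text \<open>
  Consider forms that are diagonal with respect to \<open>x\<close> and \<open>y\<close>, with diagonal entries \<open>s\<close> and \<open>t\<close>. They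
  take the value \<open>s + t\<close> at all \<open>x + \<omega> y\<close> with \<open>\<bar>\<omega>\<bar> = 1\<close>. The image form need not be diagonal, but its
  values at a pair \<open>a' \<sigma> x \<plusminus> b' \<sigma> y\<close> have an average without off-diagonal part. Both points of
  the pair come from vectors \<open>x + \<omega> y\<close> up to scaling, so the average is \<open>h (x + y) (s + t)\<close>, while the
  diagonal entries give \<open>h (x + y) s + h (x + y) t\<close>.
\<close>

lemma h_additive:
  assumes xy: "lin_indep2 x y" and s: "0 \<le> s" and t: "0 \<le> t"
  shows "h (x + y) (s + t) = h (x + y) s + h (x + y) t"
proof -
  note nz = lin_indep2_nonzero[OF xy] and yx = lin_indep2_commute[OF xy]
  \<comment> \<open>\<open>z\<close> is the first of the two points, and fixes the coefficients \<open>a'\<close> and \<open>b'\<close>.\<close>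
  define z where "z = x + y"
  have z: "z = 1 *\<^sub>C x + 1 *\<^sub>C y" "z = 1 *\<^sub>C y + 1 *\<^sub>C x" by (simp_all add: z_def)
  have z0: "z \<noteq> 0" using xy z unfolding lin_indep2_def by (metis zero_neq_one)
  obtain a' b' where z': "\<sigma> z = a' *\<^sub>C \<sigma> x + b' *\<^sub>C \<sigma> y"
    using sigma_coplanar[OF nz z(1) z0] .
  have z'': "\<sigma> z = b' *\<^sub>C \<sigma> y + a' *\<^sub>C \<sigma> x" by (simp add: z' add.commute)
  have hx: "h z r = (cmod a')\<^sup>2 * h x r" and hy: "h z r = (cmod b')\<^sup>2 * h y r" if "r \<ge> 0" for r
    using h_coefficient[OF xy z(1) z0 z' that] h_coefficient[OF yx z(2) z0 z'' that] by simp_all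
  have a0: "a' \<noteq> 0" "b' \<noteq> 0" using hx[of 1] hy[of 1] h_pos[OF z0, of 1] by auto
  \<comment> \<open>\<open>v\<close> is the fourth harmonic point of \<open>\<sigma> x\<close>, \<open>\<sigma> y\<close>, \<open>\<sigma> z\<close>; averaging over \<open>\<sigma> z\<close> and \<open>v\<close> removes
      the off-diagonal part of a form.\<close>
  define v where "v = a' *\<^sub>C \<sigma> x - b' *\<^sub>C \<sigma> y"
  have sx: "\<sigma> z + v = (2 * a') *\<^sub>C \<sigma> x" 
    by (simp add: z' v_def scaleC_add_left[symmetric])
  have "v \<noteq> 0"
  proof
    assume "v = 0"
    then have *: "\<sigma> z = (2 * a') *\<^sub>C \<sigma> x" using sx by simp
    obtain B where B: "0 \<le>\<^sub>o B" "B x = 0" "B y \<bullet> y = 1"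
      using positive_form_vanishing_at[OF yx, of 1] by auto
    have "\<psi> B (\<sigma> x) = 0" using kernel_transport B nz by auto
    then have "\<psi> B (\<sigma> z) = 0"
      unfolding * using psi_pos[OF B(1)] by (simp add: pos_op_iff selfadjoint_scaleC)
    then have "B z = 0" using kernel_transport B z0 by auto
    then show False using B by (simp add: z_def blinfun.add_right)
  qed
  then obtain u c where u: "u \<noteq> 0" "c \<noteq> 0" "\<sigma> u = c *\<^sub>C v" using sigma_onto by blast
  have u': "\<sigma> u = (c * a') *\<^sub>C \<sigma> x + (- (c * b')) *\<^sub>C \<sigma> y"
    by (simp add: u(3) v_def complex_vector.scale_right_diff_distrib scaleC_scaleC)
  then have u'': "\<sigma> u = (- (c * b')) *\<^sub>C \<sigma> y + (c * a') *\<^sub>C \<sigma> x" by (simp add: add.commute)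
  obtain a b where ab: "u = a *\<^sub>C x + b *\<^sub>C y"
    using sigma_coplanar_converse[OF nz u(1) u'] .
  then have ba: "u = b *\<^sub>C y + a *\<^sub>C x" by (simp add: add.commute)
  have ha: "h u ((cmod a)\<^sup>2 * r) = (cmod c)\<^sup>2 * h z r" and hb: "h u ((cmod b)\<^sup>2 * r) = (cmod c)\<^sup>2 * h z r"
    if "r \<ge> 0" for r
    using h_coefficient[OF xy ab u(1) u' that] h_coefficient[OF yx ba u(1) u'' that]
      hx[OF that] hy[OF that]
    by (simp_all add: norm_mult power_mult_distrib)
  \<comment> \<open>Up to a scalar, \<open>u\<close> is of the form \<open>x + \<omega> y\<close> with \<open>\<bar>\<omega>\<bar> = 1\<close>, so diagonal forms do not
      distinguish it from \<open>z\<close>.\<close>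
  have mod: "(cmod a)\<^sup>2 = (cmod b)\<^sup>2"
    using ha[of 1] hb[of 1] h_inj[OF u(1), of "(cmod a)\<^sup>2" "(cmod b)\<^sup>2"] by simp
  obtain B1 where B1: "0 \<le>\<^sub>o B1" "B1 y = 0" "B1 x \<bullet> x = s"
    using positive_form_vanishing_at[OF xy s] .
  obtain B2 where B2: "0 \<le>\<^sub>o B2" "B2 x = 0" "B2 y \<bullet> y = t"
    using positive_form_vanishing_at[OF yx t] .
  define B where "B = B1 + B2"
  have B: "0 \<le>\<^sub>o B"
    using B1(1) B2(1) by (auto simp: B_def pos_op_iff selfadjoint_add blinfun.add_left inner_add_left)
  have Bform: "B (d *\<^sub>C x + e *\<^sub>C y) \<bullet> (d *\<^sub>C x + e *\<^sub>C y) = (cmod d)\<^sup>2 * s + (cmod e)\<^sup>2 * t" for d e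
    using form_modulo_kernel[OF B1(1,2), of d x e] form_modulo_kernel[OF B2(1,2), of e y d]
    by (simp add: B_def blinfun.add_left inner_add_left B1(3) B2(3) add.commute)
  have sB: "selfadjoint_op (\<psi> B)" using psi_pos[OF B] by (simp add: pos_op_iff)
  have "\<psi> B (\<sigma> z) \<bullet> \<sigma> z = h z (s + t)"
    using psi_form[OF B z0] Bform[of 1 1] z(1) by simp
  moreover have "(cmod c)\<^sup>2 * (\<psi> B v \<bullet> v) = (cmod c)\<^sup>2 * h z (s + t)"
  proof -
    have "(cmod c)\<^sup>2 * (\<psi> B v \<bullet> v) = \<psi> B (\<sigma> u) \<bullet> \<sigma> u"
      by (simp add: u(3) selfadjoint_form_scaleC[OF sB])
    also have "\<dots> = h u ((cmod a)\<^sup>2 * (s + t))"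
      using psi_form[OF B u(1)] Bform[of a b] ab mod by (simp add: distrib_left)
    finally show ?thesis using ha[of "s + t"] s t by simp
  qed
  then have "\<psi> B v \<bullet> v = h z (s + t)" using u(2) by simp
  moreover have "\<psi> B (\<sigma> z) \<bullet> \<sigma> z + \<psi> B v \<bullet> v = 2 * h z s + 2 * h z t"
  proof -
    have "\<psi> B (\<sigma> z) \<bullet> \<sigma> z + \<psi> B v \<bullet> v
        = 2 * ((cmod a')\<^sup>2 * (\<psi> B (\<sigma> x) \<bullet> \<sigma> x)) + 2 * ((cmod b')\<^sup>2 * (\<psi> B (\<sigma> y) \<bullet> \<sigma> y))"
      unfolding z' v_def form_parallelogram selfadjoint_form_scaleC[OF sB] ..
    also have "\<psi> B (\<sigma> x) \<bullet> \<sigma> x = h x s"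
      using psi_form[OF B nz(1)] Bform[of 1 0] by simp
    also have "\<psi> B (\<sigma> y) \<bullet> \<sigma> y = h y t"
      using psi_form[OF B nz(2)] Bform[of 0 1] by simp
    finally show ?thesis using hx[OF s] hy[OF t] by simp
  qed
  ultimately show ?thesis by (simp add: z_def)
qed

text \<open>
  In dimension at least two every nonzero \<open>x\<close> is a sum \<open>y + (x - y)\<close> of independent vectors, so every
  \<open>h x\<close> is additive.
\<close>

lemma h_linear:
  assumes dim: "cdim_at_least 2 TYPE('h)" and x: "x \<noteq> 0" and t: "0 \<le> t"
  shows "h x t = t * h x 1"
proof -
  obtain y where y: "lin_indep2 x y"
  proof -
    obtain S :: "'h set" where S: "finite S" "card S = 2" "\<not> cdependent S"
      using dim unfolding cdim_at_least_def by blast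
    then obtain u v where uv: "S = {u, v}" "u \<noteq> v" by (meson card_2_iff)
    have ind: "a = 0 \<and> b = 0" if "a *\<^sub>C u + b *\<^sub>C v = 0" for a b
    proof -
      define f where "f w = (if w = u then a else b)" for w
      have "(\<Sum>w\<in>S. f w *\<^sub>C w) = 0" using that uv by (simp add: f_def)
      then have "\<forall>w\<in>S. f w = 0"
        using S(3) unfolding complex_vector.dependent_finite[OF S(1)] by meson
      then show ?thesis using uv by (auto simp: f_def)
    qed
    have "lin_indep2 x u \<or> lin_indep2 x v"
    proof (rule ccontr)
      have dep: "\<exists>d. w = d *\<^sub>C x" if "\<not> lin_indep2 x w" for w
      proof -
        obtain a b where ab: "a *\<^sub>C x + b *\<^sub>C w = 0" "a \<noteq> 0 \<or> b \<noteq> 0"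
          using \<open>\<not> lin_indep2 x w\<close> unfolding lin_indep2_def by blast
        have b: "b \<noteq> 0" using ab x by auto
        have "(inverse b * b) *\<^sub>C w = (- inverse b * a) *\<^sub>C x"
          using arg_cong[OF ab(1), of "(*\<^sub>C) (inverse b)"]
          by (simp add: scaleC_add_right scaleC_scaleC eq_neg_iff_add_eq_0 add.commute)
        then show ?thesis using b by (intro exI[of _ "- inverse b * a"]) simp
      qed
      assume "\<not> ?thesis"
      then obtain d e where de: "u = d *\<^sub>C x" "v = e *\<^sub>C x" using dep by blast
      have "e *\<^sub>C u + (- d) *\<^sub>C v = 0" by (simp add: de scaleC_scaleC mult.commute)
      then have "d = 0" using ind by fastforce
      then have "1 *\<^sub>C u + 0 *\<^sub>C v = 0" by (simp add: de)
      then show False using ind by fastforce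
    qed
    then show ?thesis using that by blast
  qed
  have "lin_indep2 y (x - y)"
    unfolding lin_indep2_def
  proof (intro allI impI)
    fix a b assume "a *\<^sub>C y + b *\<^sub>C (x - y) = 0"
    then have "b *\<^sub>C x + (a - b) *\<^sub>C y = 0"
      by (simp add: complex_vector.scale_right_diff_distrib complex_vector.scale_left_diff_distrib algebra_simps)
    then show "a = 0 \<and> b = 0" using y unfolding lin_indep2_def by fastforce
  qed
  from h_additive[OF this] have "h x (s + t) = h x s + h x t" if "0 \<le> s" "0 \<le> t" for s t
    using that by simp
  then show ?thesis using additive_mono_imp_linear[of "h x" t] h_mono[OF x] t by blast
qed

text \<open>
  If moreover some multiple of \<open>I\<close> goes to a multiple of \<open>I\<close>, the factors \<open>h x 1\<close> are all equal
  once \<open>\<sigma>\<close> is rescaled to a map \<open>S\<close> that preserves norms. Then \<open>S\<close> also preserves transition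
  probabilities. For \<open>T = \<psi> (rank1 y)\<close> the form of \<open>k \<parallel>y\<parallel>\<^sup>2 I - T\<close> is nonnegative and vanishes at \<open>S y\<close>,
  so \<open>S y\<close> is an eigenvector of \<open>T\<close>, and \<open>T\<close> kills \<open>S u\<close> for \<open>u\<close> orthogonal to \<open>y\<close>; hence \<open>S\<close> preserves
  orthogonality. For \<open>x = p y + u\<close> coplanarity reduces \<open>\<langle>S x, S y\<rangle>\<close> to the coefficient of \<open>S y\<close> in
  \<open>S x\<close>, whose modulus is read off from the value of the form of \<open>T\<close> at \<open>S x\<close>.
\<close>

lemma normalized_transport:
  assumes dim: "cdim_at_least 2 TYPE('h)"
    and scalar: "\<psi> (a *\<^sub>R id_blinfun) = b *\<^sub>R id_blinfun" and a: "a > 0"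
  obtains S k where "k > 0" "\<And>B x. 0 \<le>\<^sub>o B \<Longrightarrow> \<psi> B (S x) \<bullet> S x = k * (B x \<bullet> x)"
    "\<And>x y. cmod (cinner (S x) (S y)) = cmod (cinner x y)" 
    "\<And>y. \<exists>x c. y = c *\<^sub>C S x"
proof -
  define S where "S x = (if x = 0 then 0 else (norm x / norm (\<sigma> x)) *\<^sub>R \<sigma> x)" for x
  have S0 [simp]: "S 0 = 0" by (simp add: S_def)
  have nS: "norm (S x) = norm x" for x
    using sigma_nonzero[of x] by (simp add: S_def)
  define k where "k = b / a"
  have posa: "0 \<le>\<^sub>o a *\<^sub>R (id_blinfun :: 'h \<Rightarrow>\<^sub>L 'h)"
    using a by (simp add: pos_op_iff selfadjoint_intros blinfun.scaleR_left)
  have hb: "b * (norm (\<sigma> x))\<^sup>2 = a * (norm x)\<^sup>2 * h x 1" if "x \<noteq> 0" for x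
    using psi_form[OF posa that] h_linear[OF dim that, of "a * (x \<bullet> x)"] a
    by (simp add: scalar blinfun.scaleR_left power2_norm_eq_inner)
  have form: "\<psi> B (S x) \<bullet> S x = k * (B x \<bullet> x)" if B: "0 \<le>\<^sub>o B" for B x
  proof (cases "x = 0")
    case False
    have s0: "norm (\<sigma> x) \<noteq> 0" using sigma_nonzero False by simp
    have "\<psi> B (S x) \<bullet> S x = (norm x / norm (\<sigma> x))\<^sup>2 * h x (B x \<bullet> x)"
      using psi_form[OF B False] False
      by (simp add: S_def blinfun.scaleR_right power2_eq_square)
    also have "\<dots> = (norm x)\<^sup>2 / (norm (\<sigma> x))\<^sup>2 * h x 1 * (B x \<bullet> x)"
      using h_linear[OF dim False, of "B x \<bullet> x"] B by (simp add: pos_op_iff power_divide)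
    also have "(norm x)\<^sup>2 / (norm (\<sigma> x))\<^sup>2 * h x 1 = k"
      using hb[OF False] s0 a by (simp add: k_def field_simps)
    finally show ?thesis .
  qed simp
  have onto: "\<exists>x c. y = c *\<^sub>C S x" for y
  proof (cases "y = 0")
    case True then show ?thesis by (intro exI[of _ 0]) simp
  next
    case False
    then obtain x c where x: "x \<noteq> 0" "c \<noteq> 0" "\<sigma> x = c *\<^sub>C y" using sigma_onto by blast
    have "norm (\<sigma> x) \<noteq> 0" using sigma_nonzero[OF x(1)] by simp
    then have "of_real (norm (\<sigma> x) / norm x) *\<^sub>C S x = c *\<^sub>C y"
      using x by (simp add: S_def scaleR_scaleC scaleC_scaleC)
    then have "y = (inverse c * of_real (norm (\<sigma> x) / norm x)) *\<^sub>C S x"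
      using x(2) by (metis left_inverse scaleC_scaleC scaleC_simps(3))
    then show ?thesis by blast
  qed
  have k: "k > 0"
  proof -
    obtain x :: 'h where x: "x \<noteq> 0" using nonzero_vector_exists[OF dim] .
    then have "a * (norm x)\<^sup>2 * h x 1 > 0" using h_pos[OF x, of 1] a by simp
    then have "b > 0" using hb[OF x] by (metis zero_less_mult_pos2 zero_less_power2 sigma_nonzero x norm_eq_zero)
    then show ?thesis using a by (simp add: k_def)
  qed
  have coplanar: "\<exists>c d. S (p *\<^sub>C x + q *\<^sub>C y) = c *\<^sub>C S x + d *\<^sub>C S y"
    if nz: "x \<noteq> 0" "y \<noteq> 0" for x y p q
  proof (cases "p *\<^sub>C x + q *\<^sub>C y = 0")
    case True then show ?thesis by (intro exI[of _ 0]) simp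
  next
    case False
    obtain c d where cd: "\<sigma> (p *\<^sub>C x + q *\<^sub>C y) = c *\<^sub>C \<sigma> x + d *\<^sub>C \<sigma> y"
      using sigma_coplanar[OF nz refl False] .
    have sS: "\<sigma> z = of_real (norm (\<sigma> z) / norm z) *\<^sub>C S z" if "z \<noteq> 0" for z
      using that sigma_nonzero[OF that] by (simp add: S_def scaleR_scaleC scaleC_scaleC)
    have "\<exists>r. S (p *\<^sub>C x + q *\<^sub>C y) = r *\<^sub>C \<sigma> (p *\<^sub>C x + q *\<^sub>C y)"
      using False by (auto simp: S_def scaleR_scaleC)
    then show ?thesis
      by (metis cd sS[OF nz(1)] sS[OF nz(2)] scaleC_add_right scaleC_scaleC)
  qed
  have trans: "cmod (cinner (S x) (S y)) = cmod (cinner x y)" for x y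
  proof (cases "y = 0")
    case y: False
    let ?T = "\<psi> (rank1 y)"
    have T: "0 \<le>\<^sub>o ?T" by (rule psi_pos[OF rank1_pos])
    have sT: "selfadjoint_op ?T" using T by (simp add: pos_op_iff)
    define m where "m = k * (norm y)\<^sup>2"
    have m: "m > 0" using k y by (simp add: m_def)
    define D where "D = m *\<^sub>R id_blinfun - ?T"
    have formD: "D (S u) \<bullet> S u = k * ((norm y)\<^sup>2 * (norm u)\<^sup>2 - (cmod (cinner u y))\<^sup>2)" for u
      using form[OF rank1_pos, of y u] nS[of u]
      by (simp add: D_def m_def blinfun.diff_left blinfun.scaleR_left inner_diff_left rank1_form
          power2_norm_eq_inner[symmetric] algebra_simps)
    have sD: "selfadjoint_op D" unfolding D_def by (intro selfadjoint_intros sT)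
    have "0 \<le> D v \<bullet> v" for v
    proof -
      obtain u c where v: "v = c *\<^sub>C S u" using onto by blast
      have "(cmod (cinner u y))\<^sup>2 \<le> (norm u * norm y)\<^sup>2"
        by (intro power_mono complex_Cauchy_Schwarz) simp
      then have "0 \<le> D (S u) \<bullet> S u"
        unfolding formD using k by (intro mult_nonneg_nonneg) (auto simp: power_mult_distrib mult.commute)
      then show ?thesis by (simp add: v selfadjoint_form_scaleC[OF sD])
    qed
    then have D: "0 \<le>\<^sub>o D" by (simp add: pos_op_iff sD)
    have "D (S y) \<bullet> S y = 0"
      by (simp add: formD cmod_cinner_self power2_eq_square)
    then have "D (S y) = 0" using pos_op_kernel[OF D] by blast
    then have Ty: "?T (S y) = of_real m *\<^sub>C S y"
      by (simp add: D_def blinfun.diff_left blinfun.scaleR_left scaleC_of_real)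
    obtain p u where u: "x = p *\<^sub>C y + u" "cinner u y = 0" by (rule orthogonal_split)
    have "?T (S u) \<bullet> S u = 0" using form[OF rank1_pos, of y u] by (simp add: rank1_form u(2))
    then have Tu: "?T (S u) = 0" using pos_op_kernel[OF T] by blast
    have orth: "cinner (S y) (S u) = 0"
    proof -
      have "of_real m * cinner (S y) (S u) = cinner (?T (S y)) (S u)" by (simp add: Ty cinner_simps)
      also have "\<dots> = 0" by (simp add: selfadjoint_cinner[OF sT] Tu)
      finally show ?thesis using m by simp
    qed
    have "\<exists>c d. S x = c *\<^sub>C S y + d *\<^sub>C S u"
    proof (cases "u = 0")
      case True
      obtain c d where "S (p *\<^sub>C y + 0 *\<^sub>C y) = c *\<^sub>C S y + d *\<^sub>C S y" using coplanar[OF y y] by blast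
      then have "S x = (c + d) *\<^sub>C S y + 0 *\<^sub>C S u" using True by (simp add: u(1) scaleC_add_left)
      then show ?thesis by blast
    next
      case False
      from coplanar[OF y False, of p 1] show ?thesis by (simp add: u(1))
    qed
    then obtain c d where cd: "S x = c *\<^sub>C S y + d *\<^sub>C S u" by blast
    have "k * (cmod (cinner x y))\<^sup>2 = ?T (S x) \<bullet> S x"
      using form[OF rank1_pos, of y x] by (simp add: rank1_form)
    also have "\<dots> = (cmod c)\<^sup>2 * (?T (S y) \<bullet> S y)"
      unfolding cd by (rule form_modulo_kernel[OF T Tu])
    also have "?T (S y) \<bullet> S y = k * ((norm y)\<^sup>2)\<^sup>2"
      by (simp add: form[OF rank1_pos] rank1_form cmod_cinner_self)
    finally have "(cmod (cinner x y))\<^sup>2 = (cmod c * (norm y)\<^sup>2)\<^sup>2"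
      using k by (simp add: power_mult_distrib)
    then have "cmod (cinner x y) = cmod c * (norm y)\<^sup>2" by simp
    moreover have "cinner (S x) (S y) = c * of_real ((norm y)\<^sup>2)"
      using orth by (simp add: cd cinner_simps cinner_self nS cinner_eq_0_commute[of "S u"])
    ultimately show ?thesis by (simp add: norm_mult norm_power)
  qed simp
  from that[OF k form trans onto] show ?thesis .
qed

end

section \<open>Wigner's theorem\<close>

lemma collinear_if_Cauchy_Schwarz_tight:
  fixes u v :: "'h::complex_hilbert"
  assumes n: "norm u = norm v" and c: "cmod (cinner u v) = norm u * norm v"
  shows "\<exists>w. cmod w = 1 \<and> u = w *\<^sub>C v"
proof (cases "v = 0")
  case True
  then show ?thesis using n by (intro exI[of _ 1]) simp
next
  case False
  obtain a r where u: "u = a *\<^sub>C v + r" "cinner r v = 0" by (rule orthogonal_split)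
  have "cinner u v = a * of_real ((norm v)\<^sup>2)" by (simp add: u cinner_simps cinner_self)
  then have "cmod a * (norm v)\<^sup>2 = (norm v)\<^sup>2"
    using c n by (simp add: norm_mult norm_power power2_eq_square)
  then have a: "cmod a = 1" using False by simp
  have vr: "cinner v r = 0" using u(2) by (simp add: cinner_eq_0_commute)
  have "cinner u u = a * cnj a * cinner v v + cinner r r"
    using u(2) vr by (simp add: u(1) cinner_simps mult.assoc)
  also have "a * cnj a = 1" using complex_norm_square[of a] a by simp
  finally have "(norm u)\<^sup>2 = (norm v)\<^sup>2 + (norm r)\<^sup>2"
    unfolding cinner_self by (metis mult_1 of_real_add of_real_eq_iff)
  then have "r = 0" using n by simp
  then show ?thesis using a u by auto
qed

text \<open>
  Fix a unit vector \<open>e\<close> and put \<open>f = S e\<close>. For \<open>x\<close> orthogonal to \<open>e\<close> the phase of \<open>S (e + x)\<close> can be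
  normalized so that it becomes \<open>f + R x\<close> with \<open>R x\<close> orthogonal to \<open>f\<close>. Preservation of
  \<open>\<bar>1 + \<langle>x, y\<rangle>\<bar>\<close> and of \<open>\<bar>\<langle>x, y\<rangle>\<bar>\<close> together gives preservation of \<open>Re \<langle>x, y\<rangle>\<close>, and a map preserving
  the real inner product is real-linear. Finally \<open>R (\<i> x)\<close> is collinear with \<open>R x\<close> and orthogonal to it
  in the real sense, so it is \<open>\<plusminus> \<i> R x\<close>, and additivity makes the sign the same for all \<open>x\<close>.
\<close>

theorem Wigner:
  fixes S :: "'h::complex_hilbert \<Rightarrow> 'h"
  assumes tp: "\<And>x y. cmod (cinner (S x) (S y)) = cmod (cinner x y)"
  obtains U :: "'h \<Rightarrow>\<^sub>L 'h" where "clinear_op U \<or> antilinear_op U" "\<And>x. norm (U x) = norm x"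
    "\<And>x. \<exists>w. cmod w = 1 \<and> U x = w *\<^sub>C S x"
proof (cases "\<exists>e :: 'h. norm e = 1")
  case False
  have z: "x = 0" for x :: 'h
  proof (rule ccontr)
    assume "x \<noteq> 0"
    then have "norm ((1 / norm x) *\<^sub>R x) = 1" by simp
    with False show False by blast
  qed
  show ?thesis
  proof (rule that[of 0])
    show "clinear_op (0 :: 'h \<Rightarrow>\<^sub>L 'h) \<or> antilinear_op (0 :: 'h \<Rightarrow>\<^sub>L 'h)"
      by (simp add: clinear_op_def)
    show "norm ((0 :: 'h \<Rightarrow>\<^sub>L 'h) x) = norm x" for x using z[of x] by simp
    show "\<exists>w. cmod w = 1 \<and> (0 :: 'h \<Rightarrow>\<^sub>L 'h) x = w *\<^sub>C S x" for x
      using z[of "S x"] by (intro exI[of _ 1]) simp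
  qed
next
  case True
  then obtain e :: 'h where e: "norm e = 1" by blast
  have nS: "norm (S x) = norm x" for x
    using tp[of x x] by (simp add: cinner_self norm_power)
  define f where "f = S e"
  have f: "norm f = 1" by (simp add: f_def nS e)
  have ee: "cinner e e = 1" and ff: "cinner f f = 1" by (simp_all add: cinner_self e f)
  define P where "P = {x. cinner x e = 0}"
  have P': "cinner e x = 0" if "x \<in> P" for x using that by (simp add: P_def cinner_eq_0_commute)
  have P_add: "x + y \<in> P" if "x \<in> P" "y \<in> P" for x y using that by (simp add: P_def cinner_simps)
  have P_scale: "c *\<^sub>C x \<in> P" if "x \<in> P" for x c using that by (simp add: P_def cinner_simps)
  have P_scaleR: "r *\<^sub>R x \<in> P" if "x \<in> P" for x r using that by (simp add: P_def cinner_simps)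
  \<comment> \<open>On the affine hyperplane \<open>e + P\<close> phases can be normalized against \<open>f\<close>.\<close>
  have "\<forall>x. \<exists>w. cmod w = 1 \<and> w * cinner (S (e + x)) f = of_real (cmod (cinner (S (e + x)) f))"
    using phase_exists by blast
  then obtain g where g1: "\<And>x. cmod (g x) = 1"
    and g2: "\<And>x. g x * cinner (S (e + x)) f = of_real (cmod (cinner (S (e + x)) f))" by metis
  define R where "R x = g x *\<^sub>C S (e + x) - f" for x
  have fR: "f + R x = g x *\<^sub>C S (e + x)" for x by (simp add: R_def)
  have Rf: "cinner (R x) f = 0" if x: "x \<in> P" for x
  proof -
    have "cmod (cinner (S (e + x)) f) = 1"
      using x unfolding f_def tp by (simp add: cinner_simps ee P_def)
    then show ?thesis using g2[of x] by (simp add: R_def cinner_simps ff)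
  qed
  have fR0: "cinner f (R x) = 0" if x: "x \<in> P" for x using Rf[OF x] by (simp add: cinner_eq_0_commute)
  have plus: "cmod (1 + cinner (R x) (R y)) = cmod (1 + cinner x y)" if x: "x \<in> P" and y: "y \<in> P" for x y
  proof -
    have "1 + cinner (R x) (R y) = cinner (f + R x) (f + R y)"
      using Rf[OF x] fR0[OF y] by (simp add: cinner_simps ff)
    also have "cmod \<dots> = cmod (cinner (e + x) (e + y))"
      by (simp add: fR cinner_simps norm_mult g1 tp)
    also have "cinner (e + x) (e + y) = 1 + cinner x y"
      using x P'[OF y] by (simp add: cinner_simps ee P_def)
    finally show ?thesis .
  qed
  have nR: "norm (R x) = norm x" if x: "x \<in> P" for x
  proof -
    have *: "cmod (1 + complex_of_real ((norm z)\<^sup>2)) = 1 + (norm z)\<^sup>2" for z :: 'h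
      by (metis abs_of_nonneg add_nonneg_nonneg norm_of_real of_real_1 of_real_add zero_le_one zero_le_power2)
    show ?thesis using plus[OF x x] unfolding cinner_self * by simp
  qed
  have RS: "\<exists>w. cmod w = 1 \<and> R x = w *\<^sub>C S x" if x: "x \<in> P" for x
  proof (rule collinear_if_Cauchy_Schwarz_tight)
    show "norm (R x) = norm (S x)" by (simp add: nR[OF x] nS)
    have "cmod (cinner f (S x)) = 0" unfolding f_def tp by (simp add: P'[OF x])
    then have "cmod (cinner (R x) (S x)) = cmod (g x * cinner (S (e + x)) (S x))"
      by (simp add: R_def cinner_simps)
    also have "\<dots> = cmod (cinner (e + x) x)" by (simp add: norm_mult g1 tp)
    also have "\<dots> = norm x * norm x"
      using P'[OF x] by (simp add: cinner_simps cinner_self norm_power power2_eq_square norm_mult)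
    finally show "cmod (cinner (R x) (S x)) = norm (R x) * norm (S x)" by (simp add: nR[OF x] nS)
  qed
  have Rtp: "cmod (cinner (R x) (R y)) = cmod (cinner x y)" if x: "x \<in> P" and y: "y \<in> P" for x y
  proof -
    obtain a b where "cmod a = 1" "R x = a *\<^sub>C S x" "cmod b = 1" "R y = b *\<^sub>C S y"
      using RS[OF x] RS[OF y] by blast
    then show ?thesis by (simp add: cinner_simps norm_mult tp)
  qed
  have Rin: "R x \<bullet> R y = x \<bullet> y" if x: "x \<in> P" and y: "y \<in> P" for x y
  proof -
    have *: "(cmod (1 + z))\<^sup>2 = 1 + 2 * Re z + (cmod z)\<^sup>2" for z
      unfolding cmod_power2 by (simp add: power2_eq_square algebra_simps)
    show ?thesis
      using *[of "cinner (R x) (R y)"] *[of "cinner x y"] plus[OF x y] Rtp[OF x y]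
      by (simp add: inner_eq_Re_cinner)
  qed
  have Radd: "R (x + y) = R x + R y" if x: "x \<in> P" and y: "y \<in> P" for x y
  proof -
    have "(R (x + y) - R x - R y) \<bullet> (R (x + y) - R x - R y) = 0"
      using x y P_add[OF x y] by (simp add: inner_simps Rin)
    then have "R (x + y) - R x - R y = 0" by (simp only: inner_eq_zero_iff)
    then show ?thesis by (simp add: algebra_simps)
  qed
  have Rscale: "R (r *\<^sub>R x) = r *\<^sub>R R x" if x: "x \<in> P" for x r
  proof -
    have "(R (r *\<^sub>R x) - r *\<^sub>R R x) \<bullet> (R (r *\<^sub>R x) - r *\<^sub>R R x) = 0"
      using x P_scaleR[OF x] by (simp add: inner_simps Rin)
    then have "R (r *\<^sub>R x) - r *\<^sub>R R x = 0" by (simp only: inner_eq_zero_iff)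
    then show ?thesis by simp
  qed
  have Ri: "R (\<i> *\<^sub>C x) = \<i> *\<^sub>C R x \<or> R (\<i> *\<^sub>C x) = - (\<i> *\<^sub>C R x)" if x: "x \<in> P" for x
  proof (cases "x = 0")
    case True
    then show ?thesis using nR[OF x] by simp
  next
    case False
    have nix: "norm (R (\<i> *\<^sub>C x)) = norm (R x)"
      by (simp add: nR[OF x] nR[OF P_scale[OF x]] norm_scaleC)
    have "cmod (cinner (R (\<i> *\<^sub>C x)) (R x)) = norm (R (\<i> *\<^sub>C x)) * norm (R x)"
      unfolding Rtp[OF P_scale[OF x] x] nix
      by (simp add: nR[OF x] cinner_simps norm_mult cinner_self norm_power power2_eq_square)
    from collinear_if_Cauchy_Schwarz_tight[OF nix this] obtain w
      where w: "cmod w = 1" "R (\<i> *\<^sub>C x) = w *\<^sub>C R x" by blast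
    have "R (\<i> *\<^sub>C x) \<bullet> R x = 0"
      unfolding Rin[OF P_scale[OF x] x]
      by (simp add: inner_eq_Re_cinner cinner_simps cinner_self flip: of_real_power)
    then have "Re w * (norm (R x))\<^sup>2 = 0"
      by (simp add: w(2) inner_eq_Re_cinner cinner_simps cinner_self flip: of_real_power)
    then have "Re w = 0" using False nR[OF x] by simp
    moreover from this w(1) have "\<bar>Im w\<bar> = 1" by (simp add: cmod_def)
    ultimately have "w = \<i> \<or> w = - \<i>" by (auto simp: complex_eq_iff)
    then show ?thesis using w(2) by auto
  qed
  have "(\<forall>x\<in>P. R (\<i> *\<^sub>C x) = \<i> *\<^sub>C R x) \<or> (\<forall>x\<in>P. R (\<i> *\<^sub>C x) = - (\<i> *\<^sub>C R x))"
  proof (rule ccontr)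
    assume "\<not> ?thesis"
    then obtain x y where x: "x \<in> P" "R (\<i> *\<^sub>C x) \<noteq> \<i> *\<^sub>C R x" and y: "y \<in> P" "R (\<i> *\<^sub>C y) \<noteq> - (\<i> *\<^sub>C R y)"
      by blast
    have x': "R (\<i> *\<^sub>C x) = - (\<i> *\<^sub>C R x)" and y': "R (\<i> *\<^sub>C y) = \<i> *\<^sub>C R y"
      using Ri[OF x(1)] Ri[OF y(1)] x y by auto
    have nz: "\<i> *\<^sub>C R x \<noteq> 0" "\<i> *\<^sub>C R y \<noteq> 0" using x x' y y' by auto
    have "R (\<i> *\<^sub>C (x + y)) = - (\<i> *\<^sub>C R x) + \<i> *\<^sub>C R y"
      using Radd[OF P_scale[OF x(1)] P_scale[OF y(1)]] by (simp add: scaleC_add_right x' y')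
    moreover have "\<i> *\<^sub>C R (x + y) = \<i> *\<^sub>C R x + \<i> *\<^sub>C R y"
      by (simp add: Radd[OF x(1) y(1)] scaleC_add_right)
    ultimately have "- (\<i> *\<^sub>C R x) + \<i> *\<^sub>C R y = \<i> *\<^sub>C R x + \<i> *\<^sub>C R y
        \<or> - (\<i> *\<^sub>C R x) + \<i> *\<^sub>C R y = - (\<i> *\<^sub>C R x + \<i> *\<^sub>C R y)"
      using Ri[OF P_add[OF x(1) y(1)]] by simp
    moreover have "v + v \<noteq> 0" if "v \<noteq> 0" for v :: 'h
      using that by (simp flip: scaleR_2)
    note this[OF nz(1)] this[OF nz(2)]
    ultimately show False by (auto simp: algebra_simps)
  qed
  then obtain \<kappa> :: "complex \<Rightarrow> complex" where \<kappa>: "\<kappa> = id \<or> \<kappa> = cnj"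
    and Rk: "\<And>x. x \<in> P \<Longrightarrow> R (\<i> *\<^sub>C x) = \<kappa> \<i> *\<^sub>C R x" by fastforce
  have k: "\<kappa> (a + b) = \<kappa> a + \<kappa> b" "\<kappa> (a * b) = \<kappa> a * \<kappa> b" "\<kappa> (of_real r) = of_real r"
    "cmod (\<kappa> a) = cmod a" "\<kappa> 1 = 1" for a b r using \<kappa> by auto
  have Rc: "R (c *\<^sub>C x) = \<kappa> c *\<^sub>C R x" if x: "x \<in> P" for x c
  proof -
    have c: "c = of_real (Re c) + of_real (Im c) * \<i>" by (simp add: complex_eq_iff)
    have "R (c *\<^sub>C x) = R (Re c *\<^sub>R x + Im c *\<^sub>R (\<i> *\<^sub>C x))"
      by (subst c) (simp add: scaleC_add_left scaleR_scaleC scaleC_scaleC)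
    also have "\<dots> = Re c *\<^sub>R R x + Im c *\<^sub>R (\<kappa> \<i> *\<^sub>C R x)"
      using x P_scale[OF x] by (simp add: Radd P_scaleR Rscale Rk)
    also have "\<dots> = \<kappa> c *\<^sub>C R x"
      by (subst (3) c) (simp only: k scaleC_add_left scaleR_scaleC scaleC_scaleC)
    finally show ?thesis .
  qed
  define T where "T x = \<kappa> (cinner x e) *\<^sub>C f + R (x - cinner x e *\<^sub>C e)" for x
  have inP: "x - cinner x e *\<^sub>C e \<in> P" for x by (simp add: P_def cinner_simps ee)
  have Tadd: "T (x + y) = T x + T y" for x y
  proof -
    have "(x + y) - cinner (x + y) e *\<^sub>C e = (x - cinner x e *\<^sub>C e) + (y - cinner y e *\<^sub>C e)"
      by (simp add: cinner_simps scaleC_add_left)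
    then have "R ((x + y) - cinner (x + y) e *\<^sub>C e) = R (x - cinner x e *\<^sub>C e) + R (y - cinner y e *\<^sub>C e)"
      by (simp only: Radd[OF inP inP])
    then show ?thesis by (simp add: T_def cinner_simps k scaleC_add_left)
  qed
  have Tc: "T (c *\<^sub>C x) = \<kappa> c *\<^sub>C T x" for c x
  proof -
    have "c *\<^sub>C x - cinner (c *\<^sub>C x) e *\<^sub>C e = c *\<^sub>C (x - cinner x e *\<^sub>C e)"
      by (simp add: cinner_simps complex_vector.scale_right_diff_distrib scaleC_scaleC)
    then have "R (c *\<^sub>C x - cinner (c *\<^sub>C x) e *\<^sub>C e) = \<kappa> c *\<^sub>C R (x - cinner x e *\<^sub>C e)"
      by (simp only: Rc[OF inP])
    then show ?thesis by (simp add: T_def cinner_simps k scaleC_add_right scaleC_scaleC)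
  qed
  have TS: "\<exists>w. cmod w = 1 \<and> T x = w *\<^sub>C S x" for x
  proof (cases "cinner x e = 0")
    case True
    then have "x \<in> P" "T x = R x" by (auto simp: P_def T_def \<kappa> k(3)[of 0, simplified])
    then show ?thesis using RS by simp
  next
    case False
    define a where "a = cinner x e"
    define y where "y = inverse a *\<^sub>C (x - a *\<^sub>C e)"
    have a: "a \<noteq> 0" using False by (simp add: a_def)
    have y: "y \<in> P" unfolding y_def a_def by (rule P_scale[OF inP])
    have xe: "x - a *\<^sub>C e = a *\<^sub>C y" using a by (simp add: y_def scaleC_scaleC)
    have x: "x = a *\<^sub>C (e + y)" using xe by (simp add: scaleC_add_right algebra_simps)
    have "T x = \<kappa> a *\<^sub>C (f + R y)"
      using xe unfolding T_def a_def[symmetric] by (simp add: Rc[OF y] scaleC_add_right)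
    then have Tx: "T x = (\<kappa> a * g y) *\<^sub>C S (e + y)" by (simp add: fR scaleC_scaleC)
    show ?thesis
    proof (rule collinear_if_Cauchy_Schwarz_tight)
      show n: "norm (T x) = norm (S x)"
        unfolding Tx nS[of x] arg_cong[OF x, of norm] by (simp add: norm_scaleC norm_mult k g1 nS)
      have "cmod (cinner (T x) (S x)) = cmod (cinner (a *\<^sub>C (e + y)) x)"
        unfolding Tx by (simp add: cinner_scaleC_left norm_mult k g1 tp)
      also have "\<dots> = cmod (cinner x x)" by (simp only: x[symmetric])
      finally show "cmod (cinner (T x) (S x)) = norm (T x) * norm (S x)"
        by (simp add: n nS cmod_cinner_self power2_eq_square)
    qed
  qed
  have nT: "norm (T x) = norm x" for x
    using TS[of x] nS by (auto simp: norm_scaleC)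
  have "bounded_linear T"
    by (rule bounded_linear_intro[of _ 1]) (simp_all add: Tadd Tc k scaleR_scaleC nT)
  then have U: "Blinfun T x = T x" for x by (simp add: bounded_linear_Blinfun_apply)
  show ?thesis
  proof (rule that[of "Blinfun T"])
    show "clinear_op (Blinfun T) \<or> antilinear_op (Blinfun T)"
      using \<kappa> by (auto simp: clinear_op_def antilinear_op_def U Tc)
  qed (simp_all add: U nT TS)
qed

section \<open>Rank-one effects and the order\<close>

lemma rank1_effect: "norm x \<le> 1 \<Longrightarrow> rank1 x \<in> effects"
proof -
  assume x: "norm x \<le> 1"
  have "(cmod (cinner y x))\<^sup>2 \<le> (norm y)\<^sup>2" for y
    using complex_Cauchy_Schwarz[of y x] mult_left_mono[OF x, of "norm y"]
    by (intro power_mono) auto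
  then show ?thesis
    by (simp add: effects_iff rank1_selfadjoint rank1_form power2_norm_eq_inner)
qed

lemma scaleR_effect: "A \<in> effects \<Longrightarrow> 0 \<le> t \<Longrightarrow> t \<le> 1 \<Longrightarrow> t *\<^sub>R A \<in> effects"
  by (auto simp: effects_iff selfadjoint_scaleR blinfun.scaleR_left
      intro: order_trans[OF mult_left_le_one_le])

lemma rank1_phase: "cmod c = 1 \<Longrightarrow> rank1 (c *\<^sub>C x) = rank1 x"
  by (simp add: rank1_scaleC)

lemma rank1_if_kills_complement:
  assumes B: "0 \<le>\<^sub>o B" and x: "norm x = 1" and w: "\<And>w. cinner w x = 0 \<Longrightarrow> B w = 0"
  shows "B = (B x \<bullet> x) *\<^sub>R rank1 x"
proof (rule selfadjoint_eqI)
  show "selfadjoint_op B" using B by (simp add: pos_op_iff)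
  show "selfadjoint_op ((B x \<bullet> x) *\<^sub>R rank1 x)" by (intro selfadjoint_scaleR rank1_selfadjoint)
  fix z
  obtain a v where z: "z = a *\<^sub>C x + v" "cinner v x = 0" by (rule orthogonal_split)
  have "cinner z x = a" using z(2) x by (simp add: z(1) cinner_simps cinner_self)
  moreover have "B z \<bullet> z = (cmod a)\<^sup>2 * (B x \<bullet> x)"
    using form_modulo_kernel[OF B w[OF z(2)], of a x 1] by (simp add: z(1))
  ultimately show "B z \<bullet> z = ((B x \<bullet> x) *\<^sub>R rank1 x) z \<bullet> z"
    by (simp add: blinfun.scaleR_left rank1_form)
qed

lemma below_rank1:
  assumes B: "0 \<le>\<^sub>o B" and le: "B \<le>\<^sub>o s *\<^sub>R rank1 x" and x: "norm x = 1"
  shows "B = (B x \<bullet> x) *\<^sub>R rank1 x" "0 \<le> B x \<bullet> x" "B x \<bullet> x \<le> s"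
proof -
  have le': "B y \<bullet> y \<le> s * (cmod (cinner y x))\<^sup>2" for y
    using le by (simp add: op_le_iff blinfun.scaleR_left rank1_form)
  show "0 \<le> B x \<bullet> x" using B by (simp add: pos_op_iff)
  show "B x \<bullet> x \<le> s" using le'[of x] x by (simp add: cmod_cinner_self)
  show "B = (B x \<bullet> x) *\<^sub>R rank1 x"
  proof (rule rank1_if_kills_complement[OF B x])
    fix w assume "cinner w x = 0"
    then have "B w \<bullet> w = 0" using le'[of w] B by (auto simp: pos_op_iff intro: antisym)
    then show "B w = 0" using pos_op_kernel[OF B] by blast
  qed
qed

lemma rank1_le_iff: "norm x = 1 \<Longrightarrow> t *\<^sub>R rank1 x \<le>\<^sub>o s *\<^sub>R rank1 x \<longleftrightarrow> t \<le> s"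
proof -
  assume x: "norm x = 1"
  have "t \<le> s" if "t *\<^sub>R rank1 x \<le>\<^sub>o s *\<^sub>R rank1 x"
    using that x by (auto simp: op_le_iff blinfun.scaleR_left rank1_form cmod_cinner_self dest: spec[of _ x])
  then show ?thesis
    by (auto simp: op_le_iff selfadjoint_scaleR rank1_selfadjoint blinfun.scaleR_left rank1_form
        mult_right_mono)
qed

lemma rank1_le_collinear:
  assumes le: "r *\<^sub>R rank1 u \<le>\<^sub>o s *\<^sub>R rank1 v" and r: "r > 0"
  shows "\<exists>c. u = c *\<^sub>C v"
proof -
  obtain a w where u: "u = a *\<^sub>C v + w" "cinner w v = 0" by (rule orthogonal_split)
  have "r * (cmod (cinner w u))\<^sup>2 \<le> 0"
    using le u(2) by (auto simp: op_le_iff blinfun.scaleR_left rank1_form dest: spec[of _ w])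
  then have "cinner w u = 0" using r by (simp add: mult_le_0_iff)
  then have "w = 0" using u(2) by (simp add: u(1) cinner_simps cinner_self)
  then show ?thesis using u by auto
qed

lemma rank1_le_same_line:
  assumes "r *\<^sub>R rank1 x \<le>\<^sub>o s *\<^sub>R rank1 y" "r > 0" "norm x = 1" "norm y = 1"
  shows "\<exists>c. cmod c = 1 \<and> x = c *\<^sub>C y" "rank1 x = rank1 y"
proof -
  show *: "\<exists>c. cmod c = 1 \<and> x = c *\<^sub>C y"
    using rank1_le_collinear[OF assms(1,2)] assms(3,4) by (auto simp: norm_scaleC)
  then show "rank1 x = rank1 y" using rank1_phase by blast
qed

definition rank_one :: "('h::complex_hilbert \<Rightarrow>\<^sub>L 'h) \<Rightarrow> bool" where
  "rank_one A \<longleftrightarrow> (\<exists>x t. norm x = 1 \<and> 0 < t \<and> t \<le> 1 \<and> A = t *\<^sub>R rank1 x)"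

lemma op_le_rank1_of_vector:
  assumes A: "0 \<le>\<^sub>o A" and x: "A x \<noteq> 0"
  shows "(1 / (A x \<bullet> x)) *\<^sub>R rank1 (A x) \<le>\<^sub>o A" "A x \<bullet> x > 0"
proof -
  have sA: "selfadjoint_op A" using A by (simp add: pos_op_iff)
  show pos: "A x \<bullet> x > 0"
    using A x pos_op_kernel[OF A, of x] by (metis pos_op_iff order_less_le)
  have "(cmod (cinner y (A x)))\<^sup>2 \<le> (A y \<bullet> y) * (A x \<bullet> x)" for y
    using pos_op_Cauchy_Schwarz[OF A, of y x] by (simp add: selfadjoint_cinner[OF sA])
  then show "(1 / (A x \<bullet> x)) *\<^sub>R rank1 (A x) \<le>\<^sub>o A"
    using pos sA
    by (simp add: op_le_iff selfadjoint_scaleR rank1_selfadjoint blinfun.scaleR_left rank1_form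
        field_simps)
qed

text \<open>
  Rank one is an order-theoretic property. Whenever \<open>A x \<noteq> 0\<close>, a positive multiple of \<open>rank1 (A x)\<close> lies
  below \<open>A\<close>, and comparable rank-one operators have the same range; so if the effects below \<open>A\<close> form a
  chain, the range of \<open>A\<close> is one line.
\<close>

lemma rank_one_iff_chain:
  assumes A: "A \<in> effects"
  shows "rank_one A \<longleftrightarrow>
    A \<noteq> 0 \<and> (\<forall>B\<in>effects. \<forall>C\<in>effects. B \<le>\<^sub>o A \<longrightarrow> C \<le>\<^sub>o A \<longrightarrow> B \<le>\<^sub>o C \<or> C \<le>\<^sub>o B)"
proof
  assume "rank_one A"
  then obtain x t where x: "norm x = 1" "0 < t" "t \<le> 1" "A = t *\<^sub>R rank1 x"
    by (auto simp: rank_one_def)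
  have "A x \<bullet> x = t" using x by (simp add: blinfun.scaleR_left rank1_form cmod_cinner_self)
  then have "A \<noteq> 0" using x(2) by auto
  moreover have "B \<le>\<^sub>o C \<or> C \<le>\<^sub>o B"
    if "B \<in> effects" "C \<in> effects" "B \<le>\<^sub>o A" "C \<le>\<^sub>o A" for B C
    using below_rank1(1)[OF effect_pos[OF that(1)] that(3)[unfolded x(4)] x(1)]
      below_rank1(1)[OF effect_pos[OF that(2)] that(4)[unfolded x(4)] x(1)]
      rank1_le_iff[OF x(1)] by (metis linear)
  ultimately show "A \<noteq> 0 \<and> (\<forall>B\<in>effects. \<forall>C\<in>effects. B \<le>\<^sub>o A \<longrightarrow> C \<le>\<^sub>o A \<longrightarrow> B \<le>\<^sub>o C \<or> C \<le>\<^sub>o B)"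
    by blast
next
  assume chain: "A \<noteq> 0 \<and> (\<forall>B\<in>effects. \<forall>C\<in>effects. B \<le>\<^sub>o A \<longrightarrow> C \<le>\<^sub>o A \<longrightarrow> B \<le>\<^sub>o C \<or> C \<le>\<^sub>o B)"
  note Ap = effect_pos[OF A]
  have sA: "selfadjoint_op A" by (rule effect_selfadjoint[OF A])
  obtain x0 where x0: "A x0 \<noteq> 0" using chain by (metis blinfun_eqI blinfun.zero_left)
  define R where "R x = (1 / (A x \<bullet> x)) *\<^sub>R rank1 (A x)" for x
  have R: "R x \<le>\<^sub>o A" "R x \<in> effects" if "A x \<noteq> 0" for x
  proof -
    show le: "R x \<le>\<^sub>o A" unfolding R_def by (rule op_le_rank1_of_vector[OF Ap that])
    have "0 \<le>\<^sub>o R x" unfolding R_def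
      using op_le_rank1_of_vector(2)[OF Ap that] rank1_pos[of "A x"]
      by (simp add: pos_op_iff selfadjoint_scaleR blinfun.scaleR_left)
    moreover have "R x \<le>\<^sub>o id_blinfun" using le A op_le_trans by (auto simp: effects_def)
    ultimately show "R x \<in> effects" by (simp add: effects_def)
  qed
  have col: "\<exists>c. A y = c *\<^sub>C A x0" for y
  proof (cases "A y = 0")
    case True then show ?thesis by (intro exI[of _ 0]) simp
  next
    case False
    have "1 / (A y \<bullet> y) > 0" "1 / (A x0 \<bullet> x0) > 0"
      using op_le_rank1_of_vector(2)[OF Ap] False x0 by auto
    moreover have "R y \<le>\<^sub>o R x0 \<or> R x0 \<le>\<^sub>o R y" using chain R False x0 by blast
    ultimately have "(\<exists>c. A y = c *\<^sub>C A x0) \<or> (\<exists>c. A x0 = c *\<^sub>C A y)"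
      unfolding R_def using rank1_le_collinear by blast
    then show ?thesis
    proof
      assume "\<exists>c. A x0 = c *\<^sub>C A y"
      then obtain c where c: "A x0 = c *\<^sub>C A y" by blast
      then have "c \<noteq> 0" using x0 by auto
      then have "A y = inverse c *\<^sub>C A x0" by (simp add: c scaleC_scaleC)
      then show ?thesis by blast
    qed
  qed
  define x where "x = (1 / norm (A x0)) *\<^sub>R A x0"
  have nx: "norm x = 1" using x0 by (simp add: x_def)
  have Ax: "A = (A x \<bullet> x) *\<^sub>R rank1 x"
  proof (rule rank1_if_kills_complement[OF Ap nx])
    fix w assume w: "cinner w x = 0"
    obtain c where c: "A w = c *\<^sub>C A x0" using col by blast
    have "cinner (A x0) w = 0"
      using w x0 by (simp add: x_def cinner_simps cinner_eq_0_commute)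
    then have "A w \<bullet> w = 0" by (simp add: c inner_eq_Re_cinner cinner_simps)
    then show "A w = 0" using pos_op_kernel[OF Ap] by blast
  qed
  moreover have "0 < A x \<bullet> x"
  proof -
    have "A x \<bullet> x \<noteq> 0" using Ax chain by (metis scaleR_zero_left)
    then show ?thesis using A by (simp add: effects_iff less_le)
  qed
  moreover have "A x \<bullet> x \<le> 1" using A nx by (metis effects_iff norm_eq_1)
  ultimately show "rank_one A" unfolding rank_one_def using nx by blast
qed

text \<open>
  A uniform boundedness principle. The vectors \<open>x\<close> with \<open>\<bar>\<langle>y, x\<rangle>\<bar>\<^sup>2 \<le> n \<langle>A y, y\<rangle>\<close> for all \<open>y\<close> form a closed
  set, and by assumption these sets cover the space as \<open>n\<close> grows. By Baire one of them contains a ball.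
  Taking differences, the set for \<open>4 n\<close> contains a ball around \<open>0\<close>; take \<open>x\<close> parallel to \<open>y\<close>.
\<close>

lemma pointwise_lower_bound_imp_coercive:
  fixes A :: "'h::complex_hilbert \<Rightarrow>\<^sub>L 'h"
  assumes A: "A \<in> effects" and t: "\<And>x. norm x = 1 \<Longrightarrow> \<exists>t>0. t *\<^sub>R rank1 x \<le>\<^sub>o A"
  shows "coercive_op A"
proof -
  have nn: "0 \<le> A y \<bullet> y" for y using A by (simp add: effects_iff)
  define C where "C n = {x. \<forall>y. (cmod (cinner y x))\<^sup>2 \<le> real (Suc n) * (A y \<bullet> y)}" for n
  have cm: "(cmod (cinner y x))\<^sup>2 = (y \<bullet> x)\<^sup>2 + ((\<i> *\<^sub>C y) \<bullet> x)\<^sup>2" for x y :: 'h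
    by (simp add: cmod_power2 inner_eq_Re_cinner cinner_simps)
  have "closed (C n)" for n
    unfolding C_def Collect_all_eq cm
    by (intro closed_INT ballI closed_Collect_le continuous_intros)
  moreover have "(\<Union>n. C n) = UNIV"
  proof (rule UNIV_eq_I[symmetric])
    fix x :: 'h
    have "\<exists>n. x \<in> C n"
    proof (cases "x = 0")
      case True then show ?thesis using nn by (auto simp: C_def)
    next
      case False
      define u where "u = (1 / norm x) *\<^sub>R x"
      have "norm u = 1" using False by (simp add: u_def)
      then obtain s where s: "s > 0" "s *\<^sub>R rank1 u \<le>\<^sub>o A" using t by blast
      have x: "x = of_real (norm x) *\<^sub>C u" using False by (simp add: u_def scaleC_of_real)
      obtain n where n: "(norm x)\<^sup>2 / s \<le> real (Suc n)"
        by (meson less_imp_le of_nat_Suc order_trans reals_Archimedean2 of_nat_le_iff le_SucI order_refl)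
      have "(cmod (cinner y x))\<^sup>2 \<le> real (Suc n) * (A y \<bullet> y)" for y
      proof -
        have "s * (cmod (cinner y u))\<^sup>2 \<le> A y \<bullet> y"
          using s(2) by (simp add: op_le_iff blinfun.scaleR_left rank1_form)
        then have "(norm x)\<^sup>2 / s * (s * (cmod (cinner y u))\<^sup>2) \<le> real (Suc n) * (A y \<bullet> y)"
          using n s(1) by (intro mult_mono) auto
        moreover have "(cmod (cinner y x))\<^sup>2 = (norm x)\<^sup>2 * (cmod (cinner y u))\<^sup>2"
          by (subst x) (simp add: cinner_scaleC_right norm_mult power_mult_distrib)
        ultimately show ?thesis using s(1) by simp
      qed
      then show ?thesis by (auto simp: C_def)
    qed
    then show "x \<in> (\<Union>n. C n)" by blast
  qed
  ultimately have "\<exists>n. interior (C n) \<noteq> {}"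
    using Baire_category_alt[of "euclidean :: 'h topology" "range C"] completely_metrizable_space_euclidean
    by force
  then obtain n x0 where "x0 \<in> interior (C n)" by blast
  then obtain r where r: "r > 0" "ball x0 r \<subseteq> C n" by (meson mem_interior)
  let ?N = "real (Suc n)"
  have small: "(cmod (cinner y z))\<^sup>2 \<le> 4 * ?N * (A y \<bullet> y)" if z: "norm z < r" for y z
  proof -
    have "x0 + z \<in> C n" "x0 \<in> C n" using r z by (auto simp: dist_norm subset_eq)
    then have a: "(cmod (cinner y (x0 + z)))\<^sup>2 \<le> ?N * (A y \<bullet> y)" "(cmod (cinner y x0))\<^sup>2 \<le> ?N * (A y \<bullet> y)"
      by (auto simp: C_def)
    have "cmod (cinner y z) \<le> cmod (cinner y (x0 + z)) + cmod (cinner y x0)"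
      using norm_triangle_ineq4[of "cinner y (x0 + z)" "cinner y x0"] by (simp add: cinner_add_right)
    then have "(cmod (cinner y z))\<^sup>2 \<le> (cmod (cinner y (x0 + z)) + cmod (cinner y x0))\<^sup>2"
      by (intro power_mono) auto
    also have "\<dots> \<le> 2 * (cmod (cinner y (x0 + z)))\<^sup>2 + 2 * (cmod (cinner y x0))\<^sup>2"
      using sum_squares_bound[of "cmod (cinner y (x0 + z))" "cmod (cinner y x0)"]
      by (simp add: power2_sum)
    finally show ?thesis using a by linarith
  qed
  have "(r / 2)\<^sup>2 / (4 * ?N) * (y \<bullet> y) \<le> A y \<bullet> y" for y
  proof (cases "y = 0")
    case False
    define z where "z = (r / (2 * norm y)) *\<^sub>R y"
    have "norm z < r" using False r by (simp add: z_def)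
    moreover have "cmod (cinner y z) = r / 2 * norm y"
      using False r by (simp add: z_def cinner_simps norm_mult norm_divide cmod_cinner_self power2_eq_square)
    ultimately have "(r / 2 * norm y)\<^sup>2 \<le> 4 * ?N * (A y \<bullet> y)" using small[of z y] by (simp only:)
    then show ?thesis
      by (simp add: field_simps power_mult_distrib power2_norm_eq_inner)
  qed simp
  moreover have "(r / 2)\<^sup>2 / (4 * ?N) > 0" using r by simp
  ultimately show ?thesis
    using effect_selfadjoint[OF A] unfolding coercive_op_def by blast
qed

lemma coercive_iff_above_all_lines:
  assumes A: "A \<in> effects"
  shows "coercive_op A \<longleftrightarrow> (\<forall>x. norm x = 1 \<longrightarrow> (\<exists>t. 0 < t \<and> t \<le> 1 \<and> t *\<^sub>R rank1 x \<le>\<^sub>o A))"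
proof
  assume "coercive_op A"
  then obtain e where e: "e > 0" "\<And>y. e * (y \<bullet> y) \<le> A y \<bullet> y" by (auto simp: coercive_op_def)
  show "\<forall>x. norm x = 1 \<longrightarrow> (\<exists>t. 0 < t \<and> t \<le> 1 \<and> t *\<^sub>R rank1 x \<le>\<^sub>o A)"
  proof (intro allI impI)
    fix x :: 'a assume x: "norm x = 1"
    have "min e 1 * (cmod (cinner y x))\<^sup>2 \<le> A y \<bullet> y" for y
    proof -
      have "(cmod (cinner y x))\<^sup>2 \<le> (norm y)\<^sup>2"
        using complex_Cauchy_Schwarz[of y x] x by (intro power_mono) auto
      then have "min e 1 * (cmod (cinner y x))\<^sup>2 \<le> e * (y \<bullet> y)"
        using e(1) by (intro mult_mono) (auto simp: power2_norm_eq_inner)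
      then show ?thesis using e(2)[of y] by linarith
    qed
    then have "min e 1 *\<^sub>R rank1 x \<le>\<^sub>o A"
      by (auto simp: op_le_iff selfadjoint_scaleR rank1_selfadjoint effect_selfadjoint[OF A]
          blinfun.scaleR_left rank1_form)
    then show "\<exists>t. 0 < t \<and> t \<le> 1 \<and> t *\<^sub>R rank1 x \<le>\<^sub>o A"
      using e(1) by (intro exI[of _ "min e 1"]) auto
  qed
qed (use pointwise_lower_bound_imp_coercive[OF A] in blast)

text \<open>
  The Cauchy--Schwarz inequality for the form of \<open>A\<close>, in which \<open>A\<^sup>-\<^sup>1 x\<close> is the extremal vector. It makes
  the value at \<open>x\<close> of the form of \<open>A\<^sup>-\<^sup>1\<close> an order-theoretic quantity.
\<close>

lemma rank1_le_coercive_iff: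
  assumes A: "coercive_op A" and t: "t \<ge> 0"
  shows "t *\<^sub>R rank1 x \<le>\<^sub>o A \<longleftrightarrow> t * (op_inv A x \<bullet> x) \<le> 1"
proof
  note sA = coercive_selfadjoint[OF A] and pA = coercive_pos[OF A]
  define y where "y = op_inv A x"
  have x: "A y = x" by (simp add: y_def A)
  have xy: "cinner y x = of_real (y \<bullet> x)"
    using cinner_commute[of y x] selfadjoint_cinner[OF sA, of y y]
    by (simp add: x complex_eq_iff inner_eq_Re_cinner)
  have yx: "y \<bullet> x = A y \<bullet> y" by (simp add: x inner_commute)
  have yx0: "0 \<le> y \<bullet> x" unfolding yx using pA by (simp add: pos_op_iff)
  {
    assume "t *\<^sub>R rank1 x \<le>\<^sub>o A"
    then have "t * (cmod (cinner y x))\<^sup>2 \<le> A y \<bullet> y"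
      by (simp add: op_le_iff blinfun.scaleR_left rank1_form)
    then have "t * (y \<bullet> x) * (y \<bullet> x) \<le> 1 * (y \<bullet> x)"
      unfolding xy yx[symmetric] by (simp add: power2_eq_square mult.assoc)
    then show "t * (op_inv A x \<bullet> x) \<le> 1"
      using yx0 unfolding y_def[symmetric] by (cases "y \<bullet> x = 0") auto
  next
    assume le: "t * (op_inv A x \<bullet> x) \<le> 1"
    have "t * (cmod (cinner z x))\<^sup>2 \<le> A z \<bullet> z" for z
    proof -
      have "(cmod (cinner z x))\<^sup>2 \<le> (A z \<bullet> z) * (y \<bullet> x)"
        using pos_op_Cauchy_Schwarz[OF pA, of z y] selfadjoint_cinner[OF sA, of z y]
        by (simp add: x inner_commute)
      then have "t * (cmod (cinner z x))\<^sup>2 \<le> t * ((A z \<bullet> z) * (y \<bullet> x))"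
        using t by (rule mult_left_mono)
      also have "\<dots> = (t * (y \<bullet> x)) * (A z \<bullet> z)" by simp
      also have "\<dots> \<le> 1 * (A z \<bullet> z)"
        using le pA unfolding y_def[symmetric] by (intro mult_right_mono) (auto simp: pos_op_iff)
      finally show ?thesis by simp
    qed
    then show "t *\<^sub>R rank1 x \<le>\<^sub>o A"
      by (simp add: op_le_iff selfadjoint_scaleR rank1_selfadjoint sA blinfun.scaleR_left rank1_form)
  }
qed

section \<open>Order automorphisms act on lines\<close>

locale effect_automorphism =
  fixes \<phi> :: "('h::complex_hilbert \<Rightarrow>\<^sub>L 'h) \<Rightarrow> ('h \<Rightarrow>\<^sub>L 'h)"
  assumes bij: "bij_betw \<phi> effects effects"
    and order: "A \<in> effects \<Longrightarrow> B \<in> effects \<Longrightarrow> A \<le>\<^sub>o B \<longleftrightarrow> \<phi> A \<le>\<^sub>o \<phi> B"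
begin

lemma phi_effect: "A \<in> effects \<Longrightarrow> \<phi> A \<in> effects"
  using bij by (rule bij_betw_apply)

lemma phi_onto: assumes "B \<in> effects" obtains A where "A \<in> effects" "\<phi> A = B"
  using bij assms unfolding bij_betw_def by (metis imageE)

lemma phi_inj: "A \<in> effects \<Longrightarrow> B \<in> effects \<Longrightarrow> \<phi> A = \<phi> B \<longleftrightarrow> A = B"
  using bij unfolding bij_betw_def by (meson inj_on_eq_iff)

lemma zero_effect: "0 \<in> effects" by (simp add: effects_iff selfadjoint_zero)

lemma phi_zero: "\<phi> 0 = 0"
proof -
  obtain A where A: "A \<in> effects" "\<phi> A = 0" using phi_onto[OF zero_effect] .
  then have "\<phi> 0 \<le>\<^sub>o 0" using order[OF zero_effect A(1)] effect_pos by auto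
  then show ?thesis using effect_pos[OF phi_effect[OF zero_effect]] op_le_antisym by blast
qed

lemma phi_rank_one: assumes A: "A \<in> effects" shows "rank_one (\<phi> A) \<longleftrightarrow> rank_one A"
proof -
  have "(\<forall>B\<in>effects. \<forall>C\<in>effects. B \<le>\<^sub>o \<phi> A \<longrightarrow> C \<le>\<^sub>o \<phi> A \<longrightarrow> B \<le>\<^sub>o C \<or> C \<le>\<^sub>o B) \<longleftrightarrow>
      (\<forall>B\<in>\<phi> ` effects. \<forall>C\<in>\<phi> ` effects. B \<le>\<^sub>o \<phi> A \<longrightarrow> C \<le>\<^sub>o \<phi> A \<longrightarrow> B \<le>\<^sub>o C \<or> C \<le>\<^sub>o B)"
    using bij by (simp add: bij_betw_def)
  also have "\<dots> \<longleftrightarrow> (\<forall>B\<in>effects. \<forall>C\<in>effects. B \<le>\<^sub>o A \<longrightarrow> C \<le>\<^sub>o A \<longrightarrow> B \<le>\<^sub>o C \<or> C \<le>\<^sub>o B)"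
    by (simp add: order[symmetric] A)
  moreover have "\<phi> A = 0 \<longleftrightarrow> A = 0" using phi_inj[OF A zero_effect] phi_zero by simp
  ultimately show ?thesis
    using rank_one_iff_chain[OF A] rank_one_iff_chain[OF phi_effect[OF A]] by simp
qed

text \<open>
  The image of a rank-one projection has rank one, and it is again a projection because projections are
  the maximal ones among the effects of rank one.
\<close>

lemma line_image:
  assumes x: "norm x = 1"
  shows "\<exists>y. norm y = 1 \<and> \<phi> (rank1 x) = rank1 y"
proof -
  have Rx: "rank1 x \<in> effects" using x by (intro rank1_effect) simp
  have "rank_one (rank1 x)" unfolding rank_one_def using x by (intro exI[of _ x] exI[of _ 1]) simp
  then obtain y t where y: "norm y = 1" "0 < t" "t \<le> 1" "\<phi> (rank1 x) = t *\<^sub>R rank1 y"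
    using phi_rank_one[OF Rx] by (auto simp: rank_one_def)
  have Ry: "rank1 y \<in> effects" using y by (intro rank1_effect) simp
  then obtain C where C: "C \<in> effects" "\<phi> C = rank1 y" using phi_onto by blast
  have "rank_one (rank1 y)" unfolding rank_one_def using y(1) by (intro exI[of _ y] exI[of _ 1]) simp
  then obtain z s where z: "norm z = 1" "0 < s" "s \<le> 1" "C = s *\<^sub>R rank1 z"
    using phi_rank_one[OF C(1)] C(2) by (auto simp: rank_one_def)
  have "t *\<^sub>R rank1 y \<le>\<^sub>o 1 *\<^sub>R rank1 y" using rank1_le_iff[OF y(1)] y(3) by blast
  then have le: "rank1 x \<le>\<^sub>o C" using order[OF Rx C(1)] y(4) C(2) by simp
  then have "1 *\<^sub>R rank1 x \<le>\<^sub>o s *\<^sub>R rank1 z" using z by simp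
  from rank1_le_same_line(2)[OF this zero_less_one x z(1)] have "rank1 x = rank1 z" .
  then have "C \<le>\<^sub>o rank1 x" using z rank1_le_iff[OF x, of s 1] by simp
  then have "C = rank1 x" using le op_le_antisym by blast
  then show ?thesis using C y by auto
qed

definition line :: "'h \<Rightarrow> 'h" where
  "line x = (SOME y. norm y = 1 \<and> \<phi> (rank1 x) = rank1 y)"

lemma line: "norm x = 1 \<Longrightarrow> norm (line x) = 1" "norm x = 1 \<Longrightarrow> \<phi> (rank1 x) = rank1 (line x)"
  using someI_ex[OF line_image[of x]] by (simp_all add: line_def)

text \<open>
  Multiples of \<open>rank1 x\<close> go to multiples of \<open>rank1 (line x)\<close>; the value of the form at the unit vector
  \<open>line x\<close> is the coefficient.
\<close>

definition level :: "'h \<Rightarrow> real \<Rightarrow> real" where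
  "level x t = \<phi> (t *\<^sub>R rank1 x) (line x) \<bullet> line x"

context
  fixes x :: 'h assumes x: "norm x = 1"
begin

lemma Rx_effect: "0 \<le> t \<Longrightarrow> t \<le> 1 \<Longrightarrow> t *\<^sub>R rank1 x \<in> effects"
  using x by (intro scaleR_effect rank1_effect) auto

lemma Rline_effect: "0 \<le> t \<Longrightarrow> t \<le> 1 \<Longrightarrow> t *\<^sub>R rank1 (line x) \<in> effects"
  using line[OF x] by (intro scaleR_effect rank1_effect) auto

lemma level:
  assumes t: "0 \<le> t" "t \<le> 1"
  shows "\<phi> (t *\<^sub>R rank1 x) = level x t *\<^sub>R rank1 (line x)" "0 \<le> level x t" "level x t \<le> 1"
proof -
  have "t *\<^sub>R rank1 x \<le>\<^sub>o 1 *\<^sub>R rank1 x" using rank1_le_iff[OF x] t by blast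
  then have "\<phi> (t *\<^sub>R rank1 x) \<le>\<^sub>o 1 *\<^sub>R rank1 (line x)"
    using order[OF Rx_effect[OF t] Rx_effect[of 1]] line[OF x] by simp
  from below_rank1[OF effect_pos[OF phi_effect[OF Rx_effect[OF t]]] this line(1)[OF x]]
  show "\<phi> (t *\<^sub>R rank1 x) = level x t *\<^sub>R rank1 (line x)" "0 \<le> level x t" "level x t \<le> 1"
    by (simp_all add: level_def)
qed

lemma level_le_iff:
  assumes "0 \<le> s" "s \<le> 1" "0 \<le> t" "t \<le> 1" shows "level x s \<le> level x t \<longleftrightarrow> s \<le> t"
  using order[OF Rx_effect[OF assms(1,2)] Rx_effect[OF assms(3,4)]]
  by (simp add: level assms rank1_le_iff x line)

lemma level_0: "level x 0 = 0" by (simp add: level_def phi_zero)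

lemma level_1: "level x 1 = 1"
  by (simp add: level_def line x rank1_form cmod_cinner_self)

lemma level_pos: "0 < t \<Longrightarrow> t \<le> 1 \<Longrightarrow> 0 < level x t"
  using level_le_iff[of t 0] level_0 by auto

lemma level_onto:
  assumes r: "0 \<le> r" "r \<le> 1" obtains t where "0 \<le> t" "t \<le> 1" "level x t = r"
proof -
  obtain C where C: "C \<in> effects" "\<phi> C = r *\<^sub>R rank1 (line x)" using phi_onto[OF Rline_effect[OF r]] .
  have "r *\<^sub>R rank1 (line x) \<le>\<^sub>o 1 *\<^sub>R rank1 (line x)" using rank1_le_iff[OF line(1)[OF x]] r by blast
  then have "C \<le>\<^sub>o 1 *\<^sub>R rank1 x"
    using order[OF C(1) Rx_effect[of 1]] C(2) line[OF x] by simp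
  from below_rank1[OF effect_pos[OF C(1)] this x] obtain t where
    t: "C = t *\<^sub>R rank1 x" "0 \<le> t" "t \<le> 1" by blast
  then have "level x t = r"
    using C(2) by (simp add: level_def blinfun.scaleR_left rank1_form cmod_cinner_self line x)
  with t that show ?thesis by blast
qed

lemma level_le_image:
  assumes "A \<in> effects" "0 \<le> t" "t \<le> 1"
  shows "level x t *\<^sub>R rank1 (line x) \<le>\<^sub>o \<phi> A \<longleftrightarrow> t *\<^sub>R rank1 x \<le>\<^sub>o A"
  using order[OF Rx_effect[OF assms(2,3)] assms(1)] level[OF assms(2,3)] by simp

end

lemma line_onto:
  assumes y: "norm y = 1" obtains x c where "norm x = 1" "cmod c = 1" "line x = c *\<^sub>C y"
proof -
  have Ry: "rank1 y \<in> effects" using y by (intro rank1_effect) simp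
  obtain C where C: "C \<in> effects" "\<phi> C = rank1 y" using phi_onto[OF Ry] .
  have "rank_one (rank1 y)" unfolding rank_one_def using y by (intro exI[of _ y] exI[of _ 1]) simp
  then obtain x t where x: "norm x = 1" "0 < t" "t \<le> 1" "C = t *\<^sub>R rank1 x"
    using phi_rank_one[OF C(1)] C(2) by (auto simp: rank_one_def)
  have eq: "rank1 y = level x t *\<^sub>R rank1 (line x)" using level(1)[OF x(1), of t] x C by simp
  have "level x t *\<^sub>R rank1 (line x) \<le>\<^sub>o 1 *\<^sub>R rank1 y"
    unfolding eq[symmetric] by (simp add: op_le_refl rank1_selfadjoint)
  then have "\<exists>c. cmod c = 1 \<and> line x = c *\<^sub>C y"
    by (rule rank1_le_same_line(1)) (use level_pos[OF x(1)] x line y in auto)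
  then show ?thesis using that x by blast
qed

text \<open>
  Coercive effects are those that dominate a positive multiple of every rank-one projection, which is
  an order-theoretic description.
\<close>

lemma phi_coercive: assumes A: "A \<in> effects" shows "coercive_op (\<phi> A) \<longleftrightarrow> coercive_op A"
proof
  assume co: "coercive_op (\<phi> A)"
  have "\<exists>t. 0 < t \<and> t \<le> 1 \<and> t *\<^sub>R rank1 x \<le>\<^sub>o A" if x: "norm x = 1" for x
  proof -
    obtain s where s: "0 < s" "s \<le> 1" "s *\<^sub>R rank1 (line x) \<le>\<^sub>o \<phi> A"
      using co coercive_iff_above_all_lines[OF phi_effect[OF A]] line[OF x] by blast
    obtain t where t: "0 \<le> t" "t \<le> 1" "level x t = s" using level_onto[OF x, of s] s by auto
    have "t \<noteq> 0" using t s level_0[OF x] by auto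
    then show ?thesis using level_le_image[OF x A t(1,2)] t s by (intro exI[of _ t]) auto
  qed
  then show "coercive_op A" using coercive_iff_above_all_lines[OF A] by blast
next
  assume co: "coercive_op A"
  have "\<exists>t. 0 < t \<and> t \<le> 1 \<and> t *\<^sub>R rank1 y \<le>\<^sub>o \<phi> A" if y: "norm y = 1" for y
  proof -
    obtain x c where x: "norm x = 1" "cmod c = 1" "line x = c *\<^sub>C y" using line_onto[OF y] .
    obtain t where t: "0 < t" "t \<le> 1" "t *\<^sub>R rank1 x \<le>\<^sub>o A"
      using co coercive_iff_above_all_lines[OF A] x by blast
    have "level x t *\<^sub>R rank1 (line x) \<le>\<^sub>o \<phi> A" using level_le_image[OF x(1) A] t by simp
    then have "level x t *\<^sub>R rank1 y \<le>\<^sub>o \<phi> A" by (simp add: x(3) rank1_phase[OF x(2)])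
    then show ?thesis
      using level_pos[OF x(1)] level(3)[OF x(1)] t by (intro exI[of _ "level x t"]) auto
  qed
  then show "coercive_op (\<phi> A)" using coercive_iff_above_all_lines[OF phi_effect[OF A]] by blast
qed

lemma op_inv_form_ge_1:
  assumes "A \<in> effects" "coercive_op A" "norm x = 1" shows "1 \<le> op_inv A x \<bullet> x"
  using effect_to_pos_pos[OF assms(1,2)] assms(3)
  by (auto simp: pos_op_iff effect_to_pos_def blinfun.diff_left inner_diff_left norm_eq_1
      dest: spec[of _ x])

text \<open>
  For coercive \<open>A\<close> the number \<open>1 / \<langle>A\<^sup>-\<^sup>1 x, x\<rangle>\<close> is the largest \<open>t\<close> with \<open>t *\<^sub>R rank1 x \<le>\<^sub>o A\<close>, so \<open>level x\<close> takes
  it to the corresponding number for \<open>\<phi> A\<close>.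
\<close>

lemma level_op_inv:
  assumes A: "A \<in> effects" "coercive_op A" and x: "norm x = 1"
  shows "level x (1 / (op_inv A x \<bullet> x)) = 1 / (op_inv (\<phi> A) (line x) \<bullet> line x)"
proof -
  define q q' where "q = op_inv A x \<bullet> x" and "q' = op_inv (\<phi> A) (line x) \<bullet> line x"
  note \<phi>A = phi_effect[OF A(1)] and co = phi_coercive[OF A(1), THEN iffD2, OF A(2)]
  have q: "1 \<le> q" "1 \<le> q'"
    unfolding q_def q'_def using op_inv_form_ge_1 A \<phi>A co x line by auto
  have le: "level x t * q' \<le> 1 \<longleftrightarrow> t * q \<le> 1" if t: "0 \<le> t" "t \<le> 1" for t
    using level_le_image[OF x A(1) t] rank1_le_coercive_iff[OF A(2) t(1), of x]
      rank1_le_coercive_iff[OF co level(2)[OF x t], of "line x"]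
    unfolding q_def q'_def by simp
  have "level x (1 / q) * q' \<le> 1" using le[of "1 / q"] q by auto
  then have 1: "level x (1 / q) \<le> 1 / q'" using q by (simp add: field_simps)
  obtain t where t: "0 \<le> t" "t \<le> 1" "level x t = 1 / q'" using level_onto[OF x, of "1 / q'"] q by auto
  have "t * q \<le> 1" using le[OF t(1,2)] t(3) q by simp
  then have "t \<le> 1 / q" using q by (simp add: field_simps)
  then have "level x t \<le> level x (1 / q)" using level_le_iff[OF x t(1,2), of "1 / q"] q by simp
  then show ?thesis using 1 t unfolding q_def q'_def by simp
qed

definition \<psi> :: "('h \<Rightarrow>\<^sub>L 'h) \<Rightarrow> ('h \<Rightarrow>\<^sub>L 'h)" where
  "\<psi> B = effect_to_pos (\<phi> (pos_to_effect B))"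

definition \<sigma> :: "'h \<Rightarrow> 'h" where
  "\<sigma> x = line ((1 / norm x) *\<^sub>R x)"

text \<open>
  This is \<open>level\<close> in the coordinate \<open>1 / t - 1\<close> instead of \<open>t\<close>. The factors \<open>norm x\<close> come from evaluating
  forms at an arbitrary vector of a line instead of a unit vector.
\<close>

definition h :: "'h \<Rightarrow> real \<Rightarrow> real" where
  "h x s = 1 / level ((1 / norm x) *\<^sub>R x) (1 / (1 + s / (norm x)\<^sup>2)) - 1"

sublocale form_transport \<psi> \<sigma> h
proof
  fix B :: "'h \<Rightarrow>\<^sub>L 'h" assume B: "0 \<le>\<^sub>o B"
  note A = pos_to_effect_effect[OF B] pos_to_effect_coercive[OF B]
  then show "0 \<le>\<^sub>o \<psi> B"
    unfolding \<psi>_def using phi_effect phi_coercive by (intro effect_to_pos_pos) auto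
  show "\<exists>B'. 0 \<le>\<^sub>o B' \<and> \<psi> B' = B"
  proof -
    obtain A' where A': "A' \<in> effects" "\<phi> A' = pos_to_effect B" using phi_onto[OF A(1)] .
    then have co: "coercive_op A'" using phi_coercive[OF A'(1)] A(2) by simp
    have "\<psi> (effect_to_pos A') = B"
      unfolding \<psi>_def by (simp add: effect_to_pos_to_effect[OF co] A'(2) pos_to_effect_to_pos[OF B])
    then show ?thesis using effect_to_pos_pos[OF A'(1) co] by blast
  qed
  fix x :: 'h assume x: "x \<noteq> 0"
  define u where "u = (1 / norm x) *\<^sub>R x"
  have u: "norm u = 1" using x by (simp add: u_def)
  have inv: "op_inv (pos_to_effect B) = id_blinfun + B"
    unfolding pos_to_effect_def by (rule op_inv_op_inv[OF id_plus_pos_coercive[OF B]])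
  have "B u \<bullet> u = (B x \<bullet> x) / (norm x)\<^sup>2"
    by (simp add: u_def blinfun.scaleR_right power2_eq_square)
  then have "op_inv (pos_to_effect B) u \<bullet> u = 1 + (B x \<bullet> x) / (norm x)\<^sup>2"
    using u by (simp add: inv blinfun.add_left inner_add_left norm_eq_1)
  then have "op_inv (\<phi> (pos_to_effect B)) (line u) \<bullet> line u
      = 1 / level u (1 / (1 + (B x \<bullet> x) / (norm x)\<^sup>2))"
    using level_op_inv[OF A u] by simp
  then show "\<psi> B (\<sigma> x) \<bullet> \<sigma> x = h x (B x \<bullet> x)"
    using line(1)[OF u]
    by (simp add: \<psi>_def \<sigma>_def h_def effect_to_pos_def u_def[symmetric] blinfun.diff_left
        inner_diff_left norm_eq_1)
next
  fix x :: 'h assume x: "x \<noteq> 0"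
  define u where "u = (1 / norm x) *\<^sub>R x"
  have u: "norm u = 1" using x by (simp add: u_def)
  show "\<sigma> x \<noteq> 0" using line(1)[OF u] by (auto simp: \<sigma>_def u_def[symmetric])
  show "h x 0 = 0" using level_1[OF u] by (simp add: h_def u_def[symmetric])
  fix s t :: real assume st: "0 \<le> s" "s < t"
  define a b where "a = 1 / (1 + s / (norm x)\<^sup>2)" and "b = 1 / (1 + t / (norm x)\<^sup>2)"
  have nx: "(norm x)\<^sup>2 > 0" using x by simp
  have d: "0 \<le> s / (norm x)\<^sup>2" "s / (norm x)\<^sup>2 < t / (norm x)\<^sup>2"
    using st nx by (simp_all add: divide_strict_right_mono)
  then have ab: "0 < b" "b < a" "a \<le> 1"
    unfolding a_def b_def by (auto simp: field_simps intro!: divide_strict_left_mono)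
  have "level u b < level u a" using level_le_iff[OF u, of a b] ab by auto
  moreover have "0 < level u b" using level_pos[OF u, of b] ab by auto
  ultimately have "1 / level u a < 1 / level u b" by (simp add: frac_less2)
  then show "h x s < h x t" by (simp add: h_def u_def[symmetric] a_def b_def)
next
  fix y :: 'h assume y: "y \<noteq> 0"
  define v where "v = (1 / norm y) *\<^sub>R y"
  have v: "norm v = 1" using y by (simp add: v_def)
  obtain x c where x: "norm x = 1" "cmod c = 1" "line x = c *\<^sub>C v" using line_onto[OF v] .
  have "\<sigma> x = (c * of_real (1 / norm y)) *\<^sub>C y"
    using x by (simp add: \<sigma>_def v_def scaleR_scaleC scaleC_scaleC)
  moreover have "c * of_real (1 / norm y) \<noteq> 0" "x \<noteq> 0" using x y by auto
  ultimately show "\<exists>x c. x \<noteq> 0 \<and> c \<noteq> 0 \<and> \<sigma> x = c *\<^sub>C y" by blast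
qed

end

section \<open>Functional calculus of the Moebius functions\<close>

lemma poly_op_upper:
  assumes "degree q \<le> n"
  shows "poly_op q A = (\<Sum>i\<le>n. coeff q i *\<^sub>R (((o\<^sub>L) A) ^^ i) id_blinfun)"
  unfolding poly_op_def
  by (rule sum.mono_neutral_left) (use assms in \<open>auto simp: coeff_eq_0\<close>)

lemma poly_op_add: "poly_op (p + q) A = poly_op p A + poly_op q A"
proof -
  let ?n = "max (degree p) (degree q)"
  have "degree (p + q) \<le> ?n" by (rule degree_add_le_max)
  then show ?thesis
    by (simp add: poly_op_upper[of _ ?n] scaleR_add_left sum.distrib)
qed

lemma poly_op_smult: "poly_op (smult c q) A = c *\<^sub>R poly_op q A"
  by (simp add: poly_op_upper[of _ "degree q"] scaleR_sum_right)

lemma poly_op_0 [simp]: "poly_op 0 A = 0"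
  by (simp add: poly_op_def)

lemma poly_op_pCons: "poly_op (pCons a q) A = a *\<^sub>R id_blinfun + (A o\<^sub>L poly_op q A)"
proof -
  have "poly_op (pCons a q) A = (\<Sum>i\<le>Suc (degree q). coeff (pCons a q) i *\<^sub>R (((o\<^sub>L) A) ^^ i) id_blinfun)"
    by (rule poly_op_upper) (simp add: degree_pCons_le)
  also have "\<dots> = a *\<^sub>R id_blinfun
      + (\<Sum>i\<le>degree q. A o\<^sub>L (coeff q i *\<^sub>R (((o\<^sub>L) A) ^^ i) id_blinfun))"
    by (subst sum.atMost_Suc_shift)
      (simp add: bounded_bilinear.scaleR_right[OF bounded_bilinear_blinfun_compose])
  finally show ?thesis
    by (simp add: poly_op_def bounded_bilinear.sum_right[OF bounded_bilinear_blinfun_compose])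
qed

lemma poly_op_mult_apply: "poly_op (p * q) A x = poly_op p A (poly_op q A x)"
  by (induction p arbitrary: x)
    (simp_all add: poly_op_pCons poly_op_add poly_op_smult blinfun.add_left blinfun.scaleR_left)

lemma poly_op_diff: "poly_op (p - q) A = poly_op p A - poly_op q A"
  using poly_op_add[of p "smult (-1) q" A] unfolding poly_op_smult by simp

lemma poly_op_commute: "A (poly_op q A x) = poly_op q A (A x)"
  by (induction q arbitrary: x)
    (simp_all add: poly_op_pCons blinfun.add_left blinfun.add_right blinfun.scaleR_left
      blinfun.scaleR_right)

lemma poly_op_selfadjoint:
  assumes A: "selfadjoint_op A" shows "selfadjoint_op (poly_op q A)"
proof (induction q)
  case 0
  then show ?case by (simp add: selfadjoint_zero)
next
  case (pCons a q)
  have "selfadjoint_op (A o\<^sub>L poly_op q A)"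
    unfolding selfadjoint_op_def clinear_op_def
    by (simp add: selfadjoint_scaleC[OF A] selfadjoint_scaleC[OF pCons.IH]
        selfadjoint_cinner[OF A] selfadjoint_cinner[OF pCons.IH] poly_op_commute)
  then show ?case unfolding poly_op_pCons by (intro selfadjoint_intros)
qed

lemma map_poly_of_real_mult:
  "map_poly complex_of_real (p * q) = map_poly of_real p * map_poly of_real q"
  by (rule poly_eqI) (simp add: coeff_map_poly coeff_mult)

lemma map_poly_of_real_add:
  "map_poly complex_of_real (p + q) = map_poly of_real p + map_poly of_real q"
  by (rule poly_eqI) (simp add: coeff_map_poly)

lemma poly_map_poly_of_real: "poly (map_poly complex_of_real p) (of_real t) = of_real (poly p t)"
  by (induction p) (simp_all add: map_poly_pCons)

text \<open>
  The fundamental theorem of algebra in real form; for a nonreal root \<open>a + b \<i>\<close> the remainder modulo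
  its real quadratic polynomial is linear and vanishes there, hence is zero.
\<close>

lemma real_poly_factor:
  fixes q :: "real poly"
  assumes "degree q > 0"
  shows "(\<exists>t r. q = [:- t, 1:] * r) \<or> (\<exists>a b r. b \<noteq> 0 \<and> q = [:a\<^sup>2 + b\<^sup>2, - 2 * a, 1:] * r)"
proof -
  let ?Q = "map_poly complex_of_real q"
  have "degree ?Q = degree q" by (rule degree_map_poly) simp
  then have "\<not> constant (poly ?Q)" using assms by (simp add: constant_degree)
  then obtain z where z: "poly ?Q z = 0" using fundamental_theorem_of_algebra by blast
  define a b where "a = Re z" and "b = Im z"
  have zab: "z = of_real a + of_real b * \<i>" by (simp add: a_def b_def complex_eq_iff)
  show ?thesis
  proof (cases "b = 0")
    case True
    then have "poly q a = 0" using z poly_map_poly_of_real[of q a] by (simp add: zab)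
    then show ?thesis by (auto simp: poly_eq_0_iff_dvd dvd_def)
  next
    case False
    let ?d = "[:a\<^sup>2 + b\<^sup>2, - 2 * a, 1:]"
    define r where "r = q mod ?d"
    have d: "?d \<noteq> 0" by simp
    have q: "q = ?d * (q div ?d) + r" unfolding r_def by (rule mult_div_mod_eq[symmetric])
    have "poly (map_poly complex_of_real ?d) z = 0"
      by (simp add: map_poly_pCons zab algebra_simps power2_eq_square)
    then have rz: "poly (map_poly complex_of_real r) z = 0"
      using z by (subst (asm) q) (simp only: map_poly_of_real_add map_poly_of_real_mult poly_add
          poly_mult mult_zero_left add_0_left)
    have "degree r < 2" using degree_mod_less[OF d, of q] by (auto simp: r_def)
    then obtain c e where r: "r = [:c, e:]"
      by (metis degree_pCons_eq_if less_2_cases less_Suc_eq_0_disj numeral_2_eq_2 pCons_cases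
          degree_eq_zeroE nat.simps(3) old.nat.inject one_is_add pCons_0_0 One_nat_def)
    have "of_real c + z * of_real e = 0" using rz by (simp add: r map_poly_pCons)
    then have "c = 0 \<and> e = 0" using False by (auto simp: zab complex_eq_iff)
    then have "r = 0" by (simp add: r)
    then show ?thesis using q False by (metis add.right_neutral)
  qed
qed

lemma bounded_below_off_spectrum:
  fixes A :: "'h::complex_hilbert \<Rightarrow>\<^sub>L 'h"
  assumes "of_real t \<notin> spectrum_op A"
  obtains e where "e > 0" "\<And>x. e * norm x \<le> norm (A x - t *\<^sub>R x)"
proof -
  obtain B :: "'h \<Rightarrow>\<^sub>L 'h" where B: "\<And>x. B (A x - t *\<^sub>R x) = x"
    using assms by (auto simp: spectrum_op_def scaleC_of_real)
  define e where "e = 1 / (norm B + 1)"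
  have B1: "norm B + 1 > 0" by (simp add: add_nonneg_pos)
  have "e * norm x \<le> norm (A x - t *\<^sub>R x)" for x
  proof -
    have "norm x \<le> norm B * norm (A x - t *\<^sub>R x)"
      using norm_blinfun[of B "A x - t *\<^sub>R x"] by (simp add: B)
    also have "\<dots> \<le> (norm B + 1) * norm (A x - t *\<^sub>R x)" by (intro mult_right_mono) auto
    finally show ?thesis using B1 by (simp add: e_def field_simps)
  qed
  moreover have "e > 0" using B1 by (simp add: e_def)
  ultimately show ?thesis using that by blast
qed

text \<open>
  The spectral mapping theorem, in the form that is needed here: without roots in the spectrum, every
  real linear factor of \<open>q\<close> gives an invertible operator, and a quadratic factor with roots \<open>a \<plusminus> b \<i>\<close>
  gives \<open>(A - a)\<^sup>2 + b\<^sup>2 \<ge> b\<^sup>2\<close>.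
\<close>

lemma poly_op_bounded_below:
  fixes A :: "'h::complex_hilbert \<Rightarrow>\<^sub>L 'h"
  assumes A: "selfadjoint_op A"
  shows "q \<noteq> 0 \<Longrightarrow> (\<And>t. of_real t \<in> spectrum_op A \<Longrightarrow> poly q t \<noteq> 0) \<Longrightarrow>
    \<exists>e>0. \<forall>x. e * norm x \<le> norm (poly_op q A x)"
proof (induction "degree q" arbitrary: q rule: less_induct)
  case less
  have step: ?case
    if q: "q = d * r" and dr: "degree d > 0" and e: "e > 0" "\<And>x. e * norm x \<le> norm (poly_op d A x)"
    for d r e
  proof -
    have r: "r \<noteq> 0" "d \<noteq> 0" using q less.prems(1) by auto
    have "degree r < degree q" using dr r by (simp add: q degree_mult_eq)
    then obtain e' where e': "e' > 0" "\<And>x. e' * norm x \<le> norm (poly_op r A x)"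
      using less.hyps[of r] r less.prems(2) by (auto simp: q)
    have "e * e' * norm x \<le> norm (poly_op q A x)" for x
    proof -
      have "e * (e' * norm x) \<le> e * norm (poly_op r A x)" using e(1) e'(2) by (intro mult_left_mono) auto
      also have "\<dots> \<le> norm (poly_op q A x)" unfolding q poly_op_mult_apply by (rule e(2))
      finally show ?thesis by (simp add: mult.assoc)
    qed
    then show ?thesis using e(1) e'(1) by (intro exI[of _ "e * e'"]) auto
  qed
  show ?case
  proof (cases "degree q = 0")
    case True
    then obtain c where "q = [:c:]" by (metis degree_eq_zeroE)
    then show ?thesis using less.prems(1)
      by (intro exI[of _ "\<bar>c\<bar>"]) (auto simp: poly_op_pCons blinfun.add_left blinfun.scaleR_left)
  next
    case False
    then consider t r where "q = [:- t, 1:] * r"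
      | a b r where "b \<noteq> 0" "q = [:a\<^sup>2 + b\<^sup>2, - 2 * a, 1:] * r"
      using real_poly_factor[of q] by blast
    then show ?thesis
    proof cases
      case 1
      have "poly q t = 0" by (simp add: 1)
      then have "of_real t \<notin> spectrum_op A" using less.prems(2) by blast
      from bounded_below_off_spectrum[OF this] obtain e where
        "e > 0" "\<And>x. e * norm x \<le> norm (A x - t *\<^sub>R x)" by blast
      then show ?thesis
        by (intro step[OF 1, of e])
          (simp_all add: poly_op_pCons blinfun.add_left blinfun.diff_left blinfun.scaleR_left)
    next
      case 2
      let ?d = "[:a\<^sup>2 + b\<^sup>2, - 2 * a, 1:]"
      have "b\<^sup>2 * norm x \<le> norm (poly_op ?d A x)" for x
      proof (rule form_bound_below)
        have d: "poly_op ?d A x = (a\<^sup>2 + b\<^sup>2) *\<^sub>R x - (2 * a) *\<^sub>R A x + A (A x)"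
          by (simp add: poly_op_pCons blinfun.add_left blinfun.diff_left blinfun.scaleR_left
              blinfun.diff_right blinfun.add_right blinfun.scaleR_right)
        have "poly_op ?d A x \<bullet> x = b\<^sup>2 * (x \<bullet> x) + (A x - a *\<^sub>R x) \<bullet> (A x - a *\<^sub>R x)"
          unfolding d using selfadjoint_inner[OF A, of "A x" x]
          by (simp add: inner_simps inner_commute algebra_simps power2_eq_square)
        then show "b\<^sup>2 * (x \<bullet> x) \<le> poly_op ?d A x \<bullet> x" by simp
      qed
      then show ?thesis using 2(1) by (intro step[OF 2(2), of "b\<^sup>2"]) simp_all
    qed
  qed
qed

text \<open>
  The square of the norm is an approximate eigenvalue of the square of a selfadjoint operator: if \<open>\<parallel>T x\<parallel>\<close>
  is close to \<open>\<parallel>T\<parallel> \<parallel>x\<parallel>\<close>, then \<open>\<parallel>T\<parallel>\<^sup>2 x - T (T x)\<close> is small.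
\<close>

lemma norm_square_minus_square_not_bounded_below:
  fixes T :: "'h::complex_hilbert \<Rightarrow>\<^sub>L 'h"
  assumes T: "selfadjoint_op T" and z: "z \<noteq> (0::'h)"
    and e: "e > 0" "\<And>x. e * norm x \<le> norm ((norm T)\<^sup>2 *\<^sub>R x - T (T x))"
  shows False
proof -
  define M where "M = norm T"
  have "M \<noteq> 0"
  proof
    assume "M = 0"
    then have "T = 0" by (simp add: M_def)
    then have "e * norm z \<le> 0" using e(2)[of z] by simp
    then show False using e(1) z by (simp add: mult_le_0_iff)
  qed
  then have M: "M > 0" by (simp add: M_def)
  have low: "(norm (T x))\<^sup>2 \<le> (M\<^sup>2 - e\<^sup>2 / M\<^sup>2) * (norm x)\<^sup>2" for x
  proof -
    have "(e * norm x)\<^sup>2 \<le> (norm (M\<^sup>2 *\<^sub>R x - T (T x)))\<^sup>2"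
      using e by (intro power_mono) (auto simp: M_def)
    also have "\<dots> = M^4 * (norm x)\<^sup>2 - 2 * M\<^sup>2 * (norm (T x))\<^sup>2 + (norm (T (T x)))\<^sup>2"
      unfolding power2_norm_eq_inner using selfadjoint_inner[OF T, of "T x" x]
      by (simp add: inner_simps inner_commute algebra_simps power4_eq_xxxx power2_eq_square)
    also have "\<dots> \<le> M^4 * (norm x)\<^sup>2 - 2 * M\<^sup>2 * (norm (T x))\<^sup>2 + (M * norm (T x))\<^sup>2"
      unfolding M_def by (intro add_left_mono power_mono norm_blinfun) simp
    finally have "e\<^sup>2 * (norm x)\<^sup>2 \<le> M^4 * (norm x)\<^sup>2 - M\<^sup>2 * (norm (T x))\<^sup>2"
      by (simp add: power_mult_distrib)
    then show ?thesis using M by (simp add: field_simps power4_eq_xxxx power2_eq_square)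
  qed
  let ?c = "M\<^sup>2 - e\<^sup>2 / M\<^sup>2"
  have c: "0 \<le> ?c" using low[of z] z
    by (metis norm_eq_zero order_trans zero_le_mult_iff zero_le_power2 zero_less_power2 linorder_not_le)
  have "norm (T x) \<le> sqrt ?c * norm x" for x
    using real_sqrt_le_mono[OF low[of x]] by (simp add: real_sqrt_mult)
  then have "norm T \<le> sqrt ?c" by (intro norm_blinfun_bound) (use c in auto)
  also have "\<dots> < sqrt (M\<^sup>2)" using e(1) M by (intro real_sqrt_less_mono) simp
  finally show False using M by (simp add: M_def)
qed

lemma real_spectrum_meets_roots:
  fixes A :: "'h::complex_hilbert \<Rightarrow>\<^sub>L 'h"
  assumes A: "selfadjoint_op A" and z: "z \<noteq> (0::'h)"
  obtains t where "of_real t \<in> spectrum_op A" "(poly r t)\<^sup>2 = (norm (poly_op r A))\<^sup>2"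
proof -
  have root: "\<exists>t. of_real t \<in> spectrum_op A \<and> (poly r t)\<^sup>2 = (norm (poly_op r A))\<^sup>2"
    if nz: "[:(norm (poly_op r A))\<^sup>2:] - r * r \<noteq> 0" for r
  proof (rule ccontr)
    let ?q = "[:(norm (poly_op r A))\<^sup>2:] - r * r"
    assume "\<not> ?thesis"
    then have "\<exists>e>0. \<forall>x. e * norm x \<le> norm (poly_op ?q A x)"
      by (intro poly_op_bounded_below[OF A nz]) (auto simp: power2_eq_square)
    moreover have "poly_op ?q A x = (norm (poly_op r A))\<^sup>2 *\<^sub>R x - poly_op r A (poly_op r A x)" for x
      by (simp add: poly_op_diff poly_op_pCons blinfun.diff_left blinfun.add_left blinfun.scaleR_left
          poly_op_mult_apply)
    ultimately show False
      using norm_square_minus_square_not_bounded_below[OF poly_op_selfadjoint[OF A] z] by auto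
  qed
  show ?thesis
  proof (cases "[:(norm (poly_op r A))\<^sup>2:] - r * r = 0")
    case False
    then show ?thesis using root that by blast
  next
    case True
    \<comment> \<open>Then \<open>r\<close> is constant and any point of the spectrum will do.\<close>
    have "coeff ([:(norm (poly_op [:0, 1:] A))\<^sup>2:] - [:0, 1:] * [:0, 1:]) 2 = -1"
      by (simp add: numeral_2_eq_2)
    then have "[:(norm (poly_op [:0, 1:] A))\<^sup>2:] - [:0, 1:] * [:0, 1:] \<noteq> 0"
      by (metis coeff_0 zero_neq_neg_one)
    from root[OF this] obtain t where t: "of_real t \<in> spectrum_op A" by blast
    have "poly ([:(norm (poly_op r A))\<^sup>2:] - r * r) t = 0" by (simp only: True poly_0)
    then have "(poly r t)\<^sup>2 = (norm (poly_op r A))\<^sup>2" by (simp add: power2_eq_square)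
    then show ?thesis using that t by blast
  qed
qed

text \<open>
  On a nonzero space the norm of \<open>r(A)\<close> is attained by \<open>\<bar>r\<bar>\<close> on the spectrum. This is what
  makes the functional calculus continuous in \<open>r\<close>.
\<close>

lemma norm_poly_op_le:
  assumes A: "selfadjoint_op A" and d: "0 \<le> d"
    and r: "\<And>t. of_real t \<in> spectrum_op A \<Longrightarrow> \<bar>poly r t\<bar> \<le> d"
  shows "norm (poly_op r A) \<le> d"
proof (cases "\<exists>z :: 'a. z \<noteq> 0")
  case True
  then obtain t where t: "of_real t \<in> spectrum_op A" "(poly r t)\<^sup>2 = (norm (poly_op r A))\<^sup>2"
    using real_spectrum_meets_roots[OF A] by metis
  then have "norm (poly_op r A) = \<bar>poly r t\<bar>"
    by (metis abs_norm_cancel power2_eq_iff_nonneg abs_ge_zero norm_ge_zero power2_abs)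
  then show ?thesis using r[OF t(1)] by simp
next
  case False
  have "poly_op r A = 0" by (rule blinfun_eqI) (use False in auto)
  then show ?thesis using d by simp
qed

lemma not_in_spectrum_if_coercive:
  assumes s: "s \<noteq> 0" and co: "coercive_op (s *\<^sub>R (A - t *\<^sub>R id_blinfun))"
  shows "of_real t \<notin> spectrum_op A"
proof -
  let ?D = "s *\<^sub>R (A - t *\<^sub>R id_blinfun)"
  let ?B = "s *\<^sub>R op_inv ?D"
  have D: "?D x = s *\<^sub>R (A x - t *\<^sub>R x)" for x
    by (simp add: blinfun.scaleR_left blinfun.diff_left)
  have "clinear_op ?B"
    using op_inv_coercive[OF co] by (intro selfadjoint_clinear selfadjoint_scaleR coercive_selfadjoint)
  moreover have "?B (A x - of_real t *\<^sub>C x) = x" for x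
    using op_inv_left[OF co, of x] unfolding D
    by (simp add: blinfun.scaleR_left blinfun.scaleR_right scaleC_of_real)
  moreover have "A (?B x) - of_real t *\<^sub>C ?B x = x" for x
    using op_inv_right[OF co, of x] unfolding D
    by (simp add: blinfun.scaleR_left blinfun.scaleR_right scaleC_of_real scaleR_diff_right mult.commute)
  ultimately show ?thesis by (auto simp: spectrum_op_def)
qed

lemma effect_spectrum: 
  assumes A: "A \<in> effects" and t: "of_real t \<in> spectrum_op A" shows "0 \<le> t \<and> t \<le> 1"
proof (rule ccontr)
  have sa: "selfadjoint_op (s *\<^sub>R (A - t *\<^sub>R id_blinfun))" for s
    by (intro selfadjoint_intros effect_selfadjoint[OF A])
  have form: "(s *\<^sub>R (A - t *\<^sub>R id_blinfun)) x \<bullet> x = s * (A x \<bullet> x - t * (x \<bullet> x))" for s x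
    by (simp add: blinfun.scaleR_left blinfun.diff_left inner_diff_left)
  assume "\<not> (0 \<le> t \<and> t \<le> 1)"
  then consider "t < 0" | "t > 1" by linarith
  then show False
  proof cases
    case 1
    have "coercive_op (1 *\<^sub>R (A - t *\<^sub>R id_blinfun))"
      unfolding coercive_op_def form using A 1
      by (intro conjI sa exI[of _ "- t"]) (auto simp: effects_iff)
    then show False using not_in_spectrum_if_coercive[of 1] t by auto
  next
    case 2
    have "coercive_op ((-1) *\<^sub>R (A - t *\<^sub>R id_blinfun))"
      unfolding coercive_op_def form using A 2
      by (intro conjI sa exI[of _ "t - 1"]) (auto simp: effects_iff algebra_simps)
    then show False using not_in_spectrum_if_coercive[of "-1"] t by auto
  qed
qed

definition fp_denominator :: "real \<Rightarrow> ('h::complex_hilbert \<Rightarrow>\<^sub>L 'h) \<Rightarrow> 'h \<Rightarrow>\<^sub>L 'h" where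
  "fp_denominator p A = p *\<^sub>R A + (1 - p) *\<^sub>R id_blinfun"

definition fp_op :: "real \<Rightarrow> ('h::complex_hilbert \<Rightarrow>\<^sub>L 'h) \<Rightarrow> 'h \<Rightarrow>\<^sub>L 'h" where
  "fp_op p A = A o\<^sub>L op_inv (fp_denominator p A)"

lemma fp_scalar_denominator_pos: "0 \<le> t \<Longrightarrow> t \<le> 1 \<Longrightarrow> p < 1 \<Longrightarrow> 0 < t * p + (1 - p)" for t p :: real
proof -
  assume t: "0 \<le> t" "t \<le> 1" and p: "p < 1"
  have "t * p + (1 - p) = t + (1 - t) * (1 - p)" by (simp add: algebra_simps)
  moreover have "0 \<le> (1 - t) * (1 - p)" using t p by simp
  moreover have "t = 0 \<Longrightarrow> 0 < (1 - t) * (1 - p)" using p by simp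
  ultimately show ?thesis using t by (cases "t = 0") auto
qed

lemma fp_denominator_coercive:
  assumes A: "A \<in> effects" and p: "p < 1" shows "coercive_op (fp_denominator p A)"
proof -
  have "min 1 (1 - p) * (x \<bullet> x) \<le> fp_denominator p A x \<bullet> x" for x
  proof -
    have f: "fp_denominator p A x \<bullet> x = p * (A x \<bullet> x) + (1 - p) * (x \<bullet> x)"
      by (simp add: fp_denominator_def blinfun.add_left blinfun.scaleR_left inner_add_left)
    have A': "0 \<le> A x \<bullet> x" "A x \<bullet> x \<le> x \<bullet> x" using A by (auto simp: effects_iff)
    show ?thesis
    proof (cases "p \<ge> 0")
      case True
      then show ?thesis using A' by (simp add: f)
    next
      case False
      then have "p * (x \<bullet> x) \<le> p * (A x \<bullet> x)" using A' by (intro mult_left_mono_neg) auto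
      then show ?thesis using False by (simp add: f algebra_simps)
    qed
  qed
  moreover have "selfadjoint_op (fp_denominator p A)"
    unfolding fp_denominator_def by (intro selfadjoint_intros effect_selfadjoint[OF A])
  moreover have "0 < min 1 (1 - p)" using p by simp
  ultimately show ?thesis unfolding coercive_op_def by blast
qed

lemma Weierstrass_poly:
  assumes "continuous_on {0..1::real} f" "0 < e"
  obtains q where "\<And>x. x \<in> {0..1} \<Longrightarrow> \<bar>f x - poly q x\<bar> < e"
proof -
  obtain g where g: "real_polynomial_function g" "\<And>x. x \<in> {0..1} \<Longrightarrow> \<bar>f x - g x\<bar> < e"
    using Stone_Weierstrass_real_polynomial_function[OF _ assms] by auto
  then obtain a n where an: "g = (\<lambda>x. \<Sum>i\<le>n. a i * x ^ i)"
    using real_polynomial_function_imp_sum by blast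
  have "g x = poly (\<Sum>i\<le>n. monom (a i) i) x" for x
    by (simp add: an poly_sum poly_monom)
  then show ?thesis using that g(2) by metis
qed

text \<open>
  If \<open>q\<^sub>n\<close> tends to \<open>f\<^sub>p\<close> uniformly on the spectrum, then \<open>q\<^sub>n(x) (p x + 1 - p) - x\<close> tends to \<open>0\<close> there, so
  \<open>q\<^sub>n(A) K - A\<close> tends to \<open>0\<close> in norm, where \<open>K = p A + (1 - p) I\<close>; multiply by \<open>K\<^sup>-\<^sup>1\<close>. That the value is
  unique requires one such sequence, which Weierstrass provides since the spectrum lies in \<open>[0, 1]\<close>.
\<close>

theorem cfc_fp:
  assumes A: "A \<in> effects" and p: "p < 1"
  shows "cfc (fp_fun p) A = fp_op p A"
proof -
  let ?S = "{t. complex_of_real t \<in> spectrum_op A}"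
  let ?K = "fp_denominator p A" and ?f = "fp_fun p"
  let ?F = "A o\<^sub>L op_inv ?K"
  note K = fp_denominator_coercive[OF A p]
  have S: "0 \<le> t" "t \<le> 1" if "t \<in> ?S" for t using effect_spectrum[OF A] that by auto
  have conv: "(\<lambda>n. poly_op (q n) A) \<longlonglongrightarrow> ?F"
    if q: "uniform_limit ?S (\<lambda>n. poly (q n)) ?f sequentially" for q
  proof -
    define C where "C = \<bar>p\<bar> + \<bar>1 - p\<bar> + 1"
    define N where "N = norm (op_inv ?K) + 1"
    have C: "C > 0" and N: "N > 0" by (simp_all add: C_def N_def add_nonneg_pos)
    have est: "norm (poly_op (q n) A - ?F) \<le> d * C * N"
      if d: "0 \<le> d" and qn: "\<And>t. t \<in> ?S \<Longrightarrow> \<bar>poly (q n) t - ?f t\<bar> \<le> d" for n d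
    proof -
      define r where "r = q n * [:1 - p, p:] - [:0, 1:]"
      have "norm (poly_op r A) \<le> d * C"
      proof (rule norm_poly_op_le[OF effect_selfadjoint[OF A]])
        show "0 \<le> d * C" using d C by simp
        fix t assume "of_real t \<in> spectrum_op A"
        then have t: "t \<in> ?S" by simp
        have "poly r t = (poly (q n) t - ?f t) * (t * p + (1 - p))"
        proof -
          have "?f t * (t * p + (1 - p)) = t"
            using fp_scalar_denominator_pos[OF S(1,2)[OF t] p] by (simp add: fp_fun_def)
          then show ?thesis by (simp add: r_def left_diff_distrib) (simp add: algebra_simps)
        qed
        moreover have "\<bar>t * p + (1 - p)\<bar> \<le> C"
        proof -
          have "\<bar>t * p\<bar> \<le> \<bar>p\<bar>" using S[OF t] by (simp add: abs_mult mult_left_le_one_le)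
          then show ?thesis unfolding C_def by linarith
        qed
        ultimately show "\<bar>poly r t\<bar> \<le> d * C"
          using qn[OF t] d unfolding abs_mult by (simp add: abs_mult mult_mono)
      qed
      moreover have "poly_op (q n) A - ?F = poly_op r A o\<^sub>L op_inv ?K"
      proof (rule blinfun_eqI)
        fix x
        define y where "y = op_inv ?K x"
        have x: "x = ?K y" by (simp add: y_def K)
        have "poly_op r A y = poly_op (q n) A (?K y) - A y"
          unfolding r_def poly_op_diff poly_op_mult_apply blinfun.diff_left
          by (simp add: poly_op_pCons blinfun.diff_left
              blinfun.add_left blinfun.scaleR_left blinfun.add_right blinfun.scaleR_right
              fp_denominator_def)
        then show "(poly_op (q n) A - ?F) x = (poly_op r A o\<^sub>L op_inv ?K) x"
          by (simp add: blinfun.diff_left y_def K)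
      qed
      ultimately have "norm (poly_op (q n) A - ?F) \<le> d * C * norm (op_inv ?K)"
        using norm_blinfun_compose[of "poly_op r A" "op_inv ?K"]
          mult_right_mono[of "norm (poly_op r A)" "d * C" "norm (op_inv ?K)"] by simp
      also have "\<dots> \<le> d * C * N" using d C by (intro mult_left_mono) (auto simp: N_def)
      finally show ?thesis .
    qed
    show ?thesis
    proof (rule metric_LIMSEQ_I)
      fix e :: real assume e: "e > 0"
      define d where "d = e / (2 * C * N)"
      have d: "d > 0" using e C N by (simp add: d_def)
      have "\<forall>\<^sub>F n in sequentially. \<forall>t\<in>?S. dist (poly (q n) t) (?f t) < d"
        using uniform_limitD[OF q d] .
      then obtain n0 where n0: "\<And>n t. n \<ge> n0 \<Longrightarrow> t \<in> ?S \<Longrightarrow> dist (poly (q n) t) (?f t) < d"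
        unfolding eventually_sequentially by blast
      have "dist (poly_op (q n) A) ?F < e" if "n \<ge> n0" for n
      proof -
        have "norm (poly_op (q n) A - ?F) \<le> d * C * N"
          using n0[OF that] d by (intro est) (auto simp: dist_real_def less_imp_le)
        also have "\<dots> < e" using C N e by (simp add: d_def)
        finally show ?thesis by (simp add: dist_norm)
      qed
      then show "\<exists>n0. \<forall>n\<ge>n0. dist (poly_op (q n) A) ?F < e" by blast
    qed
  qed
  have "\<exists>q. uniform_limit ?S (\<lambda>n. poly (q n)) ?f sequentially"
  proof -
    have cont: "continuous_on {0..1} ?f"
      unfolding fp_fun_def using fp_scalar_denominator_pos[OF _ _ p]
      by (intro continuous_intros) (metis atLeastAtMost_iff less_irrefl)
    have "\<exists>q. \<forall>x\<in>{0..1}. \<bar>?f x - poly q x\<bar> < inverse (real (Suc n))" for n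
      using Weierstrass_poly[OF cont, of "inverse (real (Suc n))"] by (metis inverse_positive_iff_positive of_nat_0_less_iff zero_less_Suc)
    then obtain q where q: "\<And>n x. x \<in> {0..1} \<Longrightarrow> \<bar>?f x - poly (q n) x\<bar> < inverse (real (Suc n))"
      by metis
    have "uniform_limit ?S (\<lambda>n. poly (q n)) ?f sequentially"
    proof (rule uniform_limitI)
      fix e :: real assume "e > 0"
      then obtain n0 where n0: "inverse (real (Suc n0)) < e" using reals_Archimedean by blast
      have "dist (poly (q n) t) (?f t) < e" if n: "n \<ge> n0" and t: "t \<in> ?S" for n t
      proof -
        have "\<bar>?f t - poly (q n) t\<bar> < inverse (real (Suc n))" using q S[OF t] by simp
        also have "\<dots> \<le> inverse (real (Suc n0))" using n by simp
        finally show ?thesis using n0 by (simp add: dist_real_def abs_minus_commute)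
      qed
      then show "\<forall>\<^sub>F n in sequentially. \<forall>t\<in>?S. dist (poly (q n) t) (?f t) < e"
        unfolding eventually_sequentially by blast
    qed
    then show ?thesis by blast
  qed
  then obtain q0 where q0: "uniform_limit ?S (\<lambda>n. poly (q0 n)) ?f sequentially" by blast
  show ?thesis
    unfolding cfc_def fp_op_def
  proof (rule the_equality)
    show "\<forall>q. uniform_limit ?S (\<lambda>n. poly (q n)) ?f sequentially \<longrightarrow> (\<lambda>n. poly_op (q n) A) \<longlonglongrightarrow> ?F"
      using conv by blast
    fix B assume "\<forall>q. uniform_limit ?S (\<lambda>n. poly (q n)) ?f sequentially \<longrightarrow> (\<lambda>n. poly_op (q n) A) \<longlonglongrightarrow> B"
    then show "B = ?F" using q0 conv[OF q0] LIMSEQ_unique by blast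
  qed
qed

section \<open>Unitary and antiunitary operators\<close>

lemma selfadjointI_real:
  assumes cl: "clinear_op A" and sy: "\<And>x y. A x \<bullet> y = x \<bullet> A y" shows "selfadjoint_op A"
proof -
  have "cinner (A x) y = cinner x (A y)" for x y
    by (rule complex_eqI) (simp_all add: Re_cinner Im_cinner sy clinear_op_scaleC[OF cl, symmetric])
  then show ?thesis using cl by (simp add: selfadjoint_op_def)
qed

lemma isometry_inner:
  fixes U :: "'h::complex_hilbert \<Rightarrow>\<^sub>L 'h"
  assumes "\<And>x. norm (U x) = norm x" shows "U x \<bullet> U y = x \<bullet> y"
proof -
  have "U (x + y) \<bullet> U (x + y) = (x + y) \<bullet> (x + y)" "U x \<bullet> U x = x \<bullet> x" "U y \<bullet> U y = y \<bullet> y"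
    using assms by (simp_all flip: power2_norm_eq_inner)
  then show ?thesis by (simp add: blinfun.add_right inner_simps inner_commute)
qed

lemma isometry_unitary_or_antiunitary:
  assumes lin: "clinear_op U \<or> antilinear_op U" and iso: "\<And>x. norm (U x) = norm x"
    and onto: "surj (blinfun_apply U)"
  shows "unitary_op U \<or> antiunitary_op U"
  using lin
proof
  assume cl: "clinear_op U"
  have "cinner (U x) (U y) = cinner x y" for x y
    using isometry_inner[OF iso, of x y] isometry_inner[OF iso, of x "\<i> *\<^sub>C y"]
    by (intro complex_eqI) (simp_all add: Re_cinner Im_cinner clinear_op_scaleC[OF cl])
  then show ?thesis using cl onto by (simp add: unitary_op_def)
next
  assume al: "antilinear_op U"
  then have "U (\<i> *\<^sub>C y) = - (\<i> *\<^sub>C U y)" for y by (simp add: antilinear_op_def)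
  then have "cinner (U x) (U y) = cnj (cinner x y)" for x y
    using isometry_inner[OF iso, of x y] isometry_inner[OF iso, of x "\<i> *\<^sub>C y"]
    by (intro complex_eqI) (simp_all add: Re_cinner Im_cinner)
  then show ?thesis using al onto by (simp add: antiunitary_op_def)
qed

text \<open>
  Both for unitary and for antiunitary \<open>U\<close> the inverse satisfies the equation that defines the adjoint.
  The nonzero vector \<open>z\<close> guarantees that \<open>U\<close> is not complex-linear and antilinear at the same time, so
  that the definition chooses the right one of the two equations.
\<close>

lemma adj_op_inverse:
  fixes U :: "'h::complex_hilbert \<Rightarrow>\<^sub>L 'h"
  assumes U: "unitary_op U \<or> antiunitary_op U" and nt: "z \<noteq> (0::'h)"
  shows "U (adj_op U y) = y" "adj_op U (U x) = x"
proof -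
  have onto: "surj (blinfun_apply U)" using U by (auto simp: unitary_op_def antiunitary_op_def)
  have iso: "norm (U x) = norm x" for x
  proof -
    have "cinner (U x) (U x) = cinner x x \<or> cinner (U x) (U x) = cnj (cinner x x)"
      using U by (auto simp: unitary_op_def antiunitary_op_def)
    then show ?thesis by (auto simp: cinner_self simp flip: of_real_power)
  qed
  let ?I = "inv (blinfun_apply U)"
  have UI [simp]: "U (?I y) = y" for y using onto by (simp add: surj_f_inv_f)
  have inj: "U x = U y \<Longrightarrow> x = y" for x y
    using iso[of "x - y"] by (simp add: blinfun.diff_right)
  then have IU [simp]: "?I (U x) = x" for x by (metis UI)
  have "bounded_linear ?I"
  proof (rule bounded_linear_intro[of _ 1])
    show "?I (x + y) = ?I x + ?I y" for x y by (rule inj) (simp add: blinfun.add_right)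
    show "?I (r *\<^sub>R x) = r *\<^sub>R ?I x" for r x by (rule inj) (simp add: blinfun.scaleR_right)
    show "norm (?I x) \<le> norm x * 1" for x using iso[of "?I x"] by simp
  qed
  then have V: "Blinfun ?I y = ?I y" for y by (simp add: bounded_linear_Blinfun_apply)
  have ad: "cinner (U x) y = (if antilinear_op U then cnj (cinner x (?I y)) else cinner x (?I y))"
    for x y
  proof (cases "antilinear_op U")
    case True
    have "antiunitary_op U"
    proof (rule ccontr)
      assume "\<not> antiunitary_op U"
      then have "clinear_op U" using U by (simp add: unitary_op_def)
      then have "\<i> *\<^sub>C U z = cnj \<i> *\<^sub>C U z" using True by (metis antilinear_op_def clinear_op_def)
      then have "(2 * \<i>) *\<^sub>C U z = 0" by (simp add: scaleC_add_left[symmetric] eq_neg_iff_add_eq_0)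
      then have "U z = 0" by simp
      then show False using iso[of z] nt by simp
    qed
    then have "cinner (U x) (U (?I y)) = cnj (cinner x (?I y))" unfolding antiunitary_op_def by blast
    then show ?thesis using True by simp
  next
    case False
    then have "unitary_op U" using U by (auto simp: antiunitary_op_def)
    then have "cinner (U x) (U (?I y)) = cinner x (?I y)" unfolding unitary_op_def by blast
    then show ?thesis using False by simp
  qed
  have "adj_op U = Blinfun ?I"
    unfolding adj_op_def
  proof (rule the_equality)
    show "\<forall>x y. cinner (U x) y = (if antilinear_op U then cnj (cinner x (Blinfun ?I y))
      else cinner x (Blinfun ?I y))" using ad by (simp add: V)
    fix W :: "'h \<Rightarrow>\<^sub>L 'h" assume W: "\<forall>x y. cinner (U x) y = (if antilinear_op U
      then cnj (cinner x (W y)) else cinner x (W y))"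
    have "cinner x (W y) = cinner x (?I y)" for x y
      using W[rule_format, of x y] ad[of x y] by (simp split: if_splits)
    then have W': "cinner (W y) x = cinner (?I y) x" for x y by (metis cinner_commute)
    have "W y = Blinfun ?I y" for y by (rule cinner_ext) (simp only: V W')
    then show "W = Blinfun ?I" by (rule blinfun_eqI)
  qed
  then show "U (adj_op U y) = y" "adj_op U (U x) = x" by (simp_all add: V)
qed

section \<open>Limits of effects\<close>

lemma effect_pointwise_limit:
  fixes T :: "'h::complex_hilbert \<Rightarrow>\<^sub>L 'h"
  assumes E: "\<And>n. E n \<in> effects" and lim: "\<And>x. (\<lambda>n. E n x) \<longlonglongrightarrow> T x"
  shows "T \<in> effects"
proof -
  have inn: "(\<lambda>n. E n x \<bullet> y) \<longlonglongrightarrow> T x \<bullet> y" for x y by (intro tendsto_inner lim tendsto_const)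
  have "T (c *\<^sub>C x) = c *\<^sub>C T x" for c x
  proof -
    have "bounded_linear (\<lambda>v :: 'h. c *\<^sub>C v)"
      by (rule bounded_linear_intro[of _ "cmod c"])
        (simp_all add: scaleC_add_right scaleR_scaleC scaleC_scaleC norm_scaleC mult.commute)
    then have "(\<lambda>n. c *\<^sub>C E n x) \<longlonglongrightarrow> c *\<^sub>C T x" using lim by (rule bounded_linear.tendsto)
    moreover have "(\<lambda>n. c *\<^sub>C E n x) \<longlonglongrightarrow> T (c *\<^sub>C x)"
      using lim[of "c *\<^sub>C x"] by (simp add: selfadjoint_scaleC[OF effect_selfadjoint[OF E]])
    ultimately show ?thesis using LIMSEQ_unique by blast
  qed
  then have "clinear_op T" by (simp add: clinear_op_def)
  moreover have "T x \<bullet> y = x \<bullet> T y" for x y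
  proof -
    have "(\<lambda>n. E n x \<bullet> y) \<longlonglongrightarrow> x \<bullet> T y"
      unfolding selfadjoint_inner[OF effect_selfadjoint[OF E]]
      by (intro tendsto_inner lim tendsto_const)
    then show ?thesis using inn[of x y] LIMSEQ_unique by blast
  qed
  ultimately have "selfadjoint_op T" by (rule selfadjointI_real)
  moreover have "0 \<le> T x \<bullet> x" for x
    using inn[of x x] by (rule LIMSEQ_le_const) (use E in \<open>auto simp: effects_iff\<close>)
  moreover have "T x \<bullet> x \<le> x \<bullet> x" for x
    using inn[of x x] by (rule LIMSEQ_le_const2) (use E in \<open>auto simp: effects_iff\<close>)
  ultimately show ?thesis by (simp add: effects_iff)
qed

text \<open>
  Every effect is the infimum of a decreasing sequence of coercive effects. This carries
  the description of an automorphism over from coercive effects to all effects.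
\<close>

definition coercive_approx :: "('h::complex_hilbert \<Rightarrow>\<^sub>L 'h) \<Rightarrow> nat \<Rightarrow> 'h \<Rightarrow>\<^sub>L 'h" where
  "coercive_approx A n = A + inverse (real (Suc n)) *\<^sub>R (id_blinfun - A)"

lemma coercive_approx_apply: "coercive_approx A n x = A x + inverse (real (Suc n)) *\<^sub>R (x - A x)"
  by (simp add: coercive_approx_def blinfun.add_left blinfun.scaleR_left blinfun.diff_left)

lemma coercive_approx_form:
  "coercive_approx A n x \<bullet> x = A x \<bullet> x + inverse (real (Suc n)) * (x \<bullet> x - A x \<bullet> x)"
  by (simp add: coercive_approx_apply inner_simps)

lemma inverse_Suc_le_1: "inverse (real (Suc n)) \<le> 1"
  by (simp add: inverse_le_1_iff)

lemma coercive_approx_selfadjoint: "A \<in> effects \<Longrightarrow> selfadjoint_op (coercive_approx A n)"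
  unfolding coercive_approx_def by (intro selfadjoint_intros effect_selfadjoint)

lemma coercive_approx_effect: assumes A: "A \<in> effects" shows "coercive_approx A n \<in> effects"
proof -
  have "inverse (real (Suc n)) * (x \<bullet> x - A x \<bullet> x) \<le> 1 * (x \<bullet> x - A x \<bullet> x)" for x
    using A inverse_Suc_le_1 by (intro mult_right_mono) (auto simp: effects_iff)
  moreover have "0 \<le> inverse (real (Suc n)) * (x \<bullet> x - A x \<bullet> x)" for x
    using A by (intro mult_nonneg_nonneg) (auto simp: effects_iff)
  ultimately show ?thesis
    using A coercive_approx_selfadjoint[OF A, of n]
    unfolding effects_iff coercive_approx_form by (auto simp: add_nonneg_nonneg) (smt (verit))
qed

lemma coercive_approx_coercive: assumes A: "A \<in> effects" shows "coercive_op (coercive_approx A n)"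
proof -
  let ?e = "inverse (real (Suc n))"
  have "?e * (x \<bullet> x) \<le> coercive_approx A n x \<bullet> x" for x
  proof -
    have "0 \<le> (1 - ?e) * (A x \<bullet> x)"
      using A inverse_Suc_le_1[of n] by (intro mult_nonneg_nonneg) (auto simp: effects_iff)
    then show ?thesis unfolding coercive_approx_form by (simp add: algebra_simps)
  qed
  moreover have "?e > 0" by simp
  ultimately show ?thesis
    using coercive_approx_selfadjoint[OF A] unfolding coercive_op_def by blast
qed

lemma coercive_approx_decreasing:
  assumes A: "A \<in> effects" and mn: "m \<le> n" shows "coercive_approx A n \<le>\<^sub>o coercive_approx A m"
proof -
  have "inverse (real (Suc n)) * (x \<bullet> x - A x \<bullet> x) \<le> inverse (real (Suc m)) * (x \<bullet> x - A x \<bullet> x)" for x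
    using A mn by (intro mult_right_mono) (auto simp: effects_iff)
  then show ?thesis
    using coercive_approx_selfadjoint[OF A] by (simp add: op_le_iff coercive_approx_form)
qed

lemma coercive_approx_above: assumes A: "A \<in> effects" shows "A \<le>\<^sub>o coercive_approx A n"
  using A coercive_approx_selfadjoint[OF A, of n]
  by (auto simp: op_le_iff coercive_approx_form effects_iff intro!: mult_nonneg_nonneg)

lemma coercive_approx_glb:
  assumes A: "A \<in> effects" and C: "\<And>n. C \<le>\<^sub>o coercive_approx A n" shows "C \<le>\<^sub>o A"
proof -
  have "C x \<bullet> x \<le> A x \<bullet> x" for x
  proof (rule LIMSEQ_le_const)
    have "(\<lambda>n. A x \<bullet> x + inverse (real (Suc n)) * (x \<bullet> x - A x \<bullet> x))
        \<longlonglongrightarrow> A x \<bullet> x + 0 * (x \<bullet> x - A x \<bullet> x)"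
      by (intro tendsto_intros LIMSEQ_inverse_real_of_nat)
    then show "(\<lambda>n. coercive_approx A n x \<bullet> x) \<longlonglongrightarrow> A x \<bullet> x"
      by (simp add: coercive_approx_form)
    show "\<exists>N. \<forall>n\<ge>N. C x \<bullet> x \<le> coercive_approx A n x \<bullet> x"
      using C by (auto simp: op_le_iff)
  qed
  then show ?thesis using C[of 0] A by (simp add: op_le_iff effects_iff)
qed

lemma fp_op_denominator:
  assumes "A \<in> effects" "p < 1" shows "fp_op p A (fp_denominator p A y) = A y"
  by (simp add: fp_op_def fp_denominator_coercive[OF assms])

text \<open>
  The resolvent identity: with \<open>x = K y\<close> for the denominator \<open>K\<close> of \<open>A\<close>, the difference
  \<open>f\<^sub>p(A\<^sub>n) x - f\<^sub>p(A) x\<close> is \<open>1 / (n + 1)\<close> times a vector that stays bounded because the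
  operators \<open>f\<^sub>p(A\<^sub>n)\<close> are contractive.
\<close>

lemma fp_op_continuous:
  assumes A: "A \<in> effects" and p: "p < 1"
    and contr: "\<And>n v. norm (fp_op p (coercive_approx A n) v) \<le> norm v"
  shows "(\<lambda>n. fp_op p (coercive_approx A n) x) \<longlonglongrightarrow> fp_op p A x"
proof -
  define y where "y = op_inv (fp_denominator p A) x"
  have x: "x = fp_denominator p A y" by (simp add: y_def fp_denominator_coercive[OF A p])
  let ?A = "coercive_approx A" and ?e = "\<lambda>n. inverse (real (Suc n))"
  define v where "v = y - A y"
  have diff: "fp_op p (?A n) x - fp_op p A x = ?e n *\<^sub>R (v - p *\<^sub>R fp_op p (?A n) v)" for n
  proof -
    have "fp_denominator p (?A n) y = x + (p * ?e n) *\<^sub>R v"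
      by (simp add: fp_denominator_def x v_def coercive_approx_apply blinfun.add_left
          blinfun.diff_left blinfun.scaleR_left algebra_simps)
    then have "fp_op p (?A n) (x + (p * ?e n) *\<^sub>R v) = ?A n y"
      using fp_op_denominator[OF coercive_approx_effect[OF A] p] by metis
    then have "fp_op p (?A n) x = ?A n y - (p * ?e n) *\<^sub>R fp_op p (?A n) v"
      by (simp add: blinfun.add_right blinfun.scaleR_right algebra_simps)
    moreover have "fp_op p A x = A y" unfolding x by (rule fp_op_denominator[OF A p])
    ultimately show ?thesis
      by (simp add: coercive_approx_apply v_def scaleR_diff_right mult.commute)
  qed
  have bound: "norm (fp_op p (?A n) x - fp_op p A x) \<le> ?e n * ((1 + \<bar>p\<bar>) * norm v)" for n
  proof -
    have "norm (v - p *\<^sub>R fp_op p (?A n) v) \<le> norm v + \<bar>p\<bar> * norm (fp_op p (?A n) v)"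
      by (metis norm_scaleR norm_triangle_ineq4)
    also have "\<dots> \<le> norm v + \<bar>p\<bar> * norm v" by (intro add_left_mono mult_left_mono contr) simp
    finally have "norm (v - p *\<^sub>R fp_op p (?A n) v) \<le> (1 + \<bar>p\<bar>) * norm v" by (simp add: algebra_simps)
    then show ?thesis unfolding diff by (simp add: mult_left_mono)
  qed
  have "(\<lambda>n. ?e n * ((1 + \<bar>p\<bar>) * norm v)) \<longlonglongrightarrow> 0 * ((1 + \<bar>p\<bar>) * norm v)"
    by (intro tendsto_intros LIMSEQ_inverse_real_of_nat)
  then have "(\<lambda>n. ?e n * ((1 + \<bar>p\<bar>) * norm v)) \<longlonglongrightarrow> 0" by simp
  from Lim_null_comparison[OF always_eventually this, of "\<lambda>n. fp_op p (?A n) x - fp_op p A x"]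
  have "(\<lambda>n. fp_op p (?A n) x - fp_op p A x) \<longlonglongrightarrow> 0" using bound by blast
  then show ?thesis by (simp add: LIM_zero_iff)
qed

section \<open>The form of the automorphisms\<close>

lemma
  fixes c :: real assumes c: "c > 0"
  shows coercive_scalar: "coercive_op (c *\<^sub>R (id_blinfun :: 'h::complex_hilbert \<Rightarrow>\<^sub>L 'h))"
    and op_inv_scalar: "op_inv (c *\<^sub>R (id_blinfun :: 'h \<Rightarrow>\<^sub>L 'h)) = (1 / c) *\<^sub>R id_blinfun"
proof -
  show co: "coercive_op (c *\<^sub>R (id_blinfun :: 'h \<Rightarrow>\<^sub>L 'h))"
    unfolding coercive_op_def using c
    by (intro conjI selfadjoint_intros exI[of _ c]) (auto simp: blinfun.scaleR_left)
  show "op_inv (c *\<^sub>R (id_blinfun :: 'h \<Rightarrow>\<^sub>L 'h)) = (1 / c) *\<^sub>R id_blinfun"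
  proof (rule blinfun_eqI)
    fix x :: 'h
    show "op_inv (c *\<^sub>R id_blinfun) x = ((1 / c) *\<^sub>R id_blinfun) x"
      using op_inv_left[OF co, of "(1 / c) *\<^sub>R x"] c by (simp add: blinfun.scaleR_left)
  qed
qed

context effect_automorphism
begin

lemma psi_scalar:
  assumes l: "0 < l" "l < 1" and m: "0 < m" "m < 1"
    and lm: "\<phi> (l *\<^sub>R id_blinfun) = m *\<^sub>R id_blinfun"
  shows "\<psi> ((1 / l - 1) *\<^sub>R id_blinfun) = (1 / m - 1) *\<^sub>R id_blinfun"
proof -
  have "id_blinfun + (1 / l - 1) *\<^sub>R id_blinfun = (1 / l) *\<^sub>R (id_blinfun :: 'h \<Rightarrow>\<^sub>L 'h)"
    by (simp add: scaleR_diff_left)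
  then have "pos_to_effect ((1 / l - 1) *\<^sub>R id_blinfun) = l *\<^sub>R (id_blinfun :: 'h \<Rightarrow>\<^sub>L 'h)"
    using op_inv_scalar[of "1 / l"] l by (simp add: pos_to_effect_def)
  then show ?thesis
    using m by (simp add: \<psi>_def lm effect_to_pos_def op_inv_scalar scaleR_diff_left)
qed

text \<open>
  Wigner's theorem turns the map on lines into an operator \<open>U\<close>. The forms of \<open>\<psi> B\<close> and of \<open>B\<close> then
  correspond under \<open>U\<close> up to the factor \<open>k\<close>, and polarization gives the operators themselves.
\<close>

lemma psi_implementation:
  assumes dim: "cdim_at_least 2 TYPE('h)"
    and l: "0 < l" "l < 1" and m: "0 < m" "m < 1"
    and lm: "\<phi> (l *\<^sub>R id_blinfun) = m *\<^sub>R id_blinfun"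
  obtains U k where "unitary_op U \<or> antiunitary_op U" "\<And>x. norm (U x) = norm x" "k > 0"
    "\<And>B x. 0 \<le>\<^sub>o B \<Longrightarrow> \<psi> B (U x) = k *\<^sub>R U (B x)"
proof -
  have a: "1 / l - 1 > 0" using l by simp
  obtain S k where k: "k > 0" and S: "\<And>B x. 0 \<le>\<^sub>o B \<Longrightarrow> \<psi> B (S x) \<bullet> S x = k * (B x \<bullet> x)"
    and tp: "\<And>x y. cmod (cinner (S x) (S y)) = cmod (cinner x y)" and onto: "\<And>y. \<exists>x c. y = c *\<^sub>C S x"
    using normalized_transport[OF dim psi_scalar[OF l m lm] a] by metis
  obtain U where U: "clinear_op U \<or> antilinear_op U" and iso: "\<And>x. norm (U x) = norm x"
    and US: "\<And>x. \<exists>w. cmod w = 1 \<and> U x = w *\<^sub>C S x"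
    using Wigner[OF tp] by metis
  have "\<exists>x. U x = y" for y
  proof -
    obtain x c where y: "y = c *\<^sub>C S x" using onto by blast
    obtain w where w: "cmod w = 1" "U x = w *\<^sub>C S x" using US by blast
    have "w \<noteq> 0" using w(1) by auto
    then have "y = (c / w) *\<^sub>C U x" by (simp add: y w(2) scaleC_scaleC)
    then have "U ((c / w) *\<^sub>C x) = y \<or> U (cnj (c / w) *\<^sub>C x) = y"
      using U by (auto simp: clinear_op_def antilinear_op_def)
    then show ?thesis by blast
  qed
  then have surj: "surj (blinfun_apply U)" by (metis surjI)
  have form: "\<psi> B (U x) \<bullet> U x = k * (B x \<bullet> x)" if B: "0 \<le>\<^sub>o B" for B x
  proof -
    obtain w where w: "cmod w = 1" "U x = w *\<^sub>C S x" using US by blast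
    show ?thesis
      using psi_pos[OF B] S[OF B, of x] by (simp add: w pos_op_iff selfadjoint_form_scaleC)
  qed
  have "\<psi> B (U x) = k *\<^sub>R U (B x)" if B: "0 \<le>\<^sub>o B" for B x
  proof -
    have sB: "selfadjoint_op B" "selfadjoint_op (\<psi> B)" using B psi_pos[OF B] by (auto simp: pos_op_iff)
    have "(\<psi> B (U x) - k *\<^sub>R U (B x)) \<bullet> U y = 0" for y
    proof -
      have "2 * (\<psi> B (U x) \<bullet> U y) = k * (2 * (B x \<bullet> y))"
        using form[OF B, of "x + y"] form[OF B, of x] form[OF B, of y]
          selfadjoint_inner[OF sB(1), of y x] selfadjoint_inner[OF sB(2), of "U y" "U x"]
        by (simp add: blinfun.add_right inner_simps inner_commute algebra_simps)
      then show ?thesis by (simp add: inner_simps isometry_inner[OF iso])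
    qed
    then have "(\<psi> B (U x) - k *\<^sub>R U (B x)) \<bullet> z = 0" for z by (metis surj surjD)
    from this[of "\<psi> B (U x) - k *\<^sub>R U (B x)"] show ?thesis by simp
  qed
  from that[OF isometry_unitary_or_antiunitary[OF U iso surj] iso k this] show ?thesis .
qed

text \<open>
  Undoing the passage to the cone, \<open>\<psi> B U = k U B\<close> becomes
  \<open>(\<phi> A)\<^sup>-\<^sup>1 U = U ((1 - k) I + k A\<^sup>-\<^sup>1)\<close>, evaluated here at a vector \<open>A y\<close>.
\<close>

lemma phi_on_coercive:
  fixes U :: "'h \<Rightarrow>\<^sub>L 'h"
  assumes U: "\<And>B x. 0 \<le>\<^sub>o B \<Longrightarrow> \<psi> B (U x) = k *\<^sub>R U (B x)" and k: "k > 0"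
    and A: "A \<in> effects" "coercive_op A"
  shows "\<phi> A (U x) = U (fp_op (1 - k) A x)"
proof -
  let ?K = "fp_denominator (1 - k) A"
  have p: "1 - k < 1" using k by simp
  have co: "coercive_op (\<phi> A)" using phi_coercive[OF A(1)] A(2) by simp
  define y where "y = op_inv ?K x"
  have x: "x = ?K y" by (simp add: y_def fp_denominator_coercive[OF A(1) p])
  have "\<psi> (effect_to_pos A) = effect_to_pos (\<phi> A)"
    by (simp add: \<psi>_def effect_to_pos_to_effect[OF A(2)])
  then have "effect_to_pos (\<phi> A) (U (A y)) = k *\<^sub>R U (effect_to_pos A (A y))"
    using U[OF effect_to_pos_pos[OF A]] by metis
  then have "op_inv (\<phi> A) (U (A y)) = U (A y) + k *\<^sub>R U (y - A y)"
    by (simp add: effect_to_pos_def blinfun.diff_left A(2) algebra_simps)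
  also have "\<dots> = U x"
    by (simp add: x fp_denominator_def blinfun.add_left blinfun.add_right blinfun.diff_right
        blinfun.diff_left blinfun.scaleR_left blinfun.scaleR_right algebra_simps)
  finally have "U (A y) = \<phi> A (U x)" using op_inv_right[OF co] by metis
  moreover have "fp_op (1 - k) A x = A y" by (simp add: fp_op_def y_def)
  ultimately show ?thesis by simp
qed

text \<open>
  Let \<open>G\<close> be the claimed image of \<open>A\<close>. On coercive effects the formula is known, so \<open>G\<close> is the limit,
  hence the infimum, of the images of the coercive effects decreasing to \<open>A\<close>. An order automorphism
  preserves infima, so \<open>\<phi> A\<close> is the same infimum.
\<close>

theorem automorphism_form:
  assumes dim: "cdim_at_least 2 TYPE('h)"
    and l: "0 < l" "l < 1" and m: "0 < m" "m < 1"
    and lm: "\<phi> (l *\<^sub>R id_blinfun) = m *\<^sub>R id_blinfun"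
  shows "\<exists>U p. (unitary_op U \<or> antiunitary_op U) \<and> p < 1 \<and>
    (\<forall>A\<in>effects. \<phi> A = U o\<^sub>L cfc (fp_fun p) A o\<^sub>L adj_op U)"
proof -
  obtain U k where U: "unitary_op U \<or> antiunitary_op U" and iso: "\<And>x. norm (U x) = norm x"
    and k: "k > 0" and psi: "\<And>B x. 0 \<le>\<^sub>o B \<Longrightarrow> \<psi> B (U x) = k *\<^sub>R U (B x)"
    using psi_implementation[OF dim l m lm] by metis
  define p where "p = 1 - k"
  have p: "p < 1" using k by (simp add: p_def)
  obtain z :: 'h where z: "z \<noteq> 0" using nonzero_vector_exists[OF dim] .
  note adj = adj_op_inverse[OF U z]
  have co: "\<phi> A (U x) = U (fp_op p A x)" if "A \<in> effects" "coercive_op A" for A x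
    unfolding p_def by (rule phi_on_coercive[OF psi k that])
  have "\<phi> A = U o\<^sub>L fp_op p A o\<^sub>L adj_op U" if A: "A \<in> effects" for A
  proof -
    let ?A = "coercive_approx A"
    let ?G = "U o\<^sub>L fp_op p A o\<^sub>L adj_op U"
    note An = coercive_approx_effect[OF A] coercive_approx_coercive[OF A]
    have G: "?G y = U (fp_op p A (adj_op U y))" for y by simp
    have \<phi>A: "\<phi> (?A n) y = U (fp_op p (?A n) (adj_op U y))" for n y
      using co[OF An, of n "adj_op U y"] by (simp add: adj)
    have contr: "norm (fp_op p (?A n) v) \<le> norm v" for n v
      using effect_norm_le[OF phi_effect[OF An(1)[of n]], of "U v"] co[OF An, of n v] iso by metis
    have lim: "(\<lambda>n. \<phi> (?A n) y) \<longlonglongrightarrow> ?G y" for y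
      unfolding \<phi>A G by (intro tendsto_intros fp_op_continuous[OF A p contr])
    have limf: "(\<lambda>n. \<phi> (?A n) y \<bullet> y) \<longlonglongrightarrow> ?G y \<bullet> y" for y by (intro tendsto_inner lim tendsto_const)
    have Geff: "?G \<in> effects" using phi_effect[OF An(1)] lim by (rule effect_pointwise_limit)
    have "\<phi> A \<le>\<^sub>o \<phi> (?A n)" for n using order[OF A An(1)] coercive_approx_above[OF A] by blast
    then have "\<phi> A y \<bullet> y \<le> ?G y \<bullet> y" for y
      by (intro LIMSEQ_le_const[OF limf]) (auto simp: op_le_iff)
    then have 1: "\<phi> A \<le>\<^sub>o ?G"
      using effect_selfadjoint[OF phi_effect[OF A]] effect_selfadjoint[OF Geff] by (simp add: op_le_iff)
    obtain C where C: "C \<in> effects" "\<phi> C = ?G" using phi_onto[OF Geff] .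
    have "?G \<le>\<^sub>o \<phi> (?A m)" for m
    proof -
      have "\<phi> (?A n) \<le>\<^sub>o \<phi> (?A m)" if "m \<le> n" for n
        using order[OF An(1) An(1)] coercive_approx_decreasing[OF A that] by blast
      then have "?G y \<bullet> y \<le> \<phi> (?A m) y \<bullet> y" for y
        by (intro LIMSEQ_le_const2[OF limf]) (auto simp: op_le_iff)
      then show ?thesis
        using effect_selfadjoint[OF phi_effect[OF An(1)]] effect_selfadjoint[OF Geff]
        by (simp add: op_le_iff)
    qed
    then have "C \<le>\<^sub>o ?A m" for m using order[OF C(1) An(1)] C(2) by simp
    then have "C \<le>\<^sub>o A" by (rule coercive_approx_glb[OF A])
    then have "?G \<le>\<^sub>o \<phi> A" using order[OF C(1) A] C(2) by simp
    then show ?thesis using 1 op_le_antisym by blast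
  qed
  then show ?thesis using U p cfc_fp by metis
qed

lemma phi_id: "\<phi> id_blinfun = id_blinfun"
proof -
  have I: "id_blinfun \<in> effects" by (simp add: effects_iff selfadjoint_id)
  obtain A where A: "A \<in> effects" "\<phi> A = id_blinfun" using phi_onto[OF I] .
  have "A \<le>\<^sub>o id_blinfun" using A by (simp add: effects_def)
  then have "id_blinfun \<le>\<^sub>o \<phi> id_blinfun" using order[OF A(1) I] A(2) by simp
  moreover have "\<phi> id_blinfun \<le>\<^sub>o id_blinfun" using phi_effect[OF I] by (simp add: effects_def)
  ultimately show ?thesis using op_le_antisym by blast
qed

end

text \<open>
  An operator commuting with all rank-one projections has every vector as an eigenvector.
\<close>

lemma commuting_with_effects_imp_scalar:
  fixes T :: "'h::complex_hilbert \<Rightarrow>\<^sub>L 'h"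
  assumes T: "T \<in> effects" and comm: "\<And>B. B \<in> effects \<Longrightarrow> T o\<^sub>L B = B o\<^sub>L T"
  obtains m where "0 \<le> m" "m \<le> 1" "T = m *\<^sub>R id_blinfun"
proof (cases "\<exists>z :: 'h. z \<noteq> 0")
  case False
  have "T = 0 *\<^sub>R id_blinfun" by (rule blinfun_eqI) (use False in auto)
  then show ?thesis using that[of 0] by simp
next
  case True
  then obtain z :: 'h where z: "z \<noteq> 0" by blast
  note sT = effect_selfadjoint[OF T]
  have eig: "\<exists>c. T x = c *\<^sub>C x" for x
  proof (cases "x = 0")
    case False
    define u where "u = (1 / norm x) *\<^sub>R x"
    have u: "norm u = 1" "x = of_real (norm x) *\<^sub>C u" using False by (simp_all add: u_def scaleC_of_real)
    have "T (rank1 u u) = rank1 u (T u)"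
      using comm[OF rank1_effect, of u] u(1) by (metis blinfun_apply_blinfun_compose order_refl)
    then have "T u = cinner (T u) u *\<^sub>C u" using u(1) by (simp add: rank1_apply cinner_self)
    then have "T x = cinner (T u) u *\<^sub>C x"
      by (metis u(2) scaleC_scaleC mult.commute selfadjoint_scaleC[OF sT])
    then show ?thesis by blast
  qed simp
  obtain c where c: "T z = c *\<^sub>C z" using eig by blast
  have Ty: "T y = c *\<^sub>C y" for y
  proof -
    obtain a w where y: "y = a *\<^sub>C z + w" "cinner w z = 0" by (rule orthogonal_split)
    have "T w = c *\<^sub>C w"
    proof (cases "w = 0")
      case False
      obtain b where b: "T w = b *\<^sub>C w" using eig by blast
      obtain d where d: "T (z + w) = d *\<^sub>C (z + w)" using eig by blast
      have zw: "cinner z w = 0" using y(2) by (simp add: cinner_eq_0_commute)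
      have eq: "c *\<^sub>C z + b *\<^sub>C w = d *\<^sub>C z + d *\<^sub>C w"
        using d by (simp add: blinfun.add_right c b scaleC_add_right)
      from arg_cong[OF eq, of "\<lambda>v. cinner v z"] have "c = d"
        using z y(2) by (simp add: cinner_simps cinner_self)
      moreover from arg_cong[OF eq, of "\<lambda>v. cinner v w"] have "b = d"
        using False zw by (simp add: cinner_simps cinner_self)
      ultimately show ?thesis using b by simp
    qed simp
    then show ?thesis
      by (simp add: y(1) blinfun.add_right selfadjoint_scaleC[OF sT] c scaleC_add_right scaleC_scaleC
          mult.commute)
  qed
  have zz: "Re (cinner z z) > 0" using z by (simp add: cinner_self flip: of_real_power)
  have "c * cinner z z = cnj c * cinner z z"
    using selfadjoint_cinner[OF sT, of z z] by (simp add: c cinner_simps)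
  then have "c = cnj c" using zz by auto
  then have cr: "c = of_real (Re c)" by (simp add: complex_eq_iff)
  have eq: "T = Re c *\<^sub>R id_blinfun"
    by (rule blinfun_eqI) (use Ty cr in \<open>metis blinfun.scaleR_left blinfun_apply_id_blinfun scaleC_of_real\<close>)
  have "0 \<le> Re c * (z \<bullet> z)" "Re c * (z \<bullet> z) \<le> 1 * (z \<bullet> z)" and "z \<bullet> z > 0"
    using T z by (simp_all add: effects_iff eq blinfun.scaleR_left)
  then have "0 \<le> Re c" "Re c \<le> 1" by (simp_all only: zero_le_mult_iff mult_le_cancel_right_pos) auto
  then show ?thesis using that eq by blast
qed

theorem corollary3:
  assumes "cdim_at_least 2 TYPE('h::complex_hilbert)"
  shows
    "(\<forall>\<phi> :: ('h \<Rightarrow>\<^sub>L 'h) \<Rightarrow> ('h \<Rightarrow>\<^sub>L 'h).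
        bij_betw \<phi> effects effects \<longrightarrow>
        (\<forall>A\<in>effects. \<forall>B\<in>effects. A \<le>\<^sub>o B \<longleftrightarrow> \<phi> A \<le>\<^sub>o \<phi> B) \<longrightarrow>
        (\<exists>l\<in>{0<..<1}. \<exists>m\<in>{0<..<1}. \<phi> (l *\<^sub>R id_blinfun) = m *\<^sub>R id_blinfun) \<longrightarrow>
        (\<exists>U p. (unitary_op U \<or> antiunitary_op U) \<and> p < 1 \<and>
           (\<forall>A\<in>effects. \<phi> A = U o\<^sub>L cfc (fp_fun p) A o\<^sub>L adj_op U)))
     \<and>
     (\<forall>\<phi> :: ('h \<Rightarrow>\<^sub>L 'h) \<Rightarrow> ('h \<Rightarrow>\<^sub>L 'h).
        bij_betw \<phi> effects effects \<longrightarrow>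
        (\<forall>A\<in>effects. \<forall>B\<in>effects. A \<le>\<^sub>o B \<longleftrightarrow> \<phi> A \<le>\<^sub>o \<phi> B) \<longrightarrow>
        (\<forall>A\<in>effects. \<forall>B\<in>effects. A o\<^sub>L B = B o\<^sub>L A \<longleftrightarrow> \<phi> A o\<^sub>L \<phi> B = \<phi> B o\<^sub>L \<phi> A) \<longrightarrow>
        (\<exists>U p. (unitary_op U \<or> antiunitary_op U) \<and> p < 1 \<and>
           (\<forall>A\<in>effects. \<phi> A = U o\<^sub>L cfc (fp_fun p) A o\<^sub>L adj_op U)))"
proof (intro conjI allI impI)
  fix \<phi> :: "('h \<Rightarrow>\<^sub>L 'h) \<Rightarrow> ('h \<Rightarrow>\<^sub>L 'h)"
  assume bij: "bij_betw \<phi> effects effects"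
    and order: "\<forall>A\<in>effects. \<forall>B\<in>effects. A \<le>\<^sub>o B \<longleftrightarrow> \<phi> A \<le>\<^sub>o \<phi> B"
  interpret effect_automorphism \<phi> by unfold_locales (use bij order in auto)
  let ?conclusion = "\<exists>U p. (unitary_op U \<or> antiunitary_op U) \<and> p < 1 \<and>
    (\<forall>A\<in>effects. \<phi> A = U o\<^sub>L cfc (fp_fun p) A o\<^sub>L adj_op U)"
  show ?conclusion
    if "\<exists>l\<in>{0<..<1}. \<exists>m\<in>{0<..<1}. \<phi> (l *\<^sub>R id_blinfun) = m *\<^sub>R id_blinfun"
    using that automorphism_form[OF assms] by (metis greaterThanLessThan_iff)
  show ?conclusion
    if comm: "\<forall>A\<in>effects. \<forall>B\<in>effects. A o\<^sub>L B = B o\<^sub>L A \<longleftrightarrow> \<phi> A o\<^sub>L \<phi> B = \<phi> B o\<^sub>L \<phi> A"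
  proof -
    let ?I = "id_blinfun :: 'h \<Rightarrow>\<^sub>L 'h"
    let ?h = "(1 / 2) *\<^sub>R ?I"
    have I: "?I \<in> effects" by (simp add: effects_iff selfadjoint_id)
    have h: "?h \<in> effects" using I by (rule scaleR_effect) auto
    have "\<phi> ?h o\<^sub>L B = B o\<^sub>L \<phi> ?h" if B: "B \<in> effects" for B
    proof -
      obtain A where A: "A \<in> effects" "\<phi> A = B" using phi_onto[OF B] .
      have "?h o\<^sub>L A = A o\<^sub>L ?h"
        by (rule blinfun_eqI) (simp add: blinfun.scaleR_left blinfun.scaleR_right)
      then show ?thesis using comm h A by blast
    qed
    then obtain m where m: "0 \<le> m" "m \<le> 1" "\<phi> ?h = m *\<^sub>R ?I"
      using commuting_with_effects_imp_scalar[OF phi_effect[OF h]] by metis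
    obtain z :: 'h where z: "z \<noteq> 0" using nonzero_vector_exists[OF assms] .
    have "?h z \<noteq> 0" "?h z \<noteq> ?I z"
      using z scaleR_cancel_right[of "1 / 2" z 1] by (simp_all add: blinfun.scaleR_left)
    then have "?h \<noteq> 0" "?h \<noteq> ?I" by auto
    then have "\<phi> ?h \<noteq> 0" "\<phi> ?h \<noteq> ?I"
      using phi_inj[OF h zero_effect] phi_inj[OF h I] by (simp_all add: phi_zero phi_id)
    then have "m \<noteq> 0" "m \<noteq> 1" using m(3) by auto
    then show ?thesis using automorphism_form[OF assms, of "1 / 2" m] m by simp
  qed
qed

end
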